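(* Let $p\ge 2$ and let $Q$ be a quantile function in $\mathbb{L}^p$. Let $\mathbf{Y}=(Y_i)_{i\in\mathbb{Z}}$, $Y_i=Y_0\circ T^i$, be the stationary sequence described in the context, and denote by $P_{Y_0}$ the distribution of $Y_0$. Let $X_i=f(Y_i)-\mathbb{E}(f(Y_i))$, where $f$ belongs to $\widetilde{\mathcal{F}}(Q,P_{Y_0})$, and let $S_n=\sum_{k=1}^n X_k$. Then there exists a constant $C>0$ not depending on $n$ such that, for all positive integers $n$, $$\Big\|\max_{1\le k\le n}|S_k|\Big\|_p^p\le C\left\{ n^{p/2}\left(\int_0^1(\alpha_{1,\mathbf{Y}}^{-1}(u)\wedge n)\,Q^2(u)\,du\right)^{p/2}+n\int_0^1(\alpha_{2,\mathbf{Y}}^{-1}(u)\wedge n)^{p-1}Q^p(u)\,du\right\}.$$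
   Context: Stationary sequence. $(\Omega,\mathcal{A},\mathbb{P})$ is a probability space, $T:\Omega\to\Omega$ is a bijective bi-measurable transformation preserving $\mathbb{P}$, and $\mathcal{F}_0\subseteq\mathcal{A}$ is a sub-$\sigma$-algebra with $\mathcal{F}_0\subseteq T^{-1}(\mathcal{F}_0)$. $Y_0$ is an $\mathcal{F}_0$-measurable integrable real-valued random variable with distribution $P_{Y_0}$, and $Y_i=Y_0\circ T^i$ for $i\in\mathbb{Z}$. Dependency coefficients. For an integrable random variable $Z$ put $Z^{(0)}=Z-\mathbb{E}(Z)$. For a random vector $V=(V_1,\dots,V_k)$ in $\mathbb{R}^k$ and a $\sigma$-algebra $\mathcal{F}$ let $$\alpha(\mathcal{F},V)=\sup_{(x_1,\dots,x_k)\in\mathbb{R}^k}\Big\|\mathbb{E}\Big(\prod_{j=1}^k(\mathbf{1}_{V_j\le x_j})^{(0)}\Big|\mathcal{F}\Big)-\mathbb{E}\Big(\prod_{j=1}^k(\mathbf{1}_{V_j\le x_j})^{(0)}\Big)\Big\|_1 .$$ For $k\ge1$ let $\alpha_{k,\mathbf{Y}}(0)=1/2$ and, for $n>0$, $\alpha_{k,\mathbf{Y}}(n)=\max_{1\le l\le k}\ \sup_{n\le i_1\le\dots\le i_l}\alpha(\mathcal{F}_0,(Y_{i_1},\dots,Y_{i_l}))$. For $u\in[0,1]$ let $\alpha_{k,\mathbf{Y}}^{-1}(u)=\min\{q\in\mathbb{N}:\alpha_{k,\mathbf{Y}}(q)\le u\}=\sum_{n=0}^\infty\mathbf{1}_{u<\alpha_{k,\mathbf{Y}}(n)}$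 (possibly $+\infty$; here $\mathbb{N}$ contains $0$). Quantile functions. A tail function is a function $H:\mathbb{R}^+\to[0,1]$ that is non-increasing, right-continuous and converges to $0$ at infinity. The associated quantile function is $Q=H^{-1}$, $Q(u)=\inf\{t\ge0:H(t)\le u\}$ for $u\in[0,1]$, with $\inf\emptyset=\infty$. $Q$ belongs to $\mathbb{L}^p$ if $\int_0^1Q^p(u)\,du<\infty$; it is integrable if it belongs to $\mathbb{L}^1$. Function classes. For a probability measure $\mu$ on $\mathbb{R}$ and an integrable quantile function $Q=H^{-1}$, $\widetilde{\mathrm{Mon}}(Q,\mu)$ is the set of functions $g$ which are monotonic on some open interval of $\mathbb{R}$ and null elsewhere and such that $\mu(|g|>t)\le H(t)$ for all $t\in\mathbb{R}^+$. $\widetilde{\mathcal{F}}(Q,\mu)$ is the closure in $\mathbb{L}^1(\mu)$ of the set of functions of the form $\sum_{\ell=1}^L a_\ell f_\ell$ with $\sum_{\ell=1}^L|a_\ell|\le1$ and $f_\ell\in\widetilde{\mathrm{Mon}}(Q,\mu)$. Notation: $a\wedge b=\min(a,b)$; $\|\cdot\|_p$ is the $\mathbb{L}^p(\mathbb{P})$ norm. *)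

theory Defs
  imports "HOL-Probability.Probability"
begin

text \<open>Real powers on \<open>[0, \<infinity>]\<close>; only used with exponents \<open>r > 0\<close>, hence \<open>\<infinity>\<close> to the power \<open>r\<close> is
  \<open>\<infinity>\<close>.\<close>

definition epowr :: "ennreal \<Rightarrow> real \<Rightarrow> ennreal" where
  "epowr x r = (if x = top then top else ennreal (enn2real x powr r))"

definition lp_norm :: "'a measure \<Rightarrow> real \<Rightarrow> ('a \<Rightarrow> real) \<Rightarrow> ennreal" where
  "lp_norm M p Z = epowr (\<integral>\<^sup>+\<omega>. ennreal (\<bar>Z \<omega>\<bar> powr p) \<partial>M) (1 / p)"


subsection \<open>The stationary sequence\<close>

definition bimeasurable_preserving :: "'a measure \<Rightarrow> ('a \<Rightarrow> 'a) \<Rightarrow> bool" where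
  "bimeasurable_preserving M T \<longleftrightarrow>
     bij_betw T (space M) (space M) \<and>
     T \<in> measurable M M \<and> inv_into (space M) T \<in> measurable M M \<and>
     distr M M T = M"

definition int_iterate :: "'a measure \<Rightarrow> ('a \<Rightarrow> 'a) \<Rightarrow> int \<Rightarrow> 'a \<Rightarrow> 'a" where
  "int_iterate M T i =
     (if 0 \<le> i then T ^^ nat i else inv_into (space M) T ^^ nat (- i))"

definition orbit_seq :: "'a measure \<Rightarrow> ('a \<Rightarrow> 'a) \<Rightarrow> ('a \<Rightarrow> real) \<Rightarrow> int \<Rightarrow> 'a \<Rightarrow> real" where
  "orbit_seq M T Y0 i = (\<lambda>\<omega>. Y0 (int_iterate M T i \<omega>))"

definition centred :: "'a measure \<Rightarrow> ('a \<Rightarrow> real) \<Rightarrow> 'a \<Rightarrow> real" where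
  "centred M Z = (\<lambda>\<omega>. Z \<omega> - integral\<^sup>L M Z)"


subsection \<open>Dependency coefficients\<close>

text \<open>The vector \<open>(V\<^sub>1, \<dots>, V\<^sub>k)\<close> is a family indexed by \<open>nat\<close>, as is the point \<open>(x\<^sub>1, \<dots>, x\<^sub>k)\<close>;
  only the entries with index in \<open>{1..k}\<close> are used.\<close>

definition centred_indicator_prod ::
  "'a measure \<Rightarrow> nat \<Rightarrow> (nat \<Rightarrow> 'a \<Rightarrow> real) \<Rightarrow> (nat \<Rightarrow> real) \<Rightarrow> 'a \<Rightarrow> real" where
  "centred_indicator_prod M k V x =
     (\<lambda>\<omega>. \<Prod>j\<in>{1..k}. centred M (indicat_real {\<omega>. V j \<omega> \<le> x j}) \<omega>)"

definition alpha :: "'a measure \<Rightarrow> 'a measure \<Rightarrow> nat \<Rightarrow> (nat \<Rightarrow> 'a \<Rightarrow> real) \<Rightarrow> ennreal" where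
  "alpha M F k V =
     (SUP x. lp_norm M 1 (\<lambda>\<omega>.
        real_cond_exp M F (centred_indicator_prod M k V x) \<omega>
        - integral\<^sup>L M (centred_indicator_prod M k V x)))"

definition alpha_seq ::
  "'a measure \<Rightarrow> 'a measure \<Rightarrow> (int \<Rightarrow> 'a \<Rightarrow> real) \<Rightarrow> nat \<Rightarrow> nat \<Rightarrow> ennreal" where
  "alpha_seq M F0 Y k n =
     (if n = 0 then ennreal (1 / 2)
      else (MAX l\<in>{1..k}.
              SUP i\<in>{i :: nat \<Rightarrow> int. int n \<le> i 1 \<and> mono_on {1..l} i}.
                alpha M F0 l (\<lambda>j. Y (i j))))"

definition alpha_inv :: "(nat \<Rightarrow> ennreal) \<Rightarrow> real \<Rightarrow> enat" where
  "alpha_inv a u = Inf {enat q | q. a q \<le> ennreal u}"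


subsection \<open>Tail and quantile functions\<close>

text \<open>Tail functions live on \<open>[0, \<infinity>)\<close>; the values of \<open>H\<close> at negative arguments play no role.\<close>

definition tail_function :: "(real \<Rightarrow> real) \<Rightarrow> bool" where
  "tail_function H \<longleftrightarrow>
     (\<forall>t\<ge>0. H t \<in> {0..1}) \<and> antimono_on {0..} H \<and>
     (\<forall>t\<ge>0. continuous (at_right t) H) \<and> (H \<longlongrightarrow> 0) at_top"

definition quantile_of :: "(real \<Rightarrow> real) \<Rightarrow> real \<Rightarrow> ennreal" where
  "quantile_of H u = Inf {ennreal t | t. 0 \<le> t \<and> H t \<le> u}"

definition quantile_in_Lp :: "real \<Rightarrow> (real \<Rightarrow> ennreal) \<Rightarrow> bool" where
  "quantile_in_Lp p Q \<longleftrightarrow> (\<integral>\<^sup>+u\<in>{0..1}. epowr (Q u) p \<partial>lborel) < \<infinity>"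


subsection \<open>Function classes\<close>

text \<open>The classes attached to the quantile function \<open>Q\<close> are parametrised by the tail function
  \<open>H\<close> with \<open>Q = quantile_of H\<close>. Open intervals may be unbounded.\<close>

definition Mon_class :: "(real \<Rightarrow> real) \<Rightarrow> real measure \<Rightarrow> (real \<Rightarrow> real) set" where
  "Mon_class H \<mu> =
     {g. (\<exists>I. open I \<and> is_interval I \<and> (mono_on I g \<or> antimono_on I g) \<and> (\<forall>x. x \<notin> I \<longrightarrow> g x = 0)) \<and>
         (\<forall>t\<ge>0. measure \<mu> {x \<in> space \<mu>. \<bar>g x\<bar> > t} \<le> H t)}"

definition Mon_combinations :: "(real \<Rightarrow> real) \<Rightarrow> real measure \<Rightarrow> (real \<Rightarrow> real) set" where
  "Mon_combinations H \<mu> =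
     {(\<lambda>x. \<Sum>l\<in>{1..L}. a l * g l x) | (L :: nat) (a :: nat \<Rightarrow> real) (g :: nat \<Rightarrow> real \<Rightarrow> real).
        (\<Sum>l\<in>{1..L}. \<bar>a l\<bar>) \<le> 1 \<and> (\<forall>l\<in>{1..L}. g l \<in> Mon_class H \<mu>)}"

definition F_class :: "(real \<Rightarrow> real) \<Rightarrow> real measure \<Rightarrow> (real \<Rightarrow> real) set" where
  "F_class H \<mu> =
     {f. integrable \<mu> f \<and>
         (\<forall>\<epsilon>>0. \<exists>h\<in>Mon_combinations H \<mu>. (\<integral>\<^sup>+x. ennreal \<bar>f x - h x\<bar> \<partial>\<mu>) < ennreal \<epsilon>)}"

end

theory Submission
  imports Defs
begin

text \<open>
  The proof bounds, for every \<open>x > 0\<close>, the probability that \<open>max |S k|\<close> exceeds a constant times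
  \<open>x\<close> by a variance term \<open>(n A / x\<^sup>2)\<^sup>p\<close>, where \<open>A\<close> is the integral of \<open>(\<alpha>\<^sub>1\<inverse> \<and> n) Q\<^sup>2\<close>,
  plus \<open>n / x\<close> times the integral of \<open>Q\<close> over the set where \<open>x \<le> (\<alpha>\<^sub>2\<inverse> \<and> n) Q\<close>, and then
  integrates against \<open>p x\<^sup>p\<^sup>-\<^sup>1\<close>. The truncation level depends on \<open>x\<close>; this is why the second
  term of the inequality is a plain integral of \<open>(\<alpha>\<^sub>2\<inverse>)\<^sup>p\<^sup>-\<^sup>1 Q\<^sup>p\<close>, without loss.

  By approximation \<open>f\<close> may be replaced by a finite combination of indicators of intervals
  (\<open>F_class_step_form\<close>): a function that is monotone on an interval is the superposition of the
  indicators of its level sets, and a budget condition on the coefficients records that those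
  of level at most \<open>x\<close> add up to at most \<open>2 x\<close>. Given \<open>x\<close>, a block length \<open>q\<close>, a
  probability \<open>v\<close> and a level \<open>K\<close> are chosen such that \<open>q K \<le> x\<close>, \<open>H K \<le> v\<close> and
  \<open>\<alpha>\<^sub>2 q \<le> v\<close> (or \<open>q = n\<close>, where a single block suffices), while every \<open>u < v\<close> with
  \<open>u \<le> 1/4\<close> lies in the set just mentioned (\<open>choice_of_levels\<close>). The layers above \<open>K\<close>
  have mean of the order of the integral of \<open>Q\<close> over \<open>[0, v]\<close>. The layers below \<open>K\<close> are summed in blocks of length \<open>q\<close>, which are bounded by
  a multiple of \<open>x\<close>; subtracting from each block its conditional expectation given the past one
  block earlier turns the even and the odd blocks into two martingales. The expected size of
  the subtracted terms and the expected fluctuation of the conditional variances are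
  controlled by \<open>\<alpha>\<^sub>1 q\<close> and \<open>\<alpha>\<^sub>2 q\<close>, and the variance of a block by \<open>q A\<close> through the
  covariance inequality for indicators (\<open>cov_indicators\<close>, \<open>block_variance\<close>).

  The martingales are treated in \<open>deviation\<close>. As long as the accumulated conditional variance is of the
  order of its mean, an exponential inequality with increments bounded by a multiple of \<open>x\<close>
  gives the variance term with the power \<open>p\<close>. The increments after that time are controlled in
  mean square, at the price of the expected excess of the conditional variance only, and that
  excess is again of the order of \<open>n / x\<close> times the integral of \<open>Q\<close>.
\<close>

section \<open>Tail functions and their quantiles\<close>

lemma quantile_ge:
  assumes "tail_function H" "0 \<le> t" "u < H t"
  shows "ennreal t \<le> quantile_of H u"
proof -
  have "t \<le> s" if "0 \<le> s" "H s \<le> u" for s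
  proof (rule ccontr)
    assume "\<not> t \<le> s"
    moreover have "antimono_on {0..} H" using assms by (simp add: tail_function_def)
    ultimately have "H t \<le> H s" using that(1) assms(2) by (auto simp: monotone_on_def)
    then show False using that assms by simp
  qed
  then show ?thesis unfolding quantile_of_def by (intro Inf_greatest) (auto intro!: ennreal_leI)
qed

lemma quantile_antimono: "u \<le> v \<Longrightarrow> quantile_of H v \<le> quantile_of H u"
  unfolding quantile_of_def by (intro Inf_superset_mono) (auto intro: order_trans)

lemma borel_measurable_antimono_linorder:
  fixes g :: "real \<Rightarrow> 'b::{second_countable_topology, linorder_topology}"
  assumes "\<And>u v. u \<le> v \<Longrightarrow> g v \<le> g u"
  shows "g \<in> borel_measurable borel"
proof (rule borel_measurableI_greater)
  fix y
  have "is_interval {x. y < g x}"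
    unfolding is_interval_1 using assms by (auto intro: less_le_trans)
  then have "{x. y < g x} \<in> sets borel" by (rule real_interval_borel_measurable)
  then show "{x \<in> space borel. y < g x} \<in> sets borel" by simp
qed

lemma quantile_measurable [measurable]: "quantile_of H \<in> borel_measurable borel"
  by (rule borel_measurable_antimono_linorder) (rule quantile_antimono)

text \<open>The infimum defining the quantile is attained because a tail function is right-continuous.
  The truncation level used later is such an attained value.\<close>

lemma quantile_attained:
  assumes H: "tail_function H" and "quantile_of H v \<le> ennreal s" "0 \<le> s"
  obtains K where "0 \<le> K" "K \<le> s" "quantile_of H v = ennreal K" "H K \<le> v"
proof -
  define K where "K = enn2real (quantile_of H v)"
  have top: "quantile_of H v \<noteq> top" using assms(2) by (auto simp: top_unique)
  have K: "quantile_of H v = ennreal K" unfolding K_def using top by (simp add: less_top)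
  have K0: "0 \<le> K" by (simp add: K_def)
  have Ks: "K \<le> s" using assms K by (simp add: K0)
  have anti: "antimono_on {0..} H" and cont: "continuous (at_right K) H"
    using H K0 by (auto simp: tail_function_def)
  have above: "H t \<le> v" if "K < t" for t
  proof -
    have "quantile_of H v < ennreal t" using K K0 that by (simp add: ennreal_less_iff)
    then obtain s where s: "0 \<le> s" "H s \<le> v" "ennreal s < ennreal t"
      unfolding quantile_of_def Inf_less_iff by auto
    have "s \<le> t" using s ennreal_less_iff by fastforce
    then have "H t \<le> H s" using anti s K0 that by (auto simp: monotone_on_def)
    then show ?thesis using s by simp
  qed
  have "(H \<longlongrightarrow> H K) (at_right K)" using cont by (simp add: continuous_within)
  moreover have "eventually (\<lambda>t. H t \<le> v) (at_right K)"
    using above by (auto simp: eventually_at_right_field intro!: exI[of _ "K + 1"])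
  ultimately have "H K \<le> v" by (rule tendsto_upperbound) simp
  then show thesis using that K0 Ks K by blast
qed

text \<open>Comparing an integral over \<open>[0, b]\<close> with one over \<open>[0, b/4]\<close> absorbs the numerical factors
  in the mixing inequalities, and the discrepancy between \<open>1/2\<close> and \<open>1\<close> as the upper end of
  the range of \<open>u\<close>.\<close>

lemma nn_integral_antimono_quarter:
  fixes \<phi> :: "real \<Rightarrow> ennreal"
  assumes "\<And>u v. u \<le> v \<Longrightarrow> \<phi> v \<le> \<phi> u"
  shows "(\<integral>\<^sup>+u\<in>{0..b}. \<phi> u \<partial>lborel) \<le> 4 * (\<integral>\<^sup>+u\<in>{0..b/4}. \<phi> u \<partial>lborel)"
proof -
  have m [measurable]: "\<phi> \<in> borel_measurable borel" by (rule borel_measurable_antimono_linorder) fact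
  have "(\<integral>\<^sup>+u\<in>{0..b}. \<phi> u \<partial>lborel) = \<bar>4::real\<bar> * (\<integral>\<^sup>+u. \<phi> (0 + 4 * u) * indicator {0..b} (0 + 4 * u) \<partial>lborel)"
    by (rule nn_integral_real_affine) auto
  also have "\<dots> \<le> 4 * (\<integral>\<^sup>+u\<in>{0..b/4}. \<phi> u \<partial>lborel)"
  proof -
    have "(\<integral>\<^sup>+u. \<phi> (0 + 4 * u) * indicator {0..b} (0 + 4 * u) \<partial>lborel) \<le> (\<integral>\<^sup>+u\<in>{0..b/4}. \<phi> u \<partial>lborel)"
      by (rule nn_integral_mono) (auto simp: indicator_def intro!: assms)
    then show ?thesis by (auto intro: mult_left_mono)
  qed
  finally show ?thesis .
qed

section \<open>Step forms\<close>

text \<open>A step form is a finite combination of indicators of intervals, each carrying a level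
  \<open>t\<close> with \<open>\<mu> J \<le> H t\<close>. The budget condition says that the coefficients of level at most
  \<open>x\<close> add up to at most \<open>2x\<close>, as they do in the layer-cake decomposition of a function
  into the indicators of its level sets \<open>{g > t}\<close> and \<open>{g < -t}\<close>; it is the only
  trace of the function class that the estimates need.\<close>

definition step_form ::
  "(real \<Rightarrow> real) \<Rightarrow> real measure \<Rightarrow> 'i set \<Rightarrow> ('i \<Rightarrow> real) \<Rightarrow> ('i \<Rightarrow> real) \<Rightarrow> ('i \<Rightarrow> real set) \<Rightarrow> bool" where
  "step_form H \<mu> I c t J \<longleftrightarrow>
     finite I \<and> (\<forall>\<iota>\<in>I. is_interval (J \<iota>) \<and> 0 < t \<iota> \<and> measure \<mu> (J \<iota>) \<le> H (t \<iota>)) \<and>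
     (\<forall>x\<ge>0. (\<Sum>\<iota>\<in>{\<iota>\<in>I. t \<iota> \<le> x}. \<bar>c \<iota>\<bar>) \<le> 2 * x)"

lemma budget_quantile:
  assumes H: "tail_function H" and F: "step_form H \<mu> I c t J"
  shows "ennreal (\<Sum>\<iota>\<in>{\<iota>\<in>I. u < H (t \<iota>)}. \<bar>c \<iota>\<bar>) \<le> 2 * quantile_of H u"
proof (cases "quantile_of H u = top")
  case True
  then show ?thesis by (simp add: ennreal_mult_top)
next
  case False
  define x where "x = enn2real (quantile_of H u)"
  have x: "quantile_of H u = ennreal x" "0 \<le> x" using False by (simp_all add: x_def less_top)
  have "t \<iota> \<le> x" if "\<iota> \<in> I" "u < H (t \<iota>)" for \<iota>
    using quantile_ge[OF H _ that(2)] F that x by (auto simp: step_form_def less_imp_le)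
  then have "(\<Sum>\<iota>\<in>{\<iota>\<in>I. u < H (t \<iota>)}. \<bar>c \<iota>\<bar>) \<le> (\<Sum>\<iota>\<in>{\<iota>\<in>I. t \<iota> \<le> x}. \<bar>c \<iota>\<bar>)"
    using F by (intro sum_mono2) (auto simp: step_form_def)
  also have "\<dots> \<le> 2 * x" using F x by (auto simp: step_form_def)
  finally show ?thesis
    by (metis x ennreal_leI ennreal_mult' ennreal_numeral zero_le_numeral)
qed

lemma ennreal_min_eq_nn_integral:
  assumes "0 \<le> b" "b \<le> 1"
  shows "ennreal b = (\<integral>\<^sup>+u\<in>{0..1}. indicator {..<b} u \<partial>lborel)"
proof -
  have "(\<integral>\<^sup>+u\<in>{0..1}. indicator {..<b} u \<partial>lborel) = (\<integral>\<^sup>+u. indicator {0..<b} u \<partial>lborel)"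
    using assms by (intro nn_integral_cong) (auto simp: indicator_def)
  then show ?thesis using assms by simp
qed

text \<open>The mass of the levels above a truncation point \<open>K\<close> with \<open>H K \<le> v\<close>: write
  \<open>H (t \<iota>)\<close> as the length of \<open>{u. u < H (t \<iota>)}\<close>, which lies below \<open>v\<close>, and use the budget for each \<open>u\<close>.\<close>

lemma step_form_tail_mass:
  assumes H: "tail_function H" and F: "step_form H \<mu> I c t J" and K: "0 \<le> K" "H K \<le> v"
  shows "ennreal (\<Sum>\<iota>\<in>{\<iota>\<in>I. K < t \<iota>}. \<bar>c \<iota>\<bar> * H (t \<iota>))
    \<le> 2 * (\<integral>\<^sup>+u\<in>{0..1}. quantile_of H u * indicator {..<v} u \<partial>lborel)"
proof -
  let ?I = "{\<iota>\<in>I. K < t \<iota>}"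
  have fin: "finite ?I" using F by (simp add: step_form_def)
  have H01: "0 \<le> H (t \<iota>)" "H (t \<iota>) \<le> 1" if "\<iota> \<in> I" for \<iota>
    using H F that by (auto simp: tail_function_def step_form_def less_imp_le)
  have Hv: "H (t \<iota>) \<le> v" if "\<iota> \<in> ?I" for \<iota>
  proof -
    have "H (t \<iota>) \<le> H K" using H K that by (auto simp: tail_function_def monotone_on_def)
    then show ?thesis using K by simp
  qed
  have "ennreal (\<Sum>\<iota>\<in>?I. \<bar>c \<iota>\<bar> * H (t \<iota>)) = (\<Sum>\<iota>\<in>?I. ennreal \<bar>c \<iota>\<bar> * ennreal (H (t \<iota>)))"
    using H01 by (subst sum_ennreal[symmetric]) (auto intro!: sum.cong simp: ennreal_mult')
  also have "\<dots> = (\<Sum>\<iota>\<in>?I. ennreal \<bar>c \<iota>\<bar> * (\<integral>\<^sup>+u\<in>{0..1}. indicator {..<H (t \<iota>)} u \<partial>lborel))"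
    using H01 by (intro sum.cong refl) (subst ennreal_min_eq_nn_integral, auto)
  also have "\<dots> = (\<integral>\<^sup>+u\<in>{0..1}. (\<Sum>\<iota>\<in>?I. ennreal \<bar>c \<iota>\<bar> * indicator {..<H (t \<iota>)} u) \<partial>lborel)"
    by (simp add: nn_integral_sum nn_integral_cmult[symmetric] sum_distrib_right mult.assoc)
  also have "\<dots> \<le> (\<integral>\<^sup>+u\<in>{0..1}. 2 * (quantile_of H u * indicator {..<v} u) \<partial>lborel)"
  proof (intro nn_integral_mono mult_right_mono)
    fix u :: real
    show "(\<Sum>\<iota>\<in>?I. ennreal \<bar>c \<iota>\<bar> * indicator {..<H (t \<iota>)} u) \<le> 2 * (quantile_of H u * indicator {..<v} u)"
    proof (cases "u < v")
      case True
      have "(\<Sum>\<iota>\<in>?I. ennreal \<bar>c \<iota>\<bar> * indicator {..<H (t \<iota>)} u) = (\<Sum>\<iota>\<in>?I. ennreal (if u < H (t \<iota>) then \<bar>c \<iota>\<bar> else 0))"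
        by (intro sum.cong) (auto simp: indicator_def)
      also have "\<dots> = ennreal (\<Sum>\<iota>\<in>?I. if u < H (t \<iota>) then \<bar>c \<iota>\<bar> else 0)" by (rule sum_ennreal) simp
      also have "(\<Sum>\<iota>\<in>?I. if u < H (t \<iota>) then \<bar>c \<iota>\<bar> else 0) = (\<Sum>\<iota>\<in>{\<iota>\<in>?I. u < H (t \<iota>)}. \<bar>c \<iota>\<bar>)"
        by (rule sum.inter_filter[OF fin, symmetric])
      also have "ennreal \<dots> \<le> ennreal (\<Sum>\<iota>\<in>{\<iota>\<in>I. u < H (t \<iota>)}. \<bar>c \<iota>\<bar>)"
        using F by (intro ennreal_leI sum_mono2) (auto simp: step_form_def)
      also have "\<dots> \<le> 2 * quantile_of H u" by (rule budget_quantile[OF H F])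
      finally show ?thesis using True by simp
    next
      case False
      have "indicator {..<H (t \<iota>)} u = (0::ennreal)" if "\<iota> \<in> ?I" for \<iota>
        using Hv[OF that] False by (simp add: indicator_def)
      then have "(\<Sum>\<iota>\<in>?I. ennreal \<bar>c \<iota>\<bar> * indicator {..<H (t \<iota>)} u) = 0"
        by (intro sum.neutral) auto
      then show ?thesis by simp
    qed
  qed simp
  also have "\<dots> = 2 * (\<integral>\<^sup>+u\<in>{0..1}. quantile_of H u * indicator {..<v} u \<partial>lborel)"
    by (subst nn_integral_cmult[symmetric]) (auto simp: mult.assoc)
  finally show ?thesis .
qed

lemma ennreal_double_sum:
  fixes m :: "'i \<Rightarrow> 'j \<Rightarrow> real"
  assumes "\<And>\<iota> \<kappa>. \<iota> \<in> I \<Longrightarrow> \<kappa> \<in> K \<Longrightarrow> 0 \<le> m \<iota> \<kappa>"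
  shows "(\<Sum>\<iota>\<in>I. \<Sum>\<kappa>\<in>K. ennreal (m \<iota> \<kappa>)) = ennreal (\<Sum>\<iota>\<in>I. \<Sum>\<kappa>\<in>K. m \<iota> \<kappa>)"
proof -
  have "(\<Sum>\<iota>\<in>I. \<Sum>\<kappa>\<in>K. ennreal (m \<iota> \<kappa>)) = (\<Sum>\<iota>\<in>I. ennreal (\<Sum>\<kappa>\<in>K. m \<iota> \<kappa>))"
    using assms by (intro sum.cong refl sum_ennreal) auto
  also have "\<dots> = ennreal (\<Sum>\<iota>\<in>I. \<Sum>\<kappa>\<in>K. m \<iota> \<kappa>)"
    using assms by (intro sum_ennreal sum_nonneg) auto
  finally show ?thesis .
qed

text \<open>The double sum that bounds a covariance of two step forms. As before the minimum is the length
  of an interval of \<open>u\<close>, so the sum is the integral of the square of a budget.\<close>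

lemma step_form_double_sum:
  assumes H: "tail_function H" and F: "step_form H \<mu> I c t J" and \<beta>: "0 \<le> \<beta>" "\<beta> \<le> 1"
  shows "ennreal (\<Sum>\<iota>\<in>I. \<Sum>\<kappa>\<in>I. \<bar>c \<iota>\<bar> * \<bar>c \<kappa>\<bar> * min \<beta> (min (H (t \<iota>)) (H (t \<kappa>))))
    \<le> 4 * (\<integral>\<^sup>+u\<in>{0..\<beta>}. (quantile_of H u)\<^sup>2 \<partial>lborel)"
proof -
  have fin: "finite I" using F by (simp add: step_form_def)
  have H01: "0 \<le> H (t \<iota>)" "H (t \<iota>) \<le> 1" if "\<iota> \<in> I" for \<iota>
    using H F that by (auto simp: tail_function_def step_form_def less_imp_le)
  let ?m = "\<lambda>\<iota> \<kappa>. min \<beta> (min (H (t \<iota>)) (H (t \<kappa>)))"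
  have "ennreal (\<Sum>\<iota>\<in>I. \<Sum>\<kappa>\<in>I. \<bar>c \<iota>\<bar> * \<bar>c \<kappa>\<bar> * ?m \<iota> \<kappa>)
      = (\<Sum>\<iota>\<in>I. \<Sum>\<kappa>\<in>I. ennreal (\<bar>c \<iota>\<bar> * \<bar>c \<kappa>\<bar>) * ennreal (?m \<iota> \<kappa>))"
    using H01 \<beta> by (subst ennreal_double_sum[symmetric]) (auto simp: ennreal_mult' intro!: sum.cong)
  also have "\<dots> = (\<Sum>\<iota>\<in>I. \<Sum>\<kappa>\<in>I. ennreal (\<bar>c \<iota>\<bar> * \<bar>c \<kappa>\<bar>) * (\<integral>\<^sup>+u\<in>{0..1}. indicator {..<?m \<iota> \<kappa>} u \<partial>lborel))"
    using H01 \<beta> by (intro sum.cong refl) (subst ennreal_min_eq_nn_integral, auto)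
  also have "\<dots> = (\<integral>\<^sup>+u\<in>{0..1}. (\<Sum>\<iota>\<in>I. \<Sum>\<kappa>\<in>I. ennreal (\<bar>c \<iota>\<bar> * \<bar>c \<kappa>\<bar>) * indicator {..<?m \<iota> \<kappa>} u) \<partial>lborel)"
    by (simp add: nn_integral_sum nn_integral_cmult[symmetric] sum_distrib_right mult.assoc)
  also have "\<dots> \<le> (\<integral>\<^sup>+u. 4 * ((quantile_of H u)\<^sup>2 * indicator {0..\<beta>} u) \<partial>lborel)"
  proof (intro nn_integral_mono)
    fix u :: real
    let ?s = "\<Sum>\<iota>\<in>{\<iota>\<in>I. u < H (t \<iota>)}. \<bar>c \<iota>\<bar>"
    show "(\<Sum>\<iota>\<in>I. \<Sum>\<kappa>\<in>I. ennreal (\<bar>c \<iota>\<bar> * \<bar>c \<kappa>\<bar>) * indicator {..<?m \<iota> \<kappa>} u) * indicator {0..1} u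
        \<le> 4 * ((quantile_of H u)\<^sup>2 * indicator {0..\<beta>} u)"
    proof (cases "0 \<le> u \<and> u < \<beta>")
      case True
      have "(\<Sum>\<iota>\<in>I. \<Sum>\<kappa>\<in>I. ennreal (\<bar>c \<iota>\<bar> * \<bar>c \<kappa>\<bar>) * indicator {..<?m \<iota> \<kappa>} u)
          = (\<Sum>\<iota>\<in>I. \<Sum>\<kappa>\<in>I. ennreal ((if u < H (t \<iota>) then \<bar>c \<iota>\<bar> else 0) * (if u < H (t \<kappa>) then \<bar>c \<kappa>\<bar> else 0)))"
        using True by (intro sum.cong) (auto simp: indicator_def)
      also have "\<dots> = ennreal (\<Sum>\<iota>\<in>I. \<Sum>\<kappa>\<in>I. (if u < H (t \<iota>) then \<bar>c \<iota>\<bar> else 0) * (if u < H (t \<kappa>) then \<bar>c \<kappa>\<bar> else 0))"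
        by (rule ennreal_double_sum) simp
      also have "(\<Sum>\<iota>\<in>I. \<Sum>\<kappa>\<in>I. (if u < H (t \<iota>) then \<bar>c \<iota>\<bar> else 0) * (if u < H (t \<kappa>) then \<bar>c \<kappa>\<bar> else 0)) = ?s * ?s"
        by (simp only: sum_product[symmetric] sum.inter_filter[OF fin])
      also have "ennreal (?s * ?s) = ennreal ?s * ennreal ?s" by (simp add: ennreal_mult sum_nonneg)
      also have "\<dots> \<le> (2 * quantile_of H u) * (2 * quantile_of H u)"
        by (intro mult_mono budget_quantile[OF H F]) auto
      also have "\<dots> = 4 * (quantile_of H u)\<^sup>2" by (simp add: power2_eq_square algebra_simps)
      finally show ?thesis using True \<beta> by simp
    next
      case False
      then have zero: "(\<Sum>\<iota>\<in>I. \<Sum>\<kappa>\<in>I. ennreal (\<bar>c \<iota>\<bar> * \<bar>c \<kappa>\<bar>) * indicator {..<?m \<iota> \<kappa>} u) * indicator {0..1} u = 0"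
        by (cases "u < 0") (auto intro!: sum.neutral)
      show ?thesis unfolding zero by simp
    qed
  qed
  also have "\<dots> = 4 * (\<integral>\<^sup>+u\<in>{0..\<beta>}. (quantile_of H u)\<^sup>2 \<partial>lborel)"
    by (rule nn_integral_cmult) measurable
  finally show ?thesis .
qed

section \<open>A deviation inequality for martingales with bounded increments\<close>

lemma exp_le_quadratic:
  fixes t :: real
  assumes "\<bar>t\<bar> \<le> a"
  shows "exp t \<le> 1 + t + t\<^sup>2 * (exp a / 2)"
proof -
  obtain s where s: "\<bar>s\<bar> \<le> \<bar>t\<bar>" and "exp t = (\<Sum>m<2. t ^ m / fact m) + exp s / fact 2 * t ^ 2"
    using Maclaurin_exp_le[of t 2] by auto
  then have e: "exp t = 1 + t + t\<^sup>2 * (exp s / 2)" by (simp add: numeral_2_eq_2)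
  have "exp s \<le> exp a" using s assms by simp
  then have "t\<^sup>2 * (exp s / 2) \<le> t\<^sup>2 * (exp a / 2)" by (intro mult_left_mono) auto
  then show ?thesis using e by simp
qed

lemma ln_squared_le:
  fixes r :: real
  assumes "1 \<le> r"
  shows "(ln r)\<^sup>2 \<le> r"
proof -
  have r: "r > 0" using assms by simp
  have "ln (sqrt (sqrt r)) \<le> sqrt (sqrt r) - 1" using r by (intro ln_le_minus_one) simp
  then have a: "ln r \<le> 4 * (sqrt (sqrt r) - 1)" using r by (simp add: ln_sqrt)
  let ?w = "sqrt (sqrt r)"
  have w: "1 \<le> ?w" using assms by simp
  have "ln (?w) \<le> ?w - 1" using r by (intro ln_le_minus_one) simp
  have "4 * (?w - 1) \<le> ?w * ?w" using zero_le_power2[of "?w - 2"] by (simp add: power2_eq_square algebra_simps)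
  also have "\<dots> = sqrt r" using r by simp
  finally have "ln r \<le> sqrt r" using a by simp
  moreover have "0 \<le> ln r" using assms by simp
  ultimately have "(ln r)\<^sup>2 \<le> (sqrt r)\<^sup>2" by (intro power_mono)
  then show ?thesis using r by simp
qed

lemma (in prob_space) bounded_integrable:
  fixes f :: "'a \<Rightarrow> real"
  assumes "f \<in> borel_measurable M" "\<And>\<omega>. \<omega> \<in> space M \<Longrightarrow> \<bar>f \<omega>\<bar> \<le> K"
  shows "integrable M f"
  using assms by (intro integrable_const_bound[where B = K]) auto

lemma (in prob_space) bounded_mult_integrable:
  fixes f g :: "'a \<Rightarrow> real"
  assumes "f \<in> borel_measurable M" "\<And>\<omega>. \<omega> \<in> space M \<Longrightarrow> \<bar>f \<omega>\<bar> \<le> K" "integrable M g"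
  shows "integrable M (\<lambda>\<omega>. f \<omega> * g \<omega>)"
proof (rule Bochner_Integration.integrable_bound)
  show "integrable M (\<lambda>\<omega>. K * g \<omega>)" using assms(3) by simp
  show "AE \<omega> in M. norm (f \<omega> * g \<omega>) \<le> norm (K * g \<omega>)"
    using assms(2) by (intro AE_I2) (auto simp: abs_mult intro!: mult_right_mono intro: order_trans[OF _ abs_ge_self])
qed (use assms in measurable)

lemma prefix_max_event_measurable:
  fixes S :: "nat \<Rightarrow> 'a \<Rightarrow> real"
  assumes [measurable]: "\<And>k. S k \<in> borel_measurable M"
  shows "{\<omega>\<in>space M. \<exists>k\<le>n. a \<le> \<bar>S k \<omega>\<bar>} \<in> sets M"
proof -
  have "{\<omega>\<in>space M. \<exists>k\<in>{..n}. a \<le> \<bar>S k \<omega>\<bar>} \<in> sets M"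
    by (intro sets.sets_Collect_finite_Ex) auto
  then show ?thesis unfolding Bex_def atMost_iff .
qed

text \<open>Stopping a sequence of increments as soon as its partial sums enter \<open>P\<close>: the stopped
  sum is obtained by multiplying each increment by a predictable indicator, so that maximal
  inequalities reduce to inequalities for the last partial sum.\<close>

lemma stopped_sum:
  fixes e :: "nat \<Rightarrow> real"
  assumes "k \<le> N" "P (\<Sum>i<k. e i)"
  shows "P (\<Sum>j<N. if (\<forall>m\<le>j. \<not> P (\<Sum>i<m. e i)) then e j else 0)"
proof -
  define k0 where "k0 = (LEAST k. P (\<Sum>i<k. e i))"
  have k0: "P (\<Sum>i<k0. e i)" unfolding k0_def by (rule LeastI) (rule assms)
  have "k0 \<le> k" unfolding k0_def by (rule Least_le) (rule assms)
  then have "k0 \<le> N" using assms by simp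
  have eq: "(\<forall>m\<le>j. \<not> P (\<Sum>i<m. e i)) \<longleftrightarrow> j < k0" for j
  proof
    assume "\<forall>m\<le>j. \<not> P (\<Sum>i<m. e i)"
    then show "j < k0" using k0 by (meson not_le)
  next
    assume "j < k0"
    then show "\<forall>m\<le>j. \<not> P (\<Sum>i<m. e i)" unfolding k0_def using not_less_Least le_less_trans by blast
  qed
  have "(\<Sum>j<N. if j < k0 then e j else 0) = (\<Sum>j<k0. e j)"
    using \<open>k0 \<le> N\<close> by (subst sum.inter_filter[symmetric]) (auto intro!: sum.cong)
  then show ?thesis using k0 by (simp add: eq)
qed

text \<open>\<open>D\<close> is the excess of the conditional variance over the deterministic bound \<open>s\<close>. Centring and
  variance are stated against bounded test functions because they are only ever applied to
  one, an exponential or a partial sum of earlier increments, multiplied by a predictable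
  indicator.\<close>

locale bounded_martingale = prob_space M for M :: "'a measure" +
  fixes G :: "nat \<Rightarrow> 'a measure" and d D :: "nat \<Rightarrow> 'a \<Rightarrow> real" and b s :: real
  assumes sub: "\<And>j. subalgebra M (G j)"
    and mono: "\<And>i j. i \<le> j \<Longrightarrow> sets (G i) \<subseteq> sets (G j)"
    and adapted: "\<And>j. d j \<in> borel_measurable (G (Suc j))"
    and bounded: "\<And>j \<omega>. \<omega> \<in> space M \<Longrightarrow> \<bar>d j \<omega>\<bar> \<le> b"
    and b_nonneg: "0 \<le> b" and s_nonneg: "0 \<le> s"
    and D_meas: "\<And>j. D j \<in> borel_measurable (G j)"
    and D_nonneg: "\<And>j \<omega>. 0 \<le> D j \<omega>"
    and D_int: "\<And>j. integrable M (D j)"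
    and centred: "\<And>j W K. W \<in> borel_measurable (G j) \<Longrightarrow> (\<And>\<omega>. \<omega> \<in> space M \<Longrightarrow> \<bar>W \<omega>\<bar> \<le> K) \<Longrightarrow>
        (\<integral>\<omega>. W \<omega> * d j \<omega> \<partial>M) = 0"
    and variance: "\<And>j W K. W \<in> borel_measurable (G j) \<Longrightarrow>
        (\<And>\<omega>. \<omega> \<in> space M \<Longrightarrow> 0 \<le> W \<omega> \<and> W \<omega> \<le> K) \<Longrightarrow>
        (\<integral>\<omega>. W \<omega> * (d j \<omega>)\<^sup>2 \<partial>M) \<le> (\<integral>\<omega>. W \<omega> * (s + D j \<omega>) \<partial>M)"
begin

lemma meas_mono: "f \<in> borel_measurable (G i) \<Longrightarrow> i \<le> j \<Longrightarrow> f \<in> borel_measurable (G j)"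
  using mono[of i j] sub by (metis (no_types) measurable_from_subalg subalgebra_def)

lemma meas_M: "f \<in> borel_measurable (G i) \<Longrightarrow> f \<in> borel_measurable M"
  using sub measurable_from_subalg by blast

lemma space_G: "space (G j) = space M" using sub by (simp add: subalgebra_def)

text \<open>By the quadratic bound for the exponential, multiplying by \<open>exp (l e)\<close> costs at most a factor
  \<open>1 + \<psi> V\<close>, where \<open>V\<close> is the conditional variance of the increment \<open>e\<close>; dividing by
  \<open>exp (\<psi> V)\<close> compensates for it. The predictable events \<open>B j\<close> select increments: they
  serve for stopping and for discarding increments whose conditional variance is out of
  control.\<close>

lemma exponential_supermartingale:
  assumes B: "\<And>j. B j \<in> sets (G j)" and l: "0 \<le> l"
    and y: "\<And>\<omega>. \<omega> \<in> space M \<Longrightarrow> (\<Sum>j<N. (s + D j \<omega>) * indicator (B j) \<omega>) \<le> y"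
  defines "\<psi> \<equiv> l\<^sup>2 * (exp (l * b) / 2)"
  shows "n \<le> N \<Longrightarrow> (\<integral>\<omega>. exp (l * (\<Sum>j<n. d j \<omega> * indicator (B j) \<omega>)
      - \<psi> * (\<Sum>j<n. (s + D j \<omega>) * indicator (B j) \<omega>)) \<partial>M) \<le> 1"
proof (induction n)
  case 0
  show ?case by (simp add: prob_space)
next
  case (Suc n)
  have [measurable]: "B j \<in> sets (G j)" for j by (rule B)
  note D_meas[measurable] adapted[measurable]
  let ?V = "\<lambda>j \<omega>. (s + D j \<omega>) * indicator (B j) \<omega>"
  define e where "e = (\<lambda>j \<omega>. d j \<omega> * indicator (B j) \<omega>)"
  define W where "W = (\<lambda>\<omega>. exp (l * (\<Sum>j<n. e j \<omega>) - \<psi> * (\<Sum>j<Suc n. ?V j \<omega>)))"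
  have \<psi>0: "0 \<le> \<psi>" by (simp add: \<psi>_def)
  have V0: "0 \<le> ?V j \<omega>" for j \<omega> using s_nonneg D_nonneg by (intro mult_nonneg_nonneg add_nonneg_nonneg) auto
  have Vle: "?V n \<omega> \<le> y" if "\<omega> \<in> space M" for \<omega>
  proof -
    have "?V n \<omega> \<le> (\<Sum>j<N. ?V j \<omega>)" using V0 Suc.prems by (intro member_le_sum) auto
    then show ?thesis using y[OF that] by simp
  qed
  have eM: "e j \<in> borel_measurable (G n)" if "j < n" for j
  proof -
    have "B j \<in> sets (G (Suc j))" using B mono[of j "Suc j"] by auto
    then have "e j \<in> borel_measurable (G (Suc j))" unfolding e_def by measurable
    then show ?thesis by (rule meas_mono) (use that in simp)
  qed
  have VM: "?V j \<in> borel_measurable (G n)" if "j \<le> n" for j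
  proof -
    have "?V j \<in> borel_measurable (G j)" by measurable
    then show ?thesis by (rule meas_mono) (use that in simp)
  qed
  have sumM [measurable]: "(\<lambda>\<omega>. \<Sum>j<n. e j \<omega>) \<in> borel_measurable (G n)"
    "(\<lambda>\<omega>. \<Sum>j<Suc n. ?V j \<omega>) \<in> borel_measurable (G n)"
    by (rule borel_measurable_sum, rule eM VM, simp)+
  have WG [measurable]: "W \<in> borel_measurable (G n)"
    unfolding W_def by measurable
  have ebd: "\<bar>e j \<omega>\<bar> \<le> b" if "\<omega> \<in> space M" for j \<omega>
    using bounded[OF that, of j] b_nonneg by (auto simp: e_def indicator_def)
  have Wpos: "0 < W \<omega>" for \<omega> by (simp add: W_def)
  have Wbd: "W \<omega> \<le> exp (l * (real n * b))" if "\<omega> \<in> space M" for \<omega>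
  proof -
    have "(\<Sum>j<n. e j \<omega>) \<le> real n * b"
      using sum_bounded_above[of "{..<n}" "\<lambda>j. e j \<omega>" b] ebd[OF that] by (simp add: abs_le_iff)
    then have "l * (\<Sum>j<n. e j \<omega>) \<le> l * (real n * b)" using l by (rule mult_left_mono)
    moreover have "0 \<le> \<psi> * (\<Sum>j<Suc n. ?V j \<omega>)" by (rule mult_nonneg_nonneg[OF \<psi>0 sum_nonneg[OF V0]])
    ultimately show ?thesis by (simp add: W_def)
  qed
  let ?K = "exp (l * (real n * b))"
  have WM [measurable]: "W \<in> borel_measurable M" by (rule meas_M[OF WG])
  have [measurable]: "d n \<in> borel_measurable M" "D n \<in> borel_measurable M"
    by (rule meas_M[OF adapted] meas_M[OF D_meas])+
  have [measurable]: "B n \<in> sets M" using B[of n] sub[of n] by (auto simp: subalgebra_def)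
  have [measurable]: "e n \<in> borel_measurable M" unfolding e_def by measurable
  have WBG: "(\<lambda>\<omega>. W \<omega> * indicator (B n) \<omega>) \<in> borel_measurable (G n)" by measurable
  have i1: "integrable M W" by (rule bounded_integrable[where K = ?K]) (use Wbd Wpos in \<open>auto simp: abs_of_pos\<close>)
  have i2: "integrable M (\<lambda>\<omega>. W \<omega> * e n \<omega>)"
    by (rule bounded_integrable[where K = "?K * b"])
      (use Wbd Wpos ebd in \<open>auto simp: abs_mult abs_of_pos intro!: mult_mono\<close>)
  have i3: "integrable M (\<lambda>\<omega>. W \<omega> * (e n \<omega>)\<^sup>2)"
  proof (rule bounded_integrable[where K = "?K * b\<^sup>2"])
    fix \<omega> assume w: "\<omega> \<in> space M"
    have "(e n \<omega>)\<^sup>2 \<le> b\<^sup>2" using ebd[OF w, of n] by (metis abs_ge_zero power2_abs power_mono)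
    then show "\<bar>W \<omega> * (e n \<omega>)\<^sup>2\<bar> \<le> ?K * b\<^sup>2"
      using Wbd[OF w] Wpos[of \<omega>] by (auto simp: abs_mult intro!: mult_mono)
  qed simp
  have i4: "integrable M (\<lambda>\<omega>. W \<omega> * ?V n \<omega>)"
  proof (rule bounded_integrable[where K = "?K * y"])
    fix \<omega> assume w: "\<omega> \<in> space M"
    show "\<bar>W \<omega> * ?V n \<omega>\<bar> \<le> ?K * y"
      unfolding abs_mult using Wbd[OF w] Wpos[of \<omega>] Vle[OF w] V0[of n \<omega>]
      by (intro mult_mono) auto
  qed simp
  have i5: "integrable M (\<lambda>\<omega>. W \<omega> * exp (\<psi> * ?V n \<omega>))"
  proof (rule bounded_integrable[where K = "?K * exp (\<psi> * y)"])
    fix \<omega> assume w: "\<omega> \<in> space M"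
    have "exp (\<psi> * ?V n \<omega>) \<le> exp (\<psi> * y)" using Vle[OF w] \<psi>0 by (simp add: mult_left_mono)
    then show "\<bar>W \<omega> * exp (\<psi> * ?V n \<omega>)\<bar> \<le> ?K * exp (\<psi> * y)"
      unfolding abs_mult using Wbd[OF w] Wpos[of \<omega>] by (intro mult_mono) auto
  qed simp
  have i6: "integrable M (\<lambda>\<omega>. W \<omega> * exp (l * e n \<omega>))"
  proof (rule bounded_integrable[where K = "?K * exp (l * b)"])
    fix \<omega> assume w: "\<omega> \<in> space M"
    have "exp (l * e n \<omega>) \<le> exp (l * b)" using ebd[OF w, of n] l by (simp add: mult_left_mono abs_le_iff)
    then show "\<bar>W \<omega> * exp (l * e n \<omega>)\<bar> \<le> ?K * exp (l * b)"
      unfolding abs_mult using Wbd[OF w] Wpos[of \<omega>] by (intro mult_mono) auto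
  qed simp
  have c: "(\<integral>\<omega>. W \<omega> * e n \<omega> \<partial>M) = 0"
  proof -
    have "(\<integral>\<omega>. (W \<omega> * indicator (B n) \<omega>) * d n \<omega> \<partial>M) = 0"
      by (rule centred[where K = ?K]) (use WBG Wbd Wpos in \<open>auto simp: indicator_def abs_of_pos\<close>)
    then show ?thesis by (simp add: e_def mult_ac)
  qed
  have v: "(\<integral>\<omega>. W \<omega> * (e n \<omega>)\<^sup>2 \<partial>M) \<le> (\<integral>\<omega>. W \<omega> * ?V n \<omega> \<partial>M)"
  proof -
    have "(\<integral>\<omega>. (W \<omega> * indicator (B n) \<omega>) * (d n \<omega>)\<^sup>2 \<partial>M) \<le> (\<integral>\<omega>. (W \<omega> * indicator (B n) \<omega>) * (s + D n \<omega>) \<partial>M)"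
      by (rule variance[where K = ?K]) (use WBG Wbd Wpos in \<open>auto simp: indicator_def less_imp_le\<close>)
    moreover have "(\<lambda>\<omega>. (W \<omega> * indicator (B n) \<omega>) * (d n \<omega>)\<^sup>2) = (\<lambda>\<omega>. W \<omega> * (e n \<omega>)\<^sup>2)"
      by (auto simp: e_def indicator_def)
    ultimately show ?thesis by (simp add: mult_ac)
  qed
  have "(\<integral>\<omega>. exp (l * (\<Sum>j<Suc n. e j \<omega>) - \<psi> * (\<Sum>j<Suc n. ?V j \<omega>)) \<partial>M) = (\<integral>\<omega>. W \<omega> * exp (l * e n \<omega>) \<partial>M)"
    by (intro Bochner_Integration.integral_cong) (auto simp: W_def exp_add[symmetric] algebra_simps)
  also have "\<dots> \<le> (\<integral>\<omega>. W \<omega> + l * (W \<omega> * e n \<omega>) + \<psi> * (W \<omega> * (e n \<omega>)\<^sup>2) \<partial>M)"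
  proof (rule integral_mono)
    show "integrable M (\<lambda>\<omega>. W \<omega> + l * (W \<omega> * e n \<omega>) + \<psi> * (W \<omega> * (e n \<omega>)\<^sup>2))" using i1 i2 i3 by simp
    fix \<omega> assume w: "\<omega> \<in> space M"
    have "\<bar>l * e n \<omega>\<bar> \<le> l * b" using ebd[OF w, of n] l by (simp add: abs_mult mult_left_mono)
    then have "exp (l * e n \<omega>) \<le> 1 + l * e n \<omega> + (l * e n \<omega>)\<^sup>2 * (exp (l * b) / 2)" by (rule exp_le_quadratic)
    also have "\<dots> = 1 + l * e n \<omega> + \<psi> * (e n \<omega>)\<^sup>2" by (simp add: \<psi>_def power_mult_distrib)
    finally have "W \<omega> * exp (l * e n \<omega>) \<le> W \<omega> * (1 + l * e n \<omega> + \<psi> * (e n \<omega>)\<^sup>2)"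
      using Wpos[of \<omega>] by (intro mult_left_mono) auto
    then show "W \<omega> * exp (l * e n \<omega>) \<le> W \<omega> + l * (W \<omega> * e n \<omega>) + \<psi> * (W \<omega> * (e n \<omega>)\<^sup>2)"
      by (simp add: algebra_simps)
  qed (rule i6)
  also have "\<dots> = (\<integral>\<omega>. W \<omega> \<partial>M) + \<psi> * (\<integral>\<omega>. W \<omega> * (e n \<omega>)\<^sup>2 \<partial>M)" using i1 i2 i3 c by simp
  also have "\<dots> \<le> (\<integral>\<omega>. W \<omega> \<partial>M) + \<psi> * (\<integral>\<omega>. W \<omega> * ?V n \<omega> \<partial>M)" using v \<psi>0 by (simp add: mult_left_mono)
  also have "\<dots> = (\<integral>\<omega>. W \<omega> + \<psi> * (W \<omega> * ?V n \<omega>) \<partial>M)" using i1 i4 by simp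
  also have "\<dots> \<le> (\<integral>\<omega>. W \<omega> * exp (\<psi> * ?V n \<omega>) \<partial>M)"
  proof (rule integral_mono)
    show "integrable M (\<lambda>\<omega>. W \<omega> + \<psi> * (W \<omega> * ?V n \<omega>))" using i1 i4 by simp
    fix \<omega>
    have "1 + \<psi> * ?V n \<omega> \<le> exp (\<psi> * ?V n \<omega>)" by (rule exp_ge_add_one_self)
    then have "W \<omega> * (1 + \<psi> * ?V n \<omega>) \<le> W \<omega> * exp (\<psi> * ?V n \<omega>)"
      using Wpos[of \<omega>] by (intro mult_left_mono) auto
    then show "W \<omega> + \<psi> * (W \<omega> * ?V n \<omega>) \<le> W \<omega> * exp (\<psi> * ?V n \<omega>)" by (simp add: algebra_simps)
  qed (rule i5)
  also have "\<dots> = (\<integral>\<omega>. exp (l * (\<Sum>j<n. e j \<omega>) - \<psi> * (\<Sum>j<n. ?V j \<omega>)) \<partial>M)"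
    by (intro Bochner_Integration.integral_cong) (auto simp: W_def exp_add[symmetric] algebra_simps)
  also have "\<dots> \<le> 1" using Suc by (simp add: e_def)
  finally show ?case by (simp add: e_def)
qed

lemma predictable_sum_measurable:
  assumes B: "\<And>j. B j \<in> sets (G j)"
  shows "m \<le> j \<Longrightarrow> (\<lambda>\<omega>. \<Sum>i<m. d i \<omega> * indicator (B i) \<omega>) \<in> borel_measurable (G j)"
proof (rule borel_measurable_sum)
  fix i assume "m \<le> j" "i \<in> {..<m}"
  have [measurable]: "B i \<in> sets (G (Suc i))" using B mono[of i "Suc i"] by auto
  note adapted[measurable]
  have "(\<lambda>\<omega>. d i \<omega> * indicator (B i) \<omega>) \<in> borel_measurable (G (Suc i))" by measurable
  then show "(\<lambda>\<omega>. d i \<omega> * indicator (B i) \<omega>) \<in> borel_measurable (G j)"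
    by (rule meas_mono) (use \<open>m \<le> j\<close> \<open>i \<in> {..<m}\<close> in simp)
qed

lemma stopped_events:
  fixes P :: "real \<Rightarrow> bool"
  assumes B: "\<And>j. B j \<in> sets (G j)" and P: "{x. P x} \<in> sets borel"
  shows "B j \<inter> {\<omega>\<in>space M. \<forall>m\<le>j. \<not> P (\<Sum>i<m. d i \<omega> * indicator (B i) \<omega>)} \<in> sets (G j)"
proof -
  have predP: "Measurable.pred borel P" using P by (simp add: pred_def)
  have "Measurable.pred (G j) (\<lambda>\<omega>. P (\<Sum>i<m. d i \<omega> * indicator (B i) \<omega>))" if "m \<le> j" for m
    by (rule measurable_compose[OF predictable_sum_measurable[OF B that]]) (rule predP)
  then have "{\<omega>\<in>space (G j). \<forall>m\<in>{..j}. \<not> P (\<Sum>i<m. d i \<omega> * indicator (B i) \<omega>)} \<in> sets (G j)"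
    by (intro sets.sets_Collect_finite_All sets.sets_Collect_neg) (auto simp: pred_def)
  from sets.Int[OF B[of j] this] show ?thesis unfolding space_G atMost_iff Ball_def .
qed

lemma predictable_max_event:
  fixes P :: "real \<Rightarrow> bool"
  assumes B: "\<And>j. B j \<in> sets (G j)" and P: "{x. P x} \<in> sets borel"
  shows "{\<omega>\<in>space M. \<exists>k\<le>N. P (\<Sum>i<k. d i \<omega> * indicator (B i) \<omega>)} \<in> sets M"
proof -
  have predP: "Measurable.pred borel P" using P by (simp add: pred_def)
  have "Measurable.pred M (\<lambda>\<omega>. P (\<Sum>i<m. d i \<omega> * indicator (B i) \<omega>))" for m
    by (rule measurable_compose[OF meas_M[OF predictable_sum_measurable[OF B order_refl]]]) (rule predP)
  then have "{\<omega>\<in>space M. \<exists>k\<in>{..N}. P (\<Sum>i<k. d i \<omega> * indicator (B i) \<omega>)} \<in> sets M"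
    by (intro sets.sets_Collect_finite_Ex) (auto simp: pred_def)
  then show ?thesis unfolding Bex_def atMost_iff .
qed

lemma stopped_sum_at:
  fixes P :: "real \<Rightarrow> bool"
  assumes "\<omega> \<in> space M" "k \<le> N" "P (\<Sum>i<k. d i \<omega> * indicator (B i) \<omega>)"
  shows "P (\<Sum>j<N. d j \<omega> * indicator
    (B j \<inter> {\<omega>\<in>space M. \<forall>m\<le>j. \<not> P (\<Sum>i<m. d i \<omega> * indicator (B i) \<omega>)}) \<omega>)"
proof -
  have "(\<Sum>j<N. d j \<omega> * indicator (B j \<inter> {\<omega>\<in>space M. \<forall>m\<le>j. \<not> P (\<Sum>i<m. d i \<omega> * indicator (B i) \<omega>)}) \<omega>)
      = (\<Sum>j<N. if (\<forall>m\<le>j. \<not> P (\<Sum>i<m. d i \<omega> * indicator (B i) \<omega>)) then d j \<omega> * indicator (B j) \<omega> else 0)"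
    using assms(1) by (intro sum.cong refl) (simp add: indicator_def)
  also have "P \<dots>" by (rule stopped_sum) fact+
  finally show ?thesis .
qed

lemma exponential_maximal:
  assumes B: "\<And>j. B j \<in> sets (G j)" and l: "0 \<le> l"
    and y: "\<And>\<omega>. \<omega> \<in> space M \<Longrightarrow> (\<Sum>j<N. (s + D j \<omega>) * indicator (B j) \<omega>) \<le> y"
  shows "prob {\<omega>\<in>space M. \<exists>k\<le>N. z \<le> (\<Sum>i<k. d i \<omega> * indicator (B i) \<omega>)}
    \<le> exp (- l * z + l\<^sup>2 * (exp (l * b) / 2) * y)"
proof -
  define C where "C = (\<lambda>j. B j \<inter> {\<omega>\<in>space M. \<forall>m\<le>j. \<not> z \<le> (\<Sum>i<m. d i \<omega> * indicator (B i) \<omega>)})"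
  define \<psi> where "\<psi> = l\<^sup>2 * (exp (l * b) / 2)"
  have \<psi>0: "0 \<le> \<psi>" by (simp add: \<psi>_def)
  have C: "C j \<in> sets (G j)" for j unfolding C_def by (rule stopped_events[OF B]) simp
  have V0: "0 \<le> (s + D j \<omega>) * indicator A \<omega>" for j A \<omega>
    using s_nonneg D_nonneg by (intro mult_nonneg_nonneg add_nonneg_nonneg) auto
  have Cy: "(\<Sum>j<N. (s + D j \<omega>) * indicator (C j) \<omega>) \<le> y" if "\<omega> \<in> space M" for \<omega>
  proof -
    have "(\<Sum>j<N. (s + D j \<omega>) * indicator (C j) \<omega>) \<le> (\<Sum>j<N. (s + D j \<omega>) * indicator (B j) \<omega>)"
      using s_nonneg D_nonneg by (intro sum_mono mult_left_mono) (auto simp: C_def indicator_def)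
    then show ?thesis using y[OF that] by simp
  qed
  let ?S = "\<lambda>\<omega>. \<Sum>j<N. d j \<omega> * indicator (C j) \<omega>"
  let ?V = "\<lambda>\<omega>. \<Sum>j<N. (s + D j \<omega>) * indicator (C j) \<omega>"
  have SM [measurable]: "?S \<in> borel_measurable M" by (rule meas_M[OF predictable_sum_measurable[OF C order_refl]])
  have VM [measurable]: "?V \<in> borel_measurable M"
  proof (rule borel_measurable_sum)
    fix j
    have [measurable]: "D j \<in> borel_measurable M" by (rule meas_M[OF D_meas])
    have [measurable]: "C j \<in> sets M" using C[of j] sub[of j] by (auto simp: subalgebra_def)
    show "(\<lambda>\<omega>. (s + D j \<omega>) * indicator (C j) \<omega>) \<in> borel_measurable M" by measurable
  qed
  have Sle: "?S \<omega> \<le> real N * b" if "\<omega> \<in> space M" for \<omega>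
  proof -
    have "d j \<omega> * indicator (C j) \<omega> \<le> b" for j
      using bounded[OF that, of j] b_nonneg by (auto simp: indicator_def)
    then show ?thesis using sum_bounded_above[of "{..<N}" "\<lambda>j. d j \<omega> * indicator (C j) \<omega>" b] by simp
  qed
  have bd: "exp (l * ?S \<omega> - \<psi> * ?V \<omega>) \<le> exp (l * (real N * b))" if "\<omega> \<in> space M" for \<omega>
  proof -
    have "l * ?S \<omega> \<le> l * (real N * b)" using Sle[OF that] l by (rule mult_left_mono)
    moreover have "0 \<le> \<psi> * ?V \<omega>" by (rule mult_nonneg_nonneg[OF \<psi>0 sum_nonneg[OF V0]])
    ultimately show ?thesis by simp
  qed
  have int: "integrable M (\<lambda>\<omega>. exp (l * ?S \<omega> - \<psi> * ?V \<omega>))"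
    by (rule bounded_integrable[where K = "exp (l * (real N * b))"], measurable) (use bd in \<open>simp only: abs_exp_cancel\<close>)
  let ?E = "{\<omega>\<in>space M. exp (l * z - \<psi> * y) \<le> exp (l * ?S \<omega> - \<psi> * ?V \<omega>)}"
  have "{\<omega>\<in>space M. \<exists>k\<le>N. z \<le> (\<Sum>i<k. d i \<omega> * indicator (B i) \<omega>)} \<subseteq> ?E"
  proof
    fix \<omega> assume "\<omega> \<in> {\<omega>\<in>space M. \<exists>k\<le>N. z \<le> (\<Sum>i<k. d i \<omega> * indicator (B i) \<omega>)}"
    then obtain k where w: "\<omega> \<in> space M" "k \<le> N" "z \<le> (\<Sum>i<k. d i \<omega> * indicator (B i) \<omega>)" by auto
    have "z \<le> ?S \<omega>" unfolding C_def by (rule stopped_sum_at[where P = "\<lambda>x. z \<le> x", OF w])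
    then have "l * z \<le> l * ?S \<omega>" using l by (rule mult_left_mono)
    moreover have "\<psi> * ?V \<omega> \<le> \<psi> * y" using Cy[OF w(1)] \<psi>0 by (rule mult_left_mono)
    ultimately have "exp (l * z - \<psi> * y) \<le> exp (l * ?S \<omega> - \<psi> * ?V \<omega>)" by simp
    then show "\<omega> \<in> ?E" using w(1) by (intro CollectI conjI)
  qed
  then have "prob {\<omega>\<in>space M. \<exists>k\<le>N. z \<le> (\<Sum>i<k. d i \<omega> * indicator (B i) \<omega>)} \<le> prob ?E"
    by (rule finite_measure_mono) measurable
  also have "\<dots> \<le> (\<integral>\<omega>. exp (l * ?S \<omega> - \<psi> * ?V \<omega>) \<partial>M) / exp (l * z - \<psi> * y)"
    by (rule integral_Markov_inequality_measure[OF int, where A = "space M"]) simp_all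
  also have "\<dots> \<le> 1 / exp (l * z - \<psi> * y)"
    unfolding \<psi>_def by (intro divide_right_mono exponential_supermartingale[where N = N and y = y] C l Cy) auto
  also have "\<dots> = exp (- l * z + \<psi> * y)" by (simp add: exp_minus[symmetric] divide_inverse)
  finally show ?thesis by (simp add: \<psi>_def)
qed

text \<open>Optimising \<open>l\<close> at a threshold equal to \<open>2 p\<close> times the bound on the increments turns the
  exponential bound into a power of order \<open>p\<close>: reaching the threshold takes at least
  \<open>2 p\<close> increments.\<close>

lemma power_maximal:
  assumes B: "\<And>j. B j \<in> sets (G j)" and p: "2 \<le> p" and b: "0 < b" and y0: "0 < y"
    and y: "\<And>\<omega>. \<omega> \<in> space M \<Longrightarrow> (\<Sum>j<N. (s + D j \<omega>) * indicator (B j) \<omega>) \<le> y"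
  shows "prob {\<omega>\<in>space M. \<exists>k\<le>N. 2 * p * b \<le> (\<Sum>i<k. d i \<omega> * indicator (B i) \<omega>)} \<le> (y / b\<^sup>2) powr p"
proof (cases "y \<le> b\<^sup>2")
  case False
  then have "1 \<le> y / b\<^sup>2" using b by simp
  then have "1 \<le> (y / b\<^sup>2) powr p" using p by (simp add: ge_one_powr_ge_zero)
  then show ?thesis using prob_le_1 by (rule order_trans[rotated])
next
  case True
  define r where "r = sqrt (2 * p * (b\<^sup>2 / y))"
  define l where "l = ln r / b"
  have "1 * 1 \<le> (2 * p) * (b\<^sup>2 / y)" using True p y0 by (intro mult_mono) auto
  then have r: "1 \<le> r" by (simp add: r_def)
  have r2: "r\<^sup>2 = 2 * p * (b\<^sup>2 / y)" using p y0 by (simp add: r_def)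
  have l: "0 \<le> l" using r b by (simp add: l_def)
  have "l\<^sup>2 * (exp (l * b) / 2) * y = (ln r)\<^sup>2 * r * (y / (2 * b\<^sup>2))"
    using b r by (simp add: l_def power_divide)
  also have "\<dots> \<le> r * r * (y / (2 * b\<^sup>2))"
    using ln_squared_le[OF r] r y0 by (intro mult_right_mono) auto
  also have "\<dots> = p" using r2 b y0 by (simp add: power2_eq_square)
  finally have "- l * (2 * p * b) + l\<^sup>2 * (exp (l * b) / 2) * y \<le> - (2 * p * ln r) + p"
    using b by (simp add: l_def)
  moreover have "- (2 * p * ln r) + p \<le> p * ln (y / b\<^sup>2)"
  proof -
    have "2 * ln r = ln (r\<^sup>2)" using r by (simp add: ln_realpow)
    also have "\<dots> = ln (2 * p) - ln (y / b\<^sup>2)" unfolding r2 using p y0 b by (simp add: ln_mult ln_div)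
    finally have 1: "2 * ln r = ln (2 * p) - ln (y / b\<^sup>2)" .
    have "ln (exp 1) \<le> ln (2 * p)" using p exp_le by (subst ln_le_cancel_iff) auto
    then have 2: "1 \<le> ln (2 * p)" by simp
    have "1 - 2 * ln r \<le> ln (y / b\<^sup>2)" using 1 2 by simp
    then have "p * (1 - 2 * ln r) \<le> p * ln (y / b\<^sup>2)" using p by (intro mult_left_mono) auto
    then show ?thesis by (simp add: algebra_simps)
  qed
  ultimately have "exp (- l * (2 * p * b) + l\<^sup>2 * (exp (l * b) / 2) * y) \<le> exp (p * ln (y / b\<^sup>2))" by simp
  also have "\<dots> = (y / b\<^sup>2) powr p" using y0 b by (simp add: powr_def)
  finally show ?thesis using exponential_maximal[OF B l y, where z = "2 * p * b"] by simp
qed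

lemma square_integral_bound:
  assumes B: "\<And>j. B j \<in> sets (G j)"
  shows "integrable M (\<lambda>\<omega>. (\<Sum>j<n. d j \<omega> * indicator (B j) \<omega>)\<^sup>2) \<and>
    (\<integral>\<omega>. (\<Sum>j<n. d j \<omega> * indicator (B j) \<omega>)\<^sup>2 \<partial>M) \<le> (\<Sum>j<n. \<integral>\<omega>. (s + D j \<omega>) * indicator (B j) \<omega> \<partial>M)"
proof (induction n)
  case (Suc n)
  let ?S = "\<lambda>\<omega>. \<Sum>j<n. d j \<omega> * indicator (B j) \<omega>"
  have [measurable]: "?S \<in> borel_measurable (G n)" by (rule predictable_sum_measurable[OF B order_refl])
  have [measurable]: "B n \<in> sets (G n)" by (rule B)
  have [measurable]: "d n \<in> borel_measurable M" by (rule meas_M[OF adapted])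
  have [measurable]: "?S \<in> borel_measurable M" by (rule meas_M[OF predictable_sum_measurable[OF B order_refl]])
  have [measurable]: "B n \<in> sets M" using B[of n] sub[of n] by (auto simp: subalgebra_def)
  have Sbd: "\<bar>?S \<omega>\<bar> \<le> real n * b" if "\<omega> \<in> space M" for \<omega>
  proof -
    have "\<bar>d j \<omega> * indicator (B j) \<omega>\<bar> \<le> b" for j
      using bounded[OF that, of j] b_nonneg by (auto simp: indicator_def)
    then have "(\<Sum>j<n. \<bar>d j \<omega> * indicator (B j) \<omega>\<bar>) \<le> real n * b"
      using sum_bounded_above[of "{..<n}" "\<lambda>j. \<bar>d j \<omega> * indicator (B j) \<omega>\<bar>" b] by simp
    then show ?thesis using sum_abs[of "\<lambda>j. d j \<omega> * indicator (B j) \<omega>" "{..<n}"] by linarith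
  qed
  have i2: "integrable M (\<lambda>\<omega>. (?S \<omega> * indicator (B n) \<omega>) * d n \<omega>)"
  proof (rule bounded_integrable[where K = "(real n * b) * b"])
    fix \<omega> assume w: "\<omega> \<in> space M"
    have "\<bar>?S \<omega> * indicator (B n) \<omega>\<bar> \<le> real n * b"
      using Sbd[OF w] by (cases "\<omega> \<in> B n") (auto intro: order_trans[OF abs_ge_zero])
    then show "\<bar>(?S \<omega> * indicator (B n) \<omega>) * d n \<omega>\<bar> \<le> (real n * b) * b"
      unfolding abs_mult[of "?S \<omega> * indicator (B n) \<omega>"] using bounded[OF w, of n] b_nonneg by (intro mult_mono) auto
  qed measurable
  have i3: "integrable M (\<lambda>\<omega>. indicator (B n) \<omega> * (d n \<omega>)\<^sup>2)"
  proof (rule bounded_integrable[where K = "b\<^sup>2"])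
    fix \<omega> assume w: "\<omega> \<in> space M"
    have "(d n \<omega>)\<^sup>2 \<le> b\<^sup>2" using bounded[OF w, of n] by (metis abs_ge_zero power2_abs power_mono)
    then show "\<bar>indicator (B n) \<omega> * (d n \<omega>)\<^sup>2\<bar> \<le> b\<^sup>2" by (auto simp: indicator_def)
  qed measurable
  have c: "(\<integral>\<omega>. (?S \<omega> * indicator (B n) \<omega>) * d n \<omega> \<partial>M) = 0"
  proof (rule centred[where K = "real n * b"])
    show "(\<lambda>\<omega>. ?S \<omega> * indicator (B n) \<omega>) \<in> borel_measurable (G n)" by measurable
    fix \<omega> assume w: "\<omega> \<in> space M"
    show "\<bar>?S \<omega> * indicator (B n) \<omega>\<bar> \<le> real n * b"
      using Sbd[OF w] by (cases "\<omega> \<in> B n") (auto intro: order_trans[OF abs_ge_zero])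
  qed
  have v: "(\<integral>\<omega>. indicator (B n) \<omega> * (d n \<omega>)\<^sup>2 \<partial>M) \<le> (\<integral>\<omega>. indicator (B n) \<omega> * (s + D n \<omega>) \<partial>M)"
    by (rule variance[where K = 1]) (auto simp: indicator_def)
  have eq: "(\<lambda>\<omega>. (\<Sum>j<Suc n. d j \<omega> * indicator (B j) \<omega>)\<^sup>2) =
      (\<lambda>\<omega>. (?S \<omega>)\<^sup>2 + 2 * ((?S \<omega> * indicator (B n) \<omega>) * d n \<omega>) + indicator (B n) \<omega> * (d n \<omega>)\<^sup>2)"
  proof
    fix \<omega>
    have "(indicator (B n) \<omega> :: real)\<^sup>2 = indicator (B n) \<omega>" by (simp add: indicator_def)
    then show "(\<Sum>j<Suc n. d j \<omega> * indicator (B j) \<omega>)\<^sup>2 =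
        (?S \<omega>)\<^sup>2 + 2 * ((?S \<omega> * indicator (B n) \<omega>) * d n \<omega>) + indicator (B n) \<omega> * (d n \<omega>)\<^sup>2"
      by (simp add: power2_sum power_mult_distrib algebra_simps)
  qed
  show ?case unfolding eq using Suc i2 i3 c v by (simp add: mult.commute)
qed simp

lemma square_maximal:
  assumes B: "\<And>j. B j \<in> sets (G j)" and z: "0 < z"
  shows "prob {\<omega>\<in>space M. \<exists>k\<le>N. z \<le> \<bar>\<Sum>i<k. d i \<omega> * indicator (B i) \<omega>\<bar>}
    \<le> (\<Sum>j<N. \<integral>\<omega>. (s + D j \<omega>) * indicator (B j) \<omega> \<partial>M) / z\<^sup>2"
proof -
  define C where "C = (\<lambda>j. B j \<inter> {\<omega>\<in>space M. \<forall>m\<le>j. \<not> z \<le> \<bar>\<Sum>i<m. d i \<omega> * indicator (B i) \<omega>\<bar>})"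
  have C: "C j \<in> sets (G j)" for j unfolding C_def by (rule stopped_events[OF B]) measurable
  let ?S = "\<lambda>\<omega>. \<Sum>j<N. d j \<omega> * indicator (C j) \<omega>"
  have SM [measurable]: "?S \<in> borel_measurable M" by (rule meas_M[OF predictable_sum_measurable[OF C order_refl]])
  note sq = square_integral_bound[OF C, of N]
  let ?E = "{\<omega>\<in>space M. z\<^sup>2 \<le> (?S \<omega>)\<^sup>2}"
  have "{\<omega>\<in>space M. \<exists>k\<le>N. z \<le> \<bar>\<Sum>i<k. d i \<omega> * indicator (B i) \<omega>\<bar>} \<subseteq> ?E"
  proof
    fix \<omega> assume "\<omega> \<in> {\<omega>\<in>space M. \<exists>k\<le>N. z \<le> \<bar>\<Sum>i<k. d i \<omega> * indicator (B i) \<omega>\<bar>}"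
    then obtain k where w: "\<omega> \<in> space M" "k \<le> N" "z \<le> \<bar>\<Sum>i<k. d i \<omega> * indicator (B i) \<omega>\<bar>" by auto
    have "z \<le> \<bar>?S \<omega>\<bar>" unfolding C_def by (rule stopped_sum_at[where P = "\<lambda>x. z \<le> \<bar>x\<bar>", OF w])
    then have "z\<^sup>2 \<le> (?S \<omega>)\<^sup>2" using z by (metis less_imp_le power2_abs power_mono)
    then show "\<omega> \<in> ?E" using w(1) by (intro CollectI conjI)
  qed
  then have "prob {\<omega>\<in>space M. \<exists>k\<le>N. z \<le> \<bar>\<Sum>i<k. d i \<omega> * indicator (B i) \<omega>\<bar>} \<le> prob ?E"
    by (rule finite_measure_mono) measurable
  also have "\<dots> \<le> (\<integral>\<omega>. (?S \<omega>)\<^sup>2 \<partial>M) / z\<^sup>2"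
    by (rule integral_Markov_inequality_measure[OF conjunct1[OF sq], where A = "space M"]) (use z in simp_all)
  also have "\<dots> \<le> (\<Sum>j<N. \<integral>\<omega>. (s + D j \<omega>) * indicator (C j) \<omega> \<partial>M) / z\<^sup>2"
    using sq by (intro divide_right_mono) auto
  also have "\<dots> \<le> (\<Sum>j<N. \<integral>\<omega>. (s + D j \<omega>) * indicator (B j) \<omega> \<partial>M) / z\<^sup>2"
  proof (intro divide_right_mono sum_mono integral_mono)
    fix j
    have "B j \<in> sets M" "C j \<in> sets M" using B[of j] C[of j] sub[of j] by (auto simp: subalgebra_def)
    then show "integrable M (\<lambda>\<omega>. (s + D j \<omega>) * indicator (C j) \<omega>)" "integrable M (\<lambda>\<omega>. (s + D j \<omega>) * indicator (B j) \<omega>)"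
      using D_int by (auto intro!: integrable_real_mult_indicator)
    show "(s + D j \<omega>) * indicator (C j) \<omega> \<le> (s + D j \<omega>) * indicator (B j) \<omega>" for \<omega>
      using s_nonneg D_nonneg by (intro mult_left_mono) (auto simp: C_def indicator_def)
  qed simp
  finally show ?thesis .
qed

lemma negated: "bounded_martingale M G (\<lambda>j \<omega>. - d j \<omega>) D b s"
proof
  show "(\<lambda>\<omega>. - d j \<omega>) \<in> borel_measurable (G (Suc j))" for j using adapted[of j] by measurable
  show "(\<integral>\<omega>. W \<omega> * - d j \<omega> \<partial>M) = 0"
    if "W \<in> borel_measurable (G j)" "\<And>\<omega>. \<omega> \<in> space M \<Longrightarrow> \<bar>W \<omega>\<bar> \<le> K" for j W K
    using centred[OF that] by simp
  show "(\<integral>\<omega>. W \<omega> * (- d j \<omega>)\<^sup>2 \<partial>M) \<le> (\<integral>\<omega>. W \<omega> * (s + D j \<omega>) \<partial>M)"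
    if "W \<in> borel_measurable (G j)" "\<And>\<omega>. \<omega> \<in> space M \<Longrightarrow> 0 \<le> W \<omega> \<and> W \<omega> \<le> K" for j W K
    using variance[OF that] by simp
qed (use sub mono bounded b_nonneg s_nonneg D_meas D_nonneg D_int in auto)

text \<open>The increments are split by the predictable event that the accumulated excess \<open>D\<close> is still at
  most \<open>y / 2\<close>. While it holds, the accumulated conditional variance is at most \<open>y\<close> and the
  exponential inequality applies; afterwards Chebyshev's inequality costs only the expected
  excess, because there \<open>N s \<le> y / 2\<close> is itself dominated by the excess.\<close>

lemma deviation_pos:
  assumes p: "2 \<le> p" and b: "0 < b" and y0: "0 < y" and Ns: "real N * s \<le> y / 2"
  shows "prob {\<omega>\<in>space M. \<exists>k\<le>N. (2 * p + 1) * b \<le> \<bar>\<Sum>i<k. d i \<omega>\<bar>}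
    \<le> 2 * (y / b\<^sup>2) powr p + 2 / b\<^sup>2 * (\<Sum>j<N. \<integral>\<omega>. D j \<omega> \<partial>M)"
proof -
  define A where "A = (\<lambda>j \<omega>. \<Sum>i\<le>j. D i \<omega>)"
  have AM: "A j \<in> borel_measurable (G j)" for j
    unfolding A_def by (rule borel_measurable_sum) (rule meas_mono[OF D_meas], simp)
  have A_mono: "A i \<omega> \<le> A j \<omega>" if "i \<le> j" for i j \<omega>
    unfolding A_def using that D_nonneg by (intro sum_mono2) auto
  define B where "B = (\<lambda>j. {\<omega>\<in>space M. A j \<omega> \<le> y / 2})"
  define B' where "B' = (\<lambda>j. {\<omega>\<in>space M. \<not> A j \<omega> \<le> y / 2})"
  have B: "B j \<in> sets (G j)" "B' j \<in> sets (G j)" for j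
    unfolding B_def B'_def space_G[of j, symmetric] using AM[of j] by measurable
  have excess: "(\<Sum>j<N. D j \<omega> * indicator (B j) \<omega>) \<le> y / 2" if w: "\<omega> \<in> space M" for \<omega>
  proof -
    have "(\<Sum>j<n. D j \<omega> * indicator (B j) \<omega>) \<le> y / 2" for n
    proof (induction n)
      case (Suc n)
      show ?case
      proof (cases "\<omega> \<in> B n")
        case True
        have "(\<Sum>j<Suc n. D j \<omega> * indicator (B j) \<omega>) \<le> (\<Sum>j<Suc n. D j \<omega>)"
          using D_nonneg by (intro sum_mono) (auto simp: indicator_def)
        also have "\<dots> = A n \<omega>" by (simp add: A_def lessThan_Suc_atMost)
        also have "\<dots> \<le> y / 2" using True by (simp add: B_def)
        finally show ?thesis .
      qed (use Suc in simp)
    qed (use y0 in simp)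
    then show ?thesis .
  qed
  have yB: "(\<Sum>j<N. (s + D j \<omega>) * indicator (B j) \<omega>) \<le> y" if w: "\<omega> \<in> space M" for \<omega>
  proof -
    have "(\<Sum>j<N. (s + D j \<omega>) * indicator (B j) \<omega>) \<le> (\<Sum>j<N. s + D j \<omega> * indicator (B j) \<omega>)"
      using s_nonneg by (intro sum_mono) (auto simp: indicator_def)
    also have "\<dots> \<le> y" using excess[OF w] Ns by (simp add: sum.distrib)
    finally show ?thesis .
  qed
  interpret neg: bounded_martingale M G "\<lambda>j \<omega>. - d j \<omega>" D b s by (rule negated)
  let ?S = "\<lambda>k \<omega>. \<Sum>i<k. d i \<omega> * indicator (B i) \<omega>"
  let ?S' = "\<lambda>k \<omega>. \<Sum>i<k. d i \<omega> * indicator (B' i) \<omega>"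
  let ?E1 = "{\<omega>\<in>space M. \<exists>k\<le>N. 2 * p * b \<le> ?S k \<omega>}"
  let ?E2 = "{\<omega>\<in>space M. \<exists>k\<le>N. 2 * p * b \<le> (\<Sum>i<k. - d i \<omega> * indicator (B i) \<omega>)}"
  let ?E3 = "{\<omega>\<in>space M. \<exists>k\<le>N. b \<le> \<bar>?S' k \<omega>\<bar>}"
  have E: "?E1 \<in> sets M" "?E2 \<in> sets M" "?E3 \<in> sets M"
    by (rule predictable_max_event neg.predictable_max_event, rule B, simp)+
  have "{\<omega>\<in>space M. \<exists>k\<le>N. (2 * p + 1) * b \<le> \<bar>\<Sum>i<k. d i \<omega>\<bar>} \<subseteq> ?E1 \<union> ?E2 \<union> ?E3"
  proof (rule subsetI, rule ccontr)
    fix \<omega> assume "\<omega> \<in> {\<omega>\<in>space M. \<exists>k\<le>N. (2 * p + 1) * b \<le> \<bar>\<Sum>i<k. d i \<omega>\<bar>}"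
    then obtain k where w: "\<omega> \<in> space M" and k: "k \<le> N" "(2 * p + 1) * b \<le> \<bar>\<Sum>i<k. d i \<omega>\<bar>" by auto
    assume "\<omega> \<notin> ?E1 \<union> ?E2 \<union> ?E3"
    then have "\<not> 2 * p * b \<le> ?S k \<omega>" "\<not> 2 * p * b \<le> (\<Sum>i<k. - d i \<omega> * indicator (B i) \<omega>)" "\<not> b \<le> \<bar>?S' k \<omega>\<bar>"
      using w k(1) by blast+
    moreover have "(\<Sum>i<k. - d i \<omega> * indicator (B i) \<omega>) = - ?S k \<omega>" by (simp only: mult_minus_left sum_negf)
    moreover have "(\<Sum>i<k. d i \<omega>) = ?S k \<omega> + ?S' k \<omega>"
      unfolding sum.distrib[symmetric] using w by (intro sum.cong) (auto simp: B_def B'_def indicator_def)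
    ultimately show False using k(2) by (simp only: distrib_right mult_1)
  qed
  then have "prob {\<omega>\<in>space M. \<exists>k\<le>N. (2 * p + 1) * b \<le> \<bar>\<Sum>i<k. d i \<omega>\<bar>} \<le> prob (?E1 \<union> ?E2 \<union> ?E3)"
    by (rule finite_measure_mono) (intro sets.Un E)
  also have "\<dots> \<le> prob (?E1 \<union> ?E2) + prob ?E3" by (intro measure_Un_le sets.Un E)
  also have "prob (?E1 \<union> ?E2) \<le> prob ?E1 + prob ?E2" by (intro measure_Un_le E)
  also have "prob ?E1 \<le> (y / b\<^sup>2) powr p" by (rule power_maximal[OF B(1) p b y0 yB])
  also have "prob ?E2 \<le> (y / b\<^sup>2) powr p" by (rule neg.power_maximal[OF B(1) p b y0 yB])
  also have "prob ?E3 \<le> (\<Sum>j<N. \<integral>\<omega>. (s + D j \<omega>) * indicator (B' j) \<omega> \<partial>M) / b\<^sup>2"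
    by (rule square_maximal[OF B(2) b])
  also have "(\<Sum>j<N. \<integral>\<omega>. (s + D j \<omega>) * indicator (B' j) \<omega> \<partial>M) \<le> 2 * (\<Sum>j<N. \<integral>\<omega>. D j \<omega> \<partial>M)"
  proof -
    have B'M: "B' j \<in> sets M" for j using B(2)[of j] sub[of j] by (auto simp: subalgebra_def)
    have i: "integrable M (\<lambda>\<omega>. (s + D j \<omega>) * indicator (B' j) \<omega>)" for j
      using D_int B'M by (intro integrable_real_mult_indicator) auto
    have "(\<Sum>j<N. \<integral>\<omega>. (s + D j \<omega>) * indicator (B' j) \<omega> \<partial>M) = (\<integral>\<omega>. (\<Sum>j<N. (s + D j \<omega>) * indicator (B' j) \<omega>) \<partial>M)"
      by (rule Bochner_Integration.integral_sum[symmetric]) (rule i)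
    also have "\<dots> \<le> (\<integral>\<omega>. 2 * (\<Sum>j<N. D j \<omega>) \<partial>M)"
    proof (rule integral_mono)
      show "integrable M (\<lambda>\<omega>. \<Sum>j<N. (s + D j \<omega>) * indicator (B' j) \<omega>)"
        by (rule Bochner_Integration.integrable_sum) (rule i)
      show "integrable M (\<lambda>\<omega>. 2 * (\<Sum>j<N. D j \<omega>))" using D_int by simp
      fix \<omega> assume w: "\<omega> \<in> space M"
      show "(\<Sum>j<N. (s + D j \<omega>) * indicator (B' j) \<omega>) \<le> 2 * (\<Sum>j<N. D j \<omega>)"
      proof (cases "\<exists>j<N. \<omega> \<in> B' j")
        case True
        then obtain j where j: "j < N" "y / 2 < A j \<omega>" by (auto simp: B'_def)
        have "A j \<omega> \<le> (\<Sum>j<N. D j \<omega>)" unfolding A_def using j D_nonneg by (intro sum_mono2) auto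
        then have big: "y / 2 \<le> (\<Sum>j<N. D j \<omega>)" using j by simp
        have "(\<Sum>j<N. (s + D j \<omega>) * indicator (B' j) \<omega>) \<le> (\<Sum>j<N. s + D j \<omega>)"
          using s_nonneg D_nonneg by (intro sum_mono) (auto simp: indicator_def)
        also have "\<dots> = real N * s + (\<Sum>j<N. D j \<omega>)" by (simp add: sum.distrib)
        finally show ?thesis using Ns big by simp
      next
        case False
        then have "(\<Sum>j<N. (s + D j \<omega>) * indicator (B' j) \<omega>) = 0" by (intro sum.neutral) auto
        then show ?thesis using D_nonneg by (simp add: sum_nonneg)
      qed
    qed
    also have "\<dots> = 2 * (\<Sum>j<N. \<integral>\<omega>. D j \<omega> \<partial>M)" using D_int by simp
    finally show ?thesis .
  qed
  finally show ?thesis by (simp add: divide_right_mono)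
qed

text \<open>The limit \<open>y' \<down> y\<close> includes \<open>y = 0\<close>, where the first term vanishes.\<close>

lemma deviation:
  assumes p: "2 \<le> p" and b: "0 < b" and Ns: "real N * s \<le> y / 2"
  shows "prob {\<omega>\<in>space M. \<exists>k\<le>N. (2 * p + 1) * b \<le> \<bar>\<Sum>i<k. d i \<omega>\<bar>}
    \<le> 2 * (y / b\<^sup>2) powr p + 2 / b\<^sup>2 * (\<Sum>j<N. \<integral>\<omega>. D j \<omega> \<partial>M)"
proof -
  have "0 \<le> real N * s" using s_nonneg by simp
  then have y: "0 \<le> y" using Ns by linarith
  let ?R = "\<lambda>y. 2 * (y / b\<^sup>2) powr p + 2 / b\<^sup>2 * (\<Sum>j<N. \<integral>\<omega>. D j \<omega> \<partial>M)"
  have right: "eventually (\<lambda>y'. y < y') (at_right y)" by (simp add: eventually_at_filter)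
  then have "eventually (\<lambda>y'. 0 \<le> y' / b\<^sup>2) (at_right y)"
    by (rule eventually_mono) (use y in simp)
  then have "((\<lambda>y'. (y' / b\<^sup>2) powr p) \<longlongrightarrow> (y / b\<^sup>2) powr p) (at_right y)"
    using p b by (intro tendsto_powr' tendsto_divide tendsto_const tendsto_ident_at) auto
  then have "(?R \<longlongrightarrow> ?R y) (at_right y)"
    by (intro tendsto_add tendsto_mult tendsto_const)
  moreover have "eventually (\<lambda>y'. prob {\<omega>\<in>space M. \<exists>k\<le>N. (2 * p + 1) * b \<le> \<bar>\<Sum>i<k. d i \<omega>\<bar>} \<le> ?R y') (at_right y)"
    using right by (rule eventually_mono) (rule deviation_pos[OF p b], use y Ns in linarith, use Ns in linarith)
  ultimately show ?thesis by (rule tendsto_lowerbound) simp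
qed

end

section \<open>Stationarity and the dependency coefficients\<close>

definition lower_set :: "real set \<Rightarrow> bool" where
  "lower_set D \<longleftrightarrow> (\<forall>x y. y \<in> D \<longrightarrow> x \<le> y \<longrightarrow> x \<in> D)"

text \<open>A set that is closed downwards is a half-line or trivial; its indicator is a pointwise limit of
  indicators of closed half-lines, which are what the coefficients control.\<close>

lemma lower_set_limit:
  assumes "lower_set D"
  shows "\<exists>x :: nat \<Rightarrow> real. \<forall>y. (\<lambda>m. indicat_real {..x m} y) \<longlonglongrightarrow> indicat_real D y"
proof -
  have low: "x \<in> D" if "y \<in> D" "x \<le> y" for x y
    using assms that unfolding lower_set_def by blast
  have ev: "(\<lambda>m. indicat_real {..x m} y) \<longlonglongrightarrow> indicat_real D y"
    if "eventually (\<lambda>m. y \<le> x m \<longleftrightarrow> y \<in> D) sequentially" for x :: "nat \<Rightarrow> real" and y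
    by (rule tendsto_eventually) (use that in \<open>auto simp: indicator_def elim!: eventually_mono\<close>)
  consider "D = {}" | "D = UNIV" | "D \<noteq> {}" "D \<noteq> UNIV" by blast
  then show ?thesis
  proof cases
    case 1
    have "eventually (\<lambda>m. y \<le> - real m \<longleftrightarrow> y \<in> D) sequentially" for y
    proof -
      obtain n :: nat where "- y < real n" using reals_Archimedean2 by blast
      then show ?thesis using 1 by (auto simp: eventually_sequentially intro!: exI[of _ n])
    qed
    then show ?thesis by (intro exI[of _ "\<lambda>m. - real m"] allI ev)
  next
    case 2
    have "eventually (\<lambda>m. y \<le> real m \<longleftrightarrow> y \<in> D) sequentially" for y
    proof -
      obtain n :: nat where "y < real n" using reals_Archimedean2 by blast
      then show ?thesis using 2 by (auto simp: eventually_sequentially intro!: exI[of _ n])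
    qed
    then show ?thesis by (intro exI[of _ "\<lambda>m. real m"] allI ev)
  next
    case 3
    then obtain z where z: "z \<notin> D" by auto
    have bdd: "bdd_above D" using low z by (intro bdd_aboveI[of _ z]) (meson linear)
    have inD: "y \<in> D" if "y < Sup D" for y
      using less_cSupD[OF 3(1) that] low by (meson less_imp_le)
    have leS: "y \<le> Sup D" if "y \<in> D" for y using that bdd by (rule cSup_upper)
    show ?thesis
    proof (cases "Sup D \<in> D")
      case True
      then have "y \<le> Sup D \<longleftrightarrow> y \<in> D" for y using leS low by blast
      then show ?thesis by (intro exI[of _ "\<lambda>_. Sup D"] allI ev) auto
    next
      case False
      have "eventually (\<lambda>m. y \<le> Sup D - 1 / real (Suc m) \<longleftrightarrow> y \<in> D) sequentially" for y
      proof (cases "y \<in> D")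
        case True
        then have "0 < Sup D - y" using leS[of y] False by (cases "y = Sup D") auto
        then obtain n where n: "inverse (real (Suc n)) < Sup D - y" using reals_Archimedean by blast
        have "y \<le> Sup D - 1 / real (Suc m)" if "n \<le> m" for m
        proof -
          have "1 / real (Suc m) \<le> 1 / real (Suc n)" using that by (simp add: frac_le)
          then show ?thesis using n by (simp add: inverse_eq_divide)
        qed
        then show ?thesis using True by (auto simp: eventually_sequentially)
      next
        case no: False
        have "\<not> y \<le> Sup D - 1 / real (Suc m)" for m
        proof
          assume "y \<le> Sup D - 1 / real (Suc m)"
          moreover have "0 < 1 / real (Suc m)" by simp
          ultimately have "y < Sup D" by linarith
          then show False using inD no by simp
        qed
        then show ?thesis using no by simp
      qed
      then show ?thesis by (intro exI[of _ "\<lambda>m. Sup D - 1 / real (Suc m)"] allI ev)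
    qed
  qed
qed

lemma interval_as_difference:
  assumes "is_interval J"
  obtains D D' where "lower_set D" "lower_set D'"
    "\<And>y. indicat_real J y = indicat_real D y - indicat_real D' y"
proof -
  define D where "D = {y. \<exists>z\<in>J. y \<le> z}"
  have "J \<subseteq> D" by (auto simp: D_def)
  have low: "x \<in> D - J" if y: "y \<in> D - J" and xy: "x \<le> y" for x y
  proof -
    from y obtain z where z: "z \<in> J" "y \<le> z" by (auto simp: D_def)
    have "x \<notin> J"
    proof
      assume "x \<in> J"
      then have "y \<in> J" using assms z xy unfolding is_interval_1 by blast
      then show False using y by simp
    qed
    moreover have "x \<in> D" using z xy unfolding D_def by (auto intro!: bexI[of _ z])
    ultimately show "x \<in> D - J" by simp
  qed
  show thesis
  proof (rule that[of D "D - J"])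
    show "lower_set D" unfolding lower_set_def D_def using order_trans by blast
    show "lower_set (D - J)" unfolding lower_set_def using low by blast
    show "indicat_real J y = indicat_real D y - indicat_real (D - J) y" for y
      using \<open>J \<subseteq> D\<close> by (auto simp: indicator_def)
  qed
qed

lemma lp_norm_1: "lp_norm M 1 X = (\<integral>\<^sup>+\<omega>. ennreal \<bar>X \<omega>\<bar> \<partial>M)"
  by (simp add: lp_norm_def epowr_def less_top)

lemma alpha_inv_antimono: "u \<le> v \<Longrightarrow> alpha_inv a v \<le> alpha_inv a u"
  unfolding alpha_inv_def by (intro Inf_superset_mono) (use ennreal_leI order_trans in blast)

lemma alpha_inv_attained:
  assumes "alpha_inv a u \<le> enat k"
  obtains q where "alpha_inv a u = enat q" "q \<le> k" "a q \<le> ennreal u"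
proof -
  have ne: "{enat q | q. a q \<le> ennreal u} \<noteq> {}"
  proof
    assume "{enat q | q. a q \<le> ennreal u} = {}"
    then have "alpha_inv a u = \<infinity>" unfolding alpha_inv_def Inf_enat_def by simp
    then show False using assms by simp
  qed
  then have "alpha_inv a u \<in> {enat q | q. a q \<le> ennreal u}"
    unfolding alpha_inv_def by (metis (no_types, lifting) ex_in_conv wellorder_InfI)
  then show thesis using assms that by auto
qed

locale stationary_sequence = prob_space M for M :: "'a measure" +
  fixes F0 :: "'a measure" and T :: "'a \<Rightarrow> 'a" and Y0 :: "'a \<Rightarrow> real"
  assumes T_meas: "T \<in> measurable M M"
    and T_distr: "distr M M T = M"
    and sub0: "subalgebra M F0"
    and F0_T: "sets F0 \<subseteq> {T -` A \<inter> space M | A. A \<in> sets F0}"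
    and Y0_meas: "Y0 \<in> borel_measurable F0"
begin

definition Y :: "nat \<Rightarrow> 'a \<Rightarrow> real" where
  "Y k = (\<lambda>\<omega>. Y0 ((T ^^ k) \<omega>))"

definition past :: "nat \<Rightarrow> 'a measure" where
  "past k = vimage_algebra (space M) (T ^^ k) F0"

abbreviation \<mu> :: "real measure" where "\<mu> \<equiv> distr M borel Y0"

lemma T_pow_meas [measurable]: "(T ^^ k) \<in> measurable M M"
proof (induction k)
  case (Suc k)
  show ?case unfolding funpow.simps by (rule measurable_comp[OF Suc T_meas])
qed (simp add: measurable_ident)

lemma T_pow_space: "\<omega> \<in> space M \<Longrightarrow> (T ^^ k) \<omega> \<in> space M"
  using measurable_space[OF T_pow_meas] .

lemma T_pow_distr: "distr M M (T ^^ k) = M"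
proof (induction k)
  case (Suc k)
  have "distr M M (T ^^ Suc k) = distr (distr M M (T ^^ k)) M T"
    by (subst distr_distr[OF T_meas T_pow_meas]) simp
  then show ?case using Suc T_distr by (simp only:)
qed (simp add: distr_id2)

lemma integral_shift:
  fixes f :: "'a \<Rightarrow> real"
  assumes "f \<in> borel_measurable M"
  shows "(\<integral>\<omega>. f ((T ^^ k) \<omega>) \<partial>M) = (\<integral>\<omega>. f \<omega> \<partial>M)"
  using integral_distr[OF T_pow_meas assms, of k] T_pow_distr by simp

lemma integrable_shift:
  fixes f :: "'a \<Rightarrow> real"
  assumes "integrable M f"
  shows "integrable M (\<lambda>\<omega>. f ((T ^^ k) \<omega>))"
proof -
  have "integrable (distr M M (T ^^ k)) f" using assms by (simp only: T_pow_distr)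
  then show ?thesis by (rule integrable_distr[OF T_pow_meas])
qed

lemma Y0_M [measurable]: "Y0 \<in> borel_measurable M"
  by (rule measurable_from_subalg[OF sub0 Y0_meas])

lemma Y_meas [measurable]: "Y k \<in> borel_measurable M"
  unfolding Y_def by measurable

lemma Y_shift: "Y k ((T ^^ j) \<omega>) = Y (k + j) \<omega>"
  by (simp add: Y_def funpow_add)

lemma orbit_seq_Y: "orbit_seq M T Y0 (int k) = Y k"
  by (simp add: orbit_seq_def int_iterate_def Y_def)

lemma sets_past: "sets (past k) = {(T ^^ k) -` A \<inter> space M | A. A \<in> sets F0}"
  unfolding past_def using T_pow_space sub0
  by (intro sets_vimage_algebra2) (auto simp: subalgebra_def)

lemma space_past [simp]: "space (past k) = space M"
  by (simp add: past_def)

lemma past_subalgebra: "subalgebra M (past k)"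
proof -
  have "(T ^^ k) -` A \<inter> space M \<in> sets M" if "A \<in> sets F0" for A
    using that sub0 by (intro measurable_sets[OF T_pow_meas]) (auto simp: subalgebra_def)
  then show ?thesis by (auto simp: subalgebra_def sets_past)
qed

lemma past_mono: "i \<le> j \<Longrightarrow> sets (past i) \<subseteq> sets (past j)"
proof (induction j rule: dec_induct)
  case (step j)
  have "sets (past j) \<subseteq> sets (past (Suc j))"
  proof
    fix B assume "B \<in> sets (past j)"
    then obtain A where A: "A \<in> sets F0" "B = (T ^^ j) -` A \<inter> space M" by (auto simp: sets_past)
    obtain A' where A': "A' \<in> sets F0" "A = T -` A' \<inter> space M" using F0_T A(1) by blast
    have "B = (T ^^ Suc j) -` A' \<inter> space M" using A A' T_pow_space by auto
    then show "B \<in> sets (past (Suc j))" using A'(1) by (auto simp: sets_past)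
  qed
  then show ?case using step by blast
qed simp

lemma past_shift: "W \<in> borel_measurable F0 \<Longrightarrow> (\<lambda>\<omega>. W ((T ^^ k) \<omega>)) \<in> borel_measurable (past k)"
  unfolding past_def using T_pow_space sub0
  by (intro measurable_compose[OF measurable_vimage_algebra1]) (auto simp: subalgebra_def)

lemma Y_past: "Y k \<in> borel_measurable (past k)"
  unfolding Y_def by (rule past_shift[OF Y0_meas])

lemma meas_past_mono: "f \<in> borel_measurable (past i) \<Longrightarrow> i \<le> j \<Longrightarrow> f \<in> borel_measurable (past j)"
  using past_mono[of i j] by (intro measurable_from_subalg[of "past j" "past i"]) (auto simp: subalgebra_def)

lemma cond_subalgebra: "subalgebra M F \<Longrightarrow> sigma_finite_subalgebra M F"
  by (intro finite_measure_subalgebra_is_sigma_finite finite_measure_subalgebra.intro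
      finite_measure_subalgebra_axioms.intro finite_measure_axioms)

text \<open>Conditioning at time \<open>k\<close> reduces to conditioning at time \<open>0\<close>, where the coefficients are
  defined.\<close>

lemma cond_exp_shift:
  assumes Z: "integrable M Z"
  shows "AE \<omega> in M. real_cond_exp M (past k) (\<lambda>\<omega>. Z ((T ^^ k) \<omega>)) \<omega> = real_cond_exp M F0 Z ((T ^^ k) \<omega>)"
proof -
  interpret P: sigma_finite_subalgebra M "past k" by (rule cond_subalgebra[OF past_subalgebra])
  interpret F: sigma_finite_subalgebra M F0 by (rule cond_subalgebra[OF sub0])
  have ZM [measurable]: "Z \<in> borel_measurable M" using Z by simp
  have E: "integrable M (real_cond_exp M F0 Z)" by (rule F.real_cond_exp_int(1)[OF Z])
  show ?thesis
  proof (rule P.real_cond_exp_charact)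
    fix A assume "A \<in> sets (past k)"
    then obtain B where B: "B \<in> sets F0" "A = (T ^^ k) -` B \<inter> space M" by (auto simp: sets_past)
    have BM [measurable]: "B \<in> sets M" using B(1) sub0 by (auto simp: subalgebra_def)
    have ind: "indicat_real A \<omega> = indicat_real B ((T ^^ k) \<omega>)" if "\<omega> \<in> space M" for \<omega>
      using that B(2) by (auto simp: indicator_def)
    have "(\<integral>\<omega>\<in>A. Z ((T ^^ k) \<omega>) \<partial>M) = (\<integral>\<omega>. (\<lambda>\<omega>. indicat_real B \<omega> * Z \<omega>) ((T ^^ k) \<omega>) \<partial>M)"
      unfolding set_lebesgue_integral_def by (intro Bochner_Integration.integral_cong) (auto simp: ind)
    also have "\<dots> = (\<integral>\<omega>. indicat_real B \<omega> * Z \<omega> \<partial>M)" by (rule integral_shift) measurable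
    also have "\<dots> = (\<integral>\<omega>. indicat_real B \<omega> * real_cond_exp M F0 Z \<omega> \<partial>M)"
      using B(1) Z BM by (intro F.real_cond_exp_intg(2)[symmetric]) (auto intro: integrable_mult_indicator[where f = Z, simplified])
    also have "\<dots> = (\<integral>\<omega>. (\<lambda>\<omega>. indicat_real B \<omega> * real_cond_exp M F0 Z \<omega>) ((T ^^ k) \<omega>) \<partial>M)"
      by (rule integral_shift[symmetric]) measurable
    also have "\<dots> = (\<integral>\<omega>\<in>A. real_cond_exp M F0 Z ((T ^^ k) \<omega>) \<partial>M)"
      unfolding set_lebesgue_integral_def by (intro Bochner_Integration.integral_cong) (auto simp: ind)
    finally show "(\<integral>\<omega>\<in>A. Z ((T ^^ k) \<omega>) \<partial>M) = (\<integral>\<omega>\<in>A. real_cond_exp M F0 Z ((T ^^ k) \<omega>) \<partial>M)" .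
  next
    show "integrable M (\<lambda>\<omega>. Z ((T ^^ k) \<omega>))" by (rule integrable_shift[OF Z])
    show "integrable M (\<lambda>\<omega>. real_cond_exp M F0 Z ((T ^^ k) \<omega>))" by (rule integrable_shift[OF E])
    show "(\<lambda>\<omega>. real_cond_exp M F0 Z ((T ^^ k) \<omega>)) \<in> borel_measurable (past k)"
      by (rule past_shift) (rule borel_measurable_cond_exp)
  qed
qed

text \<open>The coefficients are norms of conditional expectations; against a test function they bound
  covariances.\<close>

definition cov :: "('a \<Rightarrow> real) \<Rightarrow> ('a \<Rightarrow> real) \<Rightarrow> real" where
  "cov W Z = (\<integral>\<omega>. W \<omega> * Z \<omega> \<partial>M) - (\<integral>\<omega>. W \<omega> \<partial>M) * (\<integral>\<omega>. Z \<omega> \<partial>M)"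

definition test :: "('a \<Rightarrow> real) \<Rightarrow> bool" where
  "test W \<longleftrightarrow> W \<in> borel_measurable F0 \<and> (\<forall>\<omega>\<in>space M. \<bar>W \<omega>\<bar> \<le> 1)"

lemma test_meas: "test W \<Longrightarrow> W \<in> borel_measurable M"
  using measurable_from_subalg[OF sub0] by (auto simp: test_def)

lemma test_mult_integrable: "test W \<Longrightarrow> integrable M Z \<Longrightarrow> integrable M (\<lambda>\<omega>. W \<omega> * Z \<omega>)"
  by (rule bounded_mult_integrable[OF test_meas]) (auto simp: test_def)

lemma cov_le_lp_norm:
  assumes W: "test W" and Z: "integrable M Z" and a: "0 \<le> a"
    and le: "lp_norm M 1 (\<lambda>\<omega>. real_cond_exp M F0 Z \<omega> - (\<integral>\<omega>. Z \<omega> \<partial>M)) \<le> ennreal a"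
  shows "\<bar>cov W Z\<bar> \<le> a"
proof -
  interpret F: sigma_finite_subalgebra M F0 by (rule cond_subalgebra[OF sub0])
  let ?E = "real_cond_exp M F0 Z"
  let ?D = "\<lambda>\<omega>. ?E \<omega> - (\<integral>\<omega>. Z \<omega> \<partial>M)"
  have E: "integrable M ?E" by (rule F.real_cond_exp_int(1)[OF Z])
  then have D: "integrable M ?D" by simp
  have WM [measurable]: "W \<in> borel_measurable M" by (rule test_meas[OF W])
  have Wint: "integrable M W" using W by (intro bounded_integrable[where K = 1]) (auto simp: test_def)
  have "(\<integral>\<omega>. W \<omega> * Z \<omega> \<partial>M) = (\<integral>\<omega>. W \<omega> * ?E \<omega> \<partial>M)"
    using W Z by (intro F.real_cond_exp_intg(2)[symmetric] test_mult_integrable) (auto simp: test_def)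
  then have "cov W Z = (\<integral>\<omega>. W \<omega> * ?D \<omega> \<partial>M)"
    using Wint test_mult_integrable[OF W E] by (simp add: cov_def right_diff_distrib)
  also have "\<bar>\<dots>\<bar> \<le> (\<integral>\<omega>. \<bar>W \<omega> * ?D \<omega>\<bar> \<partial>M)" by (rule integral_abs_bound)
  also have "\<dots> \<le> (\<integral>\<omega>. \<bar>?D \<omega>\<bar> \<partial>M)"
    using W by (intro integral_mono integrable_abs test_mult_integrable[OF W] D)
      (auto simp: test_def abs_mult intro!: mult_left_le_one_le)
  also have "\<dots> \<le> a"
  proof -
    have "ennreal (\<integral>\<omega>. \<bar>?D \<omega>\<bar> \<partial>M) = (\<integral>\<^sup>+\<omega>. ennreal \<bar>?D \<omega>\<bar> \<partial>M)"
      using D by (intro nn_integral_eq_integral[symmetric]) auto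
    then have "ennreal (\<integral>\<omega>. \<bar>?D \<omega>\<bar> \<partial>M) \<le> ennreal a" using le by (simp only: lp_norm_1)
    then show ?thesis using a by (simp only: ennreal_le_iff)
  qed
  finally show ?thesis .
qed

definition cen :: "nat \<Rightarrow> (real \<Rightarrow> real) \<Rightarrow> 'a \<Rightarrow> real" where
  "cen k \<phi> = (\<lambda>\<omega>. \<phi> (Y k \<omega>) - (\<integral>\<omega>. \<phi> (Y k \<omega>) \<partial>M))"

lemma cen_meas: "\<phi> \<in> borel_measurable borel \<Longrightarrow> cen k \<phi> \<in> borel_measurable M"
  unfolding cen_def by (intro borel_measurable_diff borel_measurable_const measurable_compose[OF Y_meas])

lemma cen_shift:
  assumes [measurable]: "\<phi> \<in> borel_measurable borel"
  shows "cen k \<phi> ((T ^^ j) \<omega>) = cen (k + j) \<phi> \<omega>"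
proof -
  have "(\<integral>\<omega>. \<phi> (Y (k + j) \<omega>) \<partial>M) = (\<integral>\<omega>. \<phi> (Y k \<omega>) \<partial>M)"
    unfolding Y_shift[symmetric] by (rule integral_shift) measurable
  then show ?thesis by (simp add: cen_def Y_shift)
qed

lemma comp_integrable:
  fixes \<phi> :: "real \<Rightarrow> real"
  assumes [measurable]: "\<phi> \<in> borel_measurable borel" and "\<And>y. \<bar>\<phi> y\<bar> \<le> 1"
  shows "integrable M (\<lambda>\<omega>. \<phi> (Y k \<omega>))"
  using assms by (intro bounded_integrable[where K = 1]) auto

lemma cen_bound:
  assumes "\<phi> \<in> borel_measurable borel" "\<And>y. \<bar>\<phi> y\<bar> \<le> 1"
  shows "\<bar>cen k \<phi> \<omega>\<bar> \<le> 2"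
proof -
  have "\<bar>\<integral>\<omega>. \<phi> (Y k \<omega>) \<partial>M\<bar> \<le> (\<integral>\<omega>. \<bar>\<phi> (Y k \<omega>)\<bar> \<partial>M)" by (rule integral_abs_bound)
  also have "\<dots> \<le> (\<integral>\<omega>. 1 \<partial>M)" using comp_integrable[OF assms] assms(2) by (intro integral_mono) auto
  finally show ?thesis using assms(2)[of "Y k \<omega>"] by (simp add: cen_def prob_space)
qed

lemma cen_integral:
  assumes "\<phi> \<in> borel_measurable borel" "\<And>y. \<bar>\<phi> y\<bar> \<le> 1"
  shows "integrable M (cen k \<phi>)" "(\<integral>\<omega>. cen k \<phi> \<omega> \<partial>M) = 0"
  using comp_integrable[OF assms, of k] by (auto simp: cen_def prob_space)

lemma cen_mult_integrable:
  assumes "\<phi> \<in> borel_measurable borel" "\<And>y. \<bar>\<phi> y\<bar> \<le> 1" "\<psi> \<in> borel_measurable borel" "\<And>y. \<bar>\<psi> y\<bar> \<le> 1"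
  shows "integrable M (\<lambda>\<omega>. cen k \<phi> \<omega> * cen l \<psi> \<omega>)"
proof (rule bounded_integrable[where K = "2 * 2"])
  show "(\<lambda>\<omega>. cen k \<phi> \<omega> * cen l \<psi> \<omega>) \<in> borel_measurable M"
    using cen_meas[OF assms(1), of k] cen_meas[OF assms(3), of l] by measurable
  show "\<bar>cen k \<phi> \<omega> * cen l \<psi> \<omega>\<bar> \<le> 2 * 2" for \<omega>
    unfolding abs_mult using cen_bound[OF assms(1,2)] cen_bound[OF assms(3,4)] by (intro mult_mono) auto
qed

lemma cen_limit:
  assumes [measurable]: "\<And>m. \<phi> m \<in> borel_measurable borel" "\<psi> \<in> borel_measurable borel"
    and bd: "\<And>m y. \<bar>\<phi> m y\<bar> \<le> 1" and lim: "\<And>y. (\<lambda>m. \<phi> m y) \<longlonglongrightarrow> \<psi> y"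
  shows "(\<lambda>m. cen k (\<phi> m) \<omega>) \<longlonglongrightarrow> cen k \<psi> \<omega>"
proof -
  have "(\<lambda>m. \<integral>\<omega>. \<phi> m (Y k \<omega>) \<partial>M) \<longlonglongrightarrow> (\<integral>\<omega>. \<psi> (Y k \<omega>) \<partial>M)"
    using bd lim by (intro integral_dominated_convergence[where w = "\<lambda>_. 1"]) auto
  then show ?thesis unfolding cen_def by (intro tendsto_diff lim)
qed

lemma cov_limit:
  assumes W: "test W" and [measurable]: "\<And>m. Z m \<in> borel_measurable M" "Z' \<in> borel_measurable M"
    and bd: "\<And>m \<omega>. \<omega> \<in> space M \<Longrightarrow> \<bar>Z m \<omega>\<bar> \<le> K" and lim: "\<And>\<omega>. \<omega> \<in> space M \<Longrightarrow> (\<lambda>m. Z m \<omega>) \<longlonglongrightarrow> Z' \<omega>"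
    and le: "\<And>m. \<bar>cov W (Z m)\<bar> \<le> a"
  shows "\<bar>cov W Z'\<bar> \<le> a"
proof -
  have [measurable]: "W \<in> borel_measurable M" by (rule test_meas[OF W])
  have "(\<lambda>m. \<integral>\<omega>. Z m \<omega> \<partial>M) \<longlonglongrightarrow> (\<integral>\<omega>. Z' \<omega> \<partial>M)"
    using bd lim by (intro integral_dominated_convergence[where w = "\<lambda>_. K"]) auto
  moreover have "(\<lambda>m. \<integral>\<omega>. W \<omega> * Z m \<omega> \<partial>M) \<longlonglongrightarrow> (\<integral>\<omega>. W \<omega> * Z' \<omega> \<partial>M)"
  proof (intro integral_dominated_convergence[where w = "\<lambda>_. K"])
    show "AE \<omega> in M. (\<lambda>m. W \<omega> * Z m \<omega>) \<longlonglongrightarrow> W \<omega> * Z' \<omega>"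
      using lim by (intro AE_I2 tendsto_mult_left)
    show "AE \<omega> in M. norm (W \<omega> * Z m \<omega>) \<le> K" for m
    proof (rule AE_I2)
      fix \<omega> assume w: "\<omega> \<in> space M"
      have "\<bar>W \<omega>\<bar> * \<bar>Z m \<omega>\<bar> \<le> 1 * K" using W w bd[OF w, of m] by (intro mult_mono) (auto simp: test_def)
      then show "norm (W \<omega> * Z m \<omega>) \<le> K" by (simp add: abs_mult)
    qed
  qed auto
  ultimately have "(\<lambda>m. cov W (Z m)) \<longlonglongrightarrow> cov W Z'" unfolding cov_def by (intro tendsto_intros)
  then have "(\<lambda>m. \<bar>cov W (Z m)\<bar>) \<longlonglongrightarrow> \<bar>cov W Z'\<bar>" by (rule tendsto_rabs)
  then show ?thesis by (rule LIMSEQ_le_const2) (use le in auto)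
qed

lemma cov_diff:
  assumes "test W" "integrable M Z" "integrable M Z'"
  shows "cov W (\<lambda>\<omega>. Z \<omega> - Z' \<omega>) = cov W Z - cov W Z'"
  using assms test_mult_integrable by (simp add: cov_def algebra_simps)

abbreviation \<alpha> :: "nat \<Rightarrow> nat \<Rightarrow> ennreal" where
  "\<alpha> k n \<equiv> alpha_seq M F0 (orbit_seq M T Y0) k n"

lemma alpha_1_le_2: "\<alpha> 1 n \<le> \<alpha> 2 n"
proof (cases "n = 0")
  case False
  have "{1..1::nat} \<subseteq> {1..2}" by auto
  then show ?thesis unfolding alpha_seq_def using False by (simp only: if_False) (intro Max_mono image_mono; simp)
qed (simp add: alpha_seq_def)

lemma alpha_decreasing:
  assumes "1 \<le> m" "m \<le> n"
  shows "\<alpha> k n \<le> \<alpha> k m"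
proof (cases "k = 0")
  case False
  let ?s = "\<lambda>n l. SUP i\<in>{i :: nat \<Rightarrow> int. int n \<le> i 1 \<and> mono_on {1..l} i}.
    alpha M F0 l (\<lambda>j. orbit_seq M T Y0 (i j))"
  have step: "?s n l \<le> ?s m l" for l using assms by (intro SUP_subset_mono) auto
  have "?s n l \<le> Max (?s m ` {1..k})" if "l \<in> {1..k}" for l
    by (rule order_trans[OF step Max_ge[OF _ imageI[OF that]]]) simp
  then have "Max (?s n ` {1..k}) \<le> Max (?s m ` {1..k})" using False by (intro Max.boundedI) auto
  then show ?thesis using assms by (simp add: alpha_seq_def)
qed (use assms in \<open>simp add: alpha_seq_def\<close>)

lemma alpha_le_alpha_seq:
  assumes "l \<in> {1..k}" "1 \<le> n" "int n \<le> i 1" "mono_on {1..l} i"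
  shows "alpha M F0 l (\<lambda>j. orbit_seq M T Y0 (i j)) \<le> \<alpha> k n"
proof -
  let ?s = "\<lambda>l. SUP i\<in>{i :: nat \<Rightarrow> int. int n \<le> i 1 \<and> mono_on {1..l} i}.
    alpha M F0 l (\<lambda>j. orbit_seq M T Y0 (i j))"
  have "alpha M F0 l (\<lambda>j. orbit_seq M T Y0 (i j)) \<le> ?s l" using assms by (intro SUP_upper) auto
  also have "\<dots> \<le> Max (?s ` {1..k})" using assms by (intro Max_ge) auto
  finally show ?thesis using assms by (simp add: alpha_seq_def)
qed

lemma centred_halfline: "centred M (indicat_real {\<omega>. Y k \<omega> \<le> x}) = cen k (indicat_real {..x})"
proof -
  have "indicat_real {\<omega>. Y k \<omega> \<le> x} = (\<lambda>\<omega>. indicat_real {..x} (Y k \<omega>))" by (auto simp: indicator_def)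
  then show ?thesis by (simp only: centred_def cen_def)
qed

lemma cov_halfline:
  assumes W: "test W" and q: "1 \<le> q" "q \<le> k" and a: "0 \<le> a" "\<alpha> 1 q \<le> ennreal a"
  shows "\<bar>cov W (cen k (indicat_real {..x}))\<bar> \<le> a"
proof (rule cov_le_lp_norm[OF W _ a(1)])
  show "integrable M (cen k (indicat_real {..x}))" by (rule cen_integral) (auto simp: indicator_def)
  let ?Z = "\<lambda>x. centred_indicator_prod M 1 (\<lambda>j. orbit_seq M T Y0 (int k)) x"
  have Z: "?Z (\<lambda>_. x) = cen k (indicat_real {..x})"
    by (rule ext) (simp add: centred_indicator_prod_def orbit_seq_Y centred_halfline)
  have "lp_norm M 1 (\<lambda>\<omega>. real_cond_exp M F0 (?Z (\<lambda>_. x)) \<omega> - (\<integral>\<omega>. ?Z (\<lambda>_. x) \<omega> \<partial>M))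
      \<le> alpha M F0 1 (\<lambda>j. orbit_seq M T Y0 (int k))"
    unfolding alpha_def by (rule SUP_upper) simp
  also have "\<dots> \<le> \<alpha> 1 q" by (rule alpha_le_alpha_seq) (use q in \<open>auto simp: monotone_on_def\<close>)
  also have "\<dots> \<le> ennreal a" by (rule a)
  finally show "lp_norm M 1 (\<lambda>\<omega>. real_cond_exp M F0 (cen k (indicat_real {..x})) \<omega>
      - (\<integral>\<omega>. cen k (indicat_real {..x}) \<omega> \<partial>M)) \<le> ennreal a" unfolding Z .
qed

lemma cov_halfline_pair:
  assumes W: "test W" and q: "1 \<le> q" "q \<le> k" "k \<le> l" and a: "0 \<le> a" "\<alpha> 2 q \<le> ennreal a"
  shows "\<bar>cov W (\<lambda>\<omega>. cen k (indicat_real {..x}) \<omega> * cen l (indicat_real {..y}) \<omega>)\<bar> \<le> a"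
proof (rule cov_le_lp_norm[OF W _ a(1)])
  let ?z = "\<lambda>\<omega>. cen k (indicat_real {..x}) \<omega> * cen l (indicat_real {..y}) \<omega>"
  show "integrable M ?z" by (rule cen_mult_integrable) (auto simp: indicator_def)
  let ?i = "\<lambda>j::nat. if j = 1 then int k else int l"
  let ?Z = "\<lambda>x. centred_indicator_prod M 2 (\<lambda>j. orbit_seq M T Y0 (?i j)) x"
  let ?x = "\<lambda>j::nat. if j = 1 then x else y"
  have 12: "{Suc 0..2} = {1, 2}" by auto
  have Z: "?Z ?x = ?z"
    by (rule ext) (simp add: centred_indicator_prod_def 12 orbit_seq_Y centred_halfline)
  have "lp_norm M 1 (\<lambda>\<omega>. real_cond_exp M F0 (?Z ?x) \<omega> - (\<integral>\<omega>. ?Z ?x \<omega> \<partial>M))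
      \<le> alpha M F0 2 (\<lambda>j. orbit_seq M T Y0 (?i j))"
    unfolding alpha_def by (rule SUP_upper) simp
  also have "\<dots> \<le> \<alpha> 2 q" by (rule alpha_le_alpha_seq) (use q in \<open>auto simp: monotone_on_def\<close>)
  also have "\<dots> \<le> ennreal a" by (rule a)
  finally show "lp_norm M 1 (\<lambda>\<omega>. real_cond_exp M F0 ?z \<omega> - (\<integral>\<omega>. ?z \<omega> \<partial>M)) \<le> ennreal a" unfolding Z .
qed

lemma lower_set_borel: "lower_set D \<Longrightarrow> D \<in> sets borel"
  unfolding lower_set_def by (rule real_interval_borel_measurable) (unfold is_interval_1, blast)

lemma indicat_bound: "\<bar>indicat_real A y\<bar> \<le> 1"
  by (simp add: indicator_def)

lemma cen_difference:
  assumes "D \<in> sets borel" "D' \<in> sets borel" and J: "\<And>y. indicat_real J y = indicat_real D y - indicat_real D' y"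
  shows "cen k (indicat_real J) = (\<lambda>\<omega>. cen k (indicat_real D) \<omega> - cen k (indicat_real D') \<omega>)"
proof -
  have "integrable M (\<lambda>\<omega>. indicat_real D (Y k \<omega>))" "integrable M (\<lambda>\<omega>. indicat_real D' (Y k \<omega>))"
    using assms by (auto intro!: comp_integrable indicat_bound)
  then show ?thesis unfolding cen_def J by (auto simp: fun_eq_iff)
qed

text \<open>An interval is a difference of two downward closed sets, so each interval costs a factor
  \<open>2\<close>.\<close>

lemma cov_interval:
  assumes W: "test W" and q: "1 \<le> q" "q \<le> k" and a: "0 \<le> a" "\<alpha> 1 q \<le> ennreal a" and J: "is_interval J"
  shows "\<bar>\<integral>\<omega>. W \<omega> * cen k (indicat_real J) \<omega> \<partial>M\<bar> \<le> 2 * a"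
proof -
  have low: "\<bar>cov W (cen k (indicat_real D))\<bar> \<le> a" if D: "lower_set D" for D
  proof -
    have DM [measurable]: "D \<in> sets borel" by (rule lower_set_borel[OF D])
    obtain x where x: "\<And>y. (\<lambda>m. indicat_real {..x m :: real} y) \<longlonglongrightarrow> indicat_real D y"
      using lower_set_limit[OF D] by blast
    show ?thesis
    proof (rule cov_limit[OF W, where K = 2])
      show "cen k (indicat_real {..x m}) \<in> borel_measurable M" "cen k (indicat_real D) \<in> borel_measurable M" for m
        by (rule cen_meas, measurable)+
      show "\<bar>cen k (indicat_real {..x m}) \<omega>\<bar> \<le> 2" for m \<omega> by (rule cen_bound) (auto simp: indicator_def)
      show "(\<lambda>m. cen k (indicat_real {..x m}) \<omega>) \<longlonglongrightarrow> cen k (indicat_real D) \<omega>" for \<omega>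
        by (rule cen_limit) (use x in \<open>auto simp: indicat_bound\<close>)
      show "\<bar>cov W (cen k (indicat_real {..x m}))\<bar> \<le> a" for m by (rule cov_halfline[OF W q a])
    qed
  qed
  obtain D D' where D: "lower_set D" "lower_set D'"
    and J_eq: "\<And>y. indicat_real J y = indicat_real D y - indicat_real D' y"
    by (rule interval_as_difference[OF J]) blast
  have DM: "D \<in> sets borel" "D' \<in> sets borel" using D by (auto intro: lower_set_borel)
  note i = cen_integral[OF borel_measurable_indicator indicat_bound]
  have "cov W (cen k (indicat_real J)) = cov W (cen k (indicat_real D)) - cov W (cen k (indicat_real D'))"
    unfolding cen_difference[OF DM J_eq] using DM by (intro cov_diff[OF W] i) auto
  then have "\<bar>cov W (cen k (indicat_real J))\<bar> \<le> 2 * a" using low[OF D(1)] low[OF D(2)] by linarith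
  moreover have "(\<integral>\<omega>. cen k (indicat_real J) \<omega> \<partial>M) = 0"
    using real_interval_borel_measurable[OF J] by (intro i) auto
  ultimately show ?thesis by (simp add: cov_def)
qed

lemma cov_interval_pair_ordered:
  assumes W: "test W" and q: "1 \<le> q" "q \<le> k" "k \<le> l" and a: "0 \<le> a" "\<alpha> 2 q \<le> ennreal a"
    and J: "is_interval J" "is_interval J'"
  shows "\<bar>cov W (\<lambda>\<omega>. cen k (indicat_real J) \<omega> * cen l (indicat_real J') \<omega>)\<bar> \<le> 4 * a"
proof -
  have low: "\<bar>cov W (\<lambda>\<omega>. cen k (indicat_real D) \<omega> * cen l (indicat_real E) \<omega>)\<bar> \<le> a"
    if D: "lower_set D" and E: "lower_set E" for D E
  proof -
    have DM [measurable]: "D \<in> sets borel" "E \<in> sets borel" using lower_set_borel[OF D] lower_set_borel[OF E] by auto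
    obtain x where x: "\<And>y. (\<lambda>m. indicat_real {..x m :: real} y) \<longlonglongrightarrow> indicat_real D y"
      using lower_set_limit[OF D] by blast
    obtain z where z: "\<And>y. (\<lambda>m. indicat_real {..z m :: real} y) \<longlonglongrightarrow> indicat_real E y"
      using lower_set_limit[OF E] by blast
    note m = cen_meas[OF borel_measurable_indicator] and b = cen_bound[OF borel_measurable_indicator indicat_bound]
    show ?thesis
    proof (rule cov_limit[OF W, where K = "2 * 2"])
      show "(\<lambda>\<omega>. cen k (indicat_real {..x m}) \<omega> * cen l (indicat_real {..z m}) \<omega>) \<in> borel_measurable M" for m
        by (intro borel_measurable_times m) auto
      show "(\<lambda>\<omega>. cen k (indicat_real D) \<omega> * cen l (indicat_real E) \<omega>) \<in> borel_measurable M"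
        by (intro borel_measurable_times m DM)
      show "\<bar>cen k (indicat_real {..x m}) \<omega> * cen l (indicat_real {..z m}) \<omega>\<bar> \<le> 2 * 2" for m \<omega>
        unfolding abs_mult by (intro mult_mono b) auto
      show "(\<lambda>m. cen k (indicat_real {..x m}) \<omega> * cen l (indicat_real {..z m}) \<omega>)
          \<longlonglongrightarrow> cen k (indicat_real D) \<omega> * cen l (indicat_real E) \<omega>" for \<omega>
        by (intro tendsto_mult cen_limit) (use x z in \<open>auto simp: indicat_bound\<close>)
      show "\<bar>cov W (\<lambda>\<omega>. cen k (indicat_real {..x m}) \<omega> * cen l (indicat_real {..z m}) \<omega>)\<bar> \<le> a" for m
        by (rule cov_halfline_pair[OF W q a])
    qed
  qed
  obtain D D' where D: "lower_set D" "lower_set D'"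
    and J_eq: "\<And>y. indicat_real J y = indicat_real D y - indicat_real D' y"
    by (rule interval_as_difference[OF J(1)]) blast
  obtain E E' where E: "lower_set E" "lower_set E'"
    and J'_eq: "\<And>y. indicat_real J' y = indicat_real E y - indicat_real E' y"
    by (rule interval_as_difference[OF J(2)]) blast
  have M: "D \<in> sets borel" "D' \<in> sets borel" "E \<in> sets borel" "E' \<in> sets borel"
    using D E by (auto intro: lower_set_borel)
  let ?p = "\<lambda>A B \<omega>. cen k (indicat_real A) \<omega> * cen l (indicat_real B) \<omega>"
  have i: "integrable M (?p A B)" if "A \<in> sets borel" "B \<in> sets borel" for A B
    using that by (intro cen_mult_integrable indicat_bound) auto
  have "(\<lambda>\<omega>. cen k (indicat_real J) \<omega> * cen l (indicat_real J') \<omega>)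
      = (\<lambda>\<omega>. (?p D E \<omega> - ?p D E' \<omega>) - (?p D' E \<omega> - ?p D' E' \<omega>))"
    unfolding cen_difference[OF M(1,2) J_eq] cen_difference[OF M(3,4) J'_eq] by (auto simp: algebra_simps)
  then have "cov W (\<lambda>\<omega>. cen k (indicat_real J) \<omega> * cen l (indicat_real J') \<omega>)
      = (cov W (?p D E) - cov W (?p D E')) - (cov W (?p D' E) - cov W (?p D' E'))"
    using i M by (simp add: cov_diff[OF W])
  moreover have "\<bar>cov W (?p D E)\<bar> \<le> a" "\<bar>cov W (?p D E')\<bar> \<le> a" "\<bar>cov W (?p D' E)\<bar> \<le> a" "\<bar>cov W (?p D' E')\<bar> \<le> a"
    by (intro low D E)+
  ultimately show ?thesis by linarith
qed

lemma cov_interval_pair: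
  assumes "test W" "1 \<le> q" "q \<le> k" "q \<le> l" "0 \<le> a" "\<alpha> 2 q \<le> ennreal a" "is_interval J" "is_interval J'"
  shows "\<bar>cov W (\<lambda>\<omega>. cen k (indicat_real J) \<omega> * cen l (indicat_real J') \<omega>)\<bar> \<le> 4 * a"
proof (cases "k \<le> l")
  case True
  then show ?thesis using cov_interval_pair_ordered[of W q k l a J J'] assms by simp
next
  case False
  then have "\<bar>cov W (\<lambda>\<omega>. cen l (indicat_real J') \<omega> * cen k (indicat_real J) \<omega>)\<bar> \<le> 4 * a"
    using cov_interval_pair_ordered[of W q l k a J' J] assms by simp
  then show ?thesis by (simp only: mult.commute)
qed

lemma integral_indicator_Y:
  assumes "A \<in> sets borel"
  shows "(\<integral>\<omega>. indicat_real A (Y k \<omega>) \<partial>M) = measure \<mu> A"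
proof -
  have [measurable]: "A \<in> sets borel" by fact
  have "(\<integral>\<omega>. indicat_real A (Y k \<omega>) \<partial>M) = (\<integral>\<omega>. (\<lambda>\<omega>. indicat_real A (Y0 \<omega>)) ((T ^^ k) \<omega>) \<partial>M)"
    by (simp add: Y_def)
  also have "\<dots> = (\<integral>\<omega>. indicat_real A (Y0 \<omega>) \<partial>M)" by (rule integral_shift) measurable
  also have "\<dots> = (\<integral>y. indicat_real A y \<partial>\<mu>)" by (rule integral_distr[symmetric]) measurable
  finally show ?thesis by simp
qed

lemma measure_mu_01: "0 \<le> measure \<mu> A" "measure \<mu> A \<le> 1"
  using prob_space.prob_le_1[OF prob_space_distr[OF Y0_M]] by auto

lemma cen_indicat: "A \<in> sets borel \<Longrightarrow> cen k (indicat_real A) \<omega> = indicat_real A (Y k \<omega>) - measure \<mu> A"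
  by (simp add: cen_def integral_indicator_Y)

lemma cen_indicat_bound: "A \<in> sets borel \<Longrightarrow> \<bar>cen k (indicat_real A) \<omega>\<bar> \<le> 1"
  using measure_mu_01[of A] by (auto simp: cen_indicat indicator_def)

lemma cen_indicat_past:
  assumes [measurable]: "A \<in> sets borel"
  shows "cen k (indicat_real A) \<in> borel_measurable (past k)"
proof -
  note Y_past[measurable]
  show ?thesis unfolding cen_def by measurable
qed

lemma cen_indicat_abs_integral:
  assumes A [measurable]: "A \<in> sets borel"
  shows "(\<integral>\<omega>. \<bar>cen k (indicat_real A) \<omega>\<bar> \<partial>M) \<le> 2 * measure \<mu> A"
proof -
  have i: "integrable M (\<lambda>\<omega>. indicat_real A (Y k \<omega>))" by (rule comp_integrable) (auto simp: indicat_bound)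
  have "(\<integral>\<omega>. \<bar>cen k (indicat_real A) \<omega>\<bar> \<partial>M) \<le> (\<integral>\<omega>. indicat_real A (Y k \<omega>) + measure \<mu> A \<partial>M)"
    using i cen_integral(1)[OF borel_measurable_indicator[OF A] indicat_bound] measure_mu_01[of A]
    by (intro integral_mono) (auto simp: cen_indicat[OF A] indicator_def)
  also have "\<dots> = 2 * measure \<mu> A" using i by (simp add: integral_indicator_Y[OF A] prob_space)
  finally show ?thesis .
qed

text \<open>The bounds by the two probabilities hold because a joint probability and a product of
  probabilities both lie between \<open>0\<close> and the smaller of the two; the remaining bound is mixing
  with the first indicator as test function, which gives nothing at lag \<open>0\<close>. Taking the
  minimum of all three is what produces integrals of \<open>Q\<^sup>2\<close> over \<open>[0, 2 \<alpha>]\<close>.\<close>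

lemma cov_indicators:
  assumes J: "is_interval J" "is_interval J'"
  shows "\<bar>\<integral>\<omega>. cen j (indicat_real J) \<omega> * cen (m + j) (indicat_real J') \<omega> \<partial>M\<bar>
    \<le> min (if m = 0 then 1 else enn2real (min 1 (2 * \<alpha> 1 m))) (min (measure \<mu> J) (measure \<mu> J'))"
proof -
  have JM [measurable]: "J \<in> sets borel" "J' \<in> sets borel" using J by (auto intro: real_interval_borel_measurable)
  let ?p = "\<lambda>\<omega>. cen 0 (indicat_real J) \<omega> * cen m (indicat_real J') \<omega>"
  have [measurable]: "cen 0 (indicat_real J) \<in> borel_measurable M" "cen m (indicat_real J') \<in> borel_measurable M"
    by (auto intro!: cen_meas)
  have "(\<integral>\<omega>. cen j (indicat_real J) \<omega> * cen (m + j) (indicat_real J') \<omega> \<partial>M) = (\<integral>\<omega>. ?p ((T ^^ j) \<omega>) \<partial>M)"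
    by (simp add: cen_shift)
  also have "\<dots> = (\<integral>\<omega>. ?p \<omega> \<partial>M)" by (rule integral_shift) measurable
  finally have shift: "(\<integral>\<omega>. cen j (indicat_real J) \<omega> * cen (m + j) (indicat_real J') \<omega> \<partial>M) = (\<integral>\<omega>. ?p \<omega> \<partial>M)" .
  let ?A = "\<lambda>\<omega>. indicat_real J (Y 0 \<omega>)" and ?B = "\<lambda>\<omega>. indicat_real J' (Y m \<omega>)"
  let ?a = "measure \<mu> J" and ?b = "measure \<mu> J'"
  have iA: "integrable M ?A" and iB: "integrable M ?B" by (auto intro!: comp_integrable indicat_bound)
  have iAB: "integrable M (\<lambda>\<omega>. ?A \<omega> * ?B \<omega>)" by (rule bounded_integrable[where K = 1]) (auto simp: indicator_def)
  have a: "(\<integral>\<omega>. ?A \<omega> \<partial>M) = ?a" and b: "(\<integral>\<omega>. ?B \<omega> \<partial>M) = ?b" by (rule integral_indicator_Y, measurable)+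
  have "(\<integral>\<omega>. ?p \<omega> \<partial>M) = (\<integral>\<omega>. ?A \<omega> * ?B \<omega> - ?b * ?A \<omega> - ?a * ?B \<omega> + ?a * ?b \<partial>M)"
    by (intro Bochner_Integration.integral_cong) (auto simp: cen_indicat algebra_simps)
  also have "\<dots> = (\<integral>\<omega>. ?A \<omega> * ?B \<omega> \<partial>M) - ?a * ?b"
    using iA iB iAB a b by (simp add: prob_space)
  finally have p: "(\<integral>\<omega>. ?p \<omega> \<partial>M) = (\<integral>\<omega>. ?A \<omega> * ?B \<omega> \<partial>M) - ?a * ?b" .
  have "0 \<le> (\<integral>\<omega>. ?A \<omega> * ?B \<omega> \<partial>M)" by (intro integral_nonneg_AE) auto
  moreover have "(\<integral>\<omega>. ?A \<omega> * ?B \<omega> \<partial>M) \<le> ?a" unfolding a[symmetric]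
    using iA iAB by (intro integral_mono) (auto simp: indicator_def)
  moreover have "(\<integral>\<omega>. ?A \<omega> * ?B \<omega> \<partial>M) \<le> ?b" unfolding b[symmetric]
    using iB iAB by (intro integral_mono) (auto simp: indicator_def)
  moreover have "?a * ?b \<le> ?a * 1" "?a * ?b \<le> 1 * ?b" "0 \<le> ?a * ?b"
    using measure_mu_01 by (intro mult_mono mult_nonneg_nonneg; simp)+
  ultimately have ab: "\<bar>\<integral>\<omega>. ?p \<omega> \<partial>M\<bar> \<le> min ?a ?b" unfolding p min.bounded_iff by linarith
  have "\<bar>\<integral>\<omega>. ?p \<omega> \<partial>M\<bar> \<le> enn2real (min 1 (2 * \<alpha> 1 m))" if m: "m \<noteq> 0"
  proof (cases "2 * \<alpha> 1 m \<le> 1")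
    case True
    have fin: "\<alpha> 1 m \<noteq> top"
    proof
      assume "\<alpha> 1 m = top"
      then have "2 * \<alpha> 1 m = top" by (simp add: ennreal_mult_top)
      then show False using True by (simp add: top_unique)
    qed
    note Y0_meas[measurable]
    have "cen 0 (indicat_real J) \<in> borel_measurable F0"
      unfolding cen_def Y_def funpow_0 by measurable
    then have "test (cen 0 (indicat_real J))" using cen_indicat_bound[OF JM(1)] by (simp add: test_def)
    then have "\<bar>\<integral>\<omega>. ?p \<omega> \<partial>M\<bar> \<le> 2 * enn2real (\<alpha> 1 m)"
      using m fin J(2) by (intro cov_interval[where q = m]) (auto simp: less_top)
    also have "\<dots> = enn2real (min 1 (2 * \<alpha> 1 m))"
      using True by (simp add: min_absorb2 enn2real_mult)
    finally show ?thesis .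
  next
    case False
    then have "min 1 (2 * \<alpha> 1 m) = 1" by (simp add: min_def)
    moreover have "?a \<le> 1" by (rule measure_mu_01)
    ultimately show ?thesis using ab by simp
  qed
  moreover have "?a \<le> 1" by (rule measure_mu_01)
  ultimately show ?thesis unfolding shift using ab by auto
qed

end

section \<open>Blocks of a truncated step form\<close>

text \<open>Every distance to \<open>j\<close> occurs at most twice.\<close>

lemma sum_distance_le:
  fixes f :: "nat \<Rightarrow> ennreal"
  assumes "j \<in> {1..q}"
  shows "(\<Sum>k\<in>{1..q}. f (if j \<le> k then k - j else j - k)) \<le> 2 * (\<Sum>m<q. f m)"
proof -
  have "(\<Sum>k\<in>{1..q}. f (if j \<le> k then k - j else j - k))
      = (\<Sum>k\<in>{j..q}. f (k - j)) + (\<Sum>k\<in>{1..<j}. f (j - k))"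
  proof -
    have "{1..q} = {j..q} \<union> {1..<j}" "{j..q} \<inter> {1..<j} = {}" using assms by auto
    then have "(\<Sum>k\<in>{1..q}. f (if j \<le> k then k - j else j - k))
        = (\<Sum>k\<in>{j..q}. f (if j \<le> k then k - j else j - k)) + (\<Sum>k\<in>{1..<j}. f (if j \<le> k then k - j else j - k))"
      by (simp add: sum.union_disjoint)
    then show ?thesis by (auto intro!: arg_cong2[where f = "(+)"] sum.cong)
  qed
  also have "(\<Sum>k\<in>{j..q}. f (k - j)) = (\<Sum>m\<in>(\<lambda>k. k - j) ` {j..q}. f m)"
    by (subst sum.reindex) (auto simp: inj_on_def)
  also have "\<dots> \<le> (\<Sum>m<q. f m)" using assms by (intro sum_mono2) auto
  also have "(\<Sum>k\<in>{1..<j}. f (j - k)) = (\<Sum>m\<in>(\<lambda>k. j - k) ` {1..<j}. f m)"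
    by (subst sum.reindex) (auto simp: inj_on_def)
  also have "\<dots> \<le> (\<Sum>m<q. f m)" using assms by (intro sum_mono2) auto
  finally show ?thesis by (simp add: mult_2)
qed

text \<open>\<open>K\<close> is the truncation level, \<open>q\<close> the block length and \<open>v\<close> a bound for the dependence at
  distance \<open>q\<close>. The assumption on the mass is the budget at level \<open>K\<close>: only layers up to
  \<open>K\<close> are kept.\<close>

locale blocks = stationary_sequence M F0 T Y0
  for M F0 :: "'a measure" and T :: "'a \<Rightarrow> 'a" and Y0 :: "'a \<Rightarrow> real" +
  fixes H :: "real \<Rightarrow> real" and I :: "'i set" and c t :: "'i \<Rightarrow> real" and J :: "'i \<Rightarrow> real set"
    and K v :: real and q :: nat
  assumes tail: "tail_function H" and form: "step_form H \<mu> I c t J"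
    and mass: "(\<Sum>\<iota>\<in>I. \<bar>c \<iota>\<bar>) \<le> 2 * K"
    and q: "1 \<le> q" and v: "0 \<le> v" "\<alpha> 2 q \<le> ennreal v"
begin

lemma finite_I: "finite I"
  using form by (simp add: step_form_def)

lemma J_interval: "\<iota> \<in> I \<Longrightarrow> is_interval (J \<iota>)"
  using form by (simp add: step_form_def)

lemma J_borel: "\<iota> \<in> I \<Longrightarrow> J \<iota> \<in> sets borel"
  using J_interval real_interval_borel_measurable by blast

lemma K_nonneg: "0 \<le> K"
proof -
  have "0 \<le> (\<Sum>\<iota>\<in>I. \<bar>c \<iota>\<bar>)" by (rule sum_nonneg) simp
  then show ?thesis using mass by linarith
qed

lemma J_indicator: "\<iota> \<in> I \<Longrightarrow> indicat_real (J \<iota>) \<in> borel_measurable borel"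
  using J_borel by (rule borel_measurable_indicator)

definition Z :: "nat \<Rightarrow> 'i \<Rightarrow> 'a \<Rightarrow> real" where
  "Z k \<iota> = cen k (indicat_real (J \<iota>))"

definition X :: "nat \<Rightarrow> 'a \<Rightarrow> real" where
  "X k \<omega> = (\<Sum>\<iota>\<in>I. c \<iota> * Z k \<iota> \<omega>)"

definition U :: "nat \<Rightarrow> 'a \<Rightarrow> real" where
  "U i \<omega> = (\<Sum>k\<in>{1..q}. X (i * q + k) \<omega>)"

lemma Z_bound: "\<iota> \<in> I \<Longrightarrow> \<bar>Z k \<iota> \<omega>\<bar> \<le> 1"
  unfolding Z_def by (rule cen_indicat_bound[OF J_borel])

lemma Z_meas: "\<iota> \<in> I \<Longrightarrow> Z k \<iota> \<in> borel_measurable M"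
  unfolding Z_def by (rule cen_meas[OF J_indicator])

lemma Z_integrable: "\<iota> \<in> I \<Longrightarrow> integrable M (Z k \<iota>)"
  by (rule bounded_integrable[OF Z_meas Z_bound])

lemma ZZ_integrable: "\<iota> \<in> I \<Longrightarrow> \<kappa> \<in> I \<Longrightarrow> integrable M (\<lambda>\<omega>. Z k \<iota> \<omega> * Z l \<kappa> \<omega>)"
  unfolding Z_def by (intro cen_mult_integrable indicat_bound J_indicator)

lemma X_bound: "\<bar>X k \<omega>\<bar> \<le> 2 * K"
proof -
  have "\<bar>X k \<omega>\<bar> \<le> (\<Sum>\<iota>\<in>I. \<bar>c \<iota> * Z k \<iota> \<omega>\<bar>)" unfolding X_def by (rule sum_abs)
  also have "\<dots> \<le> (\<Sum>\<iota>\<in>I. \<bar>c \<iota>\<bar>)" using Z_bound by (intro sum_mono) (auto simp: abs_mult intro: mult_left_le)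
  finally show ?thesis using mass by simp
qed

lemma X_meas [measurable]: "X k \<in> borel_measurable M"
  unfolding X_def[abs_def] by (intro borel_measurable_sum borel_measurable_times borel_measurable_const Z_meas)

lemma X_past: "X k \<in> borel_measurable (past k)"
  unfolding X_def[abs_def] Z_def
  by (intro borel_measurable_sum borel_measurable_times borel_measurable_const cen_indicat_past J_borel)

lemma X_shift: "X k ((T ^^ j) \<omega>) = X (k + j) \<omega>"
  unfolding X_def Z_def by (intro sum.cong refl) (simp add: cen_shift[OF J_indicator])

lemma U_bound: "\<bar>U i \<omega>\<bar> \<le> 2 * (real q * K)"
proof -
  have "\<bar>U i \<omega>\<bar> \<le> (\<Sum>k\<in>{1..q}. \<bar>X (i * q + k) \<omega>\<bar>)" unfolding U_def by (rule sum_abs)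
  also have "\<dots> \<le> (\<Sum>k\<in>{1..q}. 2 * K)" by (intro sum_mono X_bound)
  finally show ?thesis by simp
qed

lemma U_meas [measurable]: "U i \<in> borel_measurable M"
  unfolding U_def[abs_def] by measurable

lemma U_past: "U i \<in> borel_measurable (past (Suc i * q))"
  unfolding U_def[abs_def] by (intro borel_measurable_sum meas_past_mono[OF X_past]) auto

lemma U_shift: "U (Suc i) \<omega> = U 1 ((T ^^ (i * q)) \<omega>)"
  by (simp add: U_def X_shift algebra_simps)

lemma U_integrable: "integrable M (U i)"
  by (rule bounded_integrable[OF U_meas U_bound])

lemma U2_bound: "(U i \<omega>)\<^sup>2 \<le> (2 * (real q * K))\<^sup>2"
  using U_bound[of i \<omega>] by (metis abs_ge_zero power2_abs power_mono)

lemma U2_integrable: "integrable M (\<lambda>\<omega>. (U i \<omega>)\<^sup>2)"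
  by (rule bounded_integrable[where K = "(2 * (real q * K))\<^sup>2"]) (use U2_bound in auto)

text \<open>Block \<open>1\<close> consists of times beyond \<open>q\<close>, so all its indicators are far enough from
  \<open>F0\<close> for mixing; the total mass \<open>2 K\<close> of the coefficients passes the bound from
  indicators to the block and, for pairs of indicators, to its square.\<close>

lemma U_test:
  assumes W: "test W"
  shows "\<bar>\<integral>\<omega>. W \<omega> * U 1 \<omega> \<partial>M\<bar> \<le> real q * (4 * K * v)"
proof -
  have "\<alpha> 1 q \<le> ennreal v" using alpha_1_le_2 v(2) by (rule order_trans)
  then have z: "\<bar>\<integral>\<omega>. W \<omega> * Z k \<iota> \<omega> \<partial>M\<bar> \<le> 2 * v" if "\<iota> \<in> I" "q \<le> k" for k \<iota>
    unfolding Z_def using cov_interval[OF W q that(2) v(1) _ J_interval[OF that(1)]] by simp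
  have X: "\<bar>\<integral>\<omega>. W \<omega> * X k \<omega> \<partial>M\<bar> \<le> 4 * K * v" if "q \<le> k" for k
  proof -
    have "(\<integral>\<omega>. W \<omega> * X k \<omega> \<partial>M) = (\<integral>\<omega>. (\<Sum>\<iota>\<in>I. c \<iota> * (W \<omega> * Z k \<iota> \<omega>)) \<partial>M)"
      by (intro Bochner_Integration.integral_cong) (auto simp: X_def sum_distrib_left algebra_simps)
    also have "\<dots> = (\<Sum>\<iota>\<in>I. c \<iota> * (\<integral>\<omega>. W \<omega> * Z k \<iota> \<omega> \<partial>M))"
      using test_mult_integrable[OF W Z_integrable] by (subst Bochner_Integration.integral_sum) auto
    also have "\<bar>\<dots>\<bar> \<le> (\<Sum>\<iota>\<in>I. \<bar>c \<iota> * (\<integral>\<omega>. W \<omega> * Z k \<iota> \<omega> \<partial>M)\<bar>)" by (rule sum_abs)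
    also have "\<dots> \<le> (\<Sum>\<iota>\<in>I. \<bar>c \<iota>\<bar> * (2 * v))" unfolding abs_mult using z that by (intro sum_mono mult_left_mono) auto
    also have "\<dots> = (\<Sum>\<iota>\<in>I. \<bar>c \<iota>\<bar>) * (2 * v)" by (simp add: sum_distrib_right)
    also have "\<dots> \<le> 2 * K * (2 * v)" using mass v(1) by (intro mult_right_mono) auto
    finally show ?thesis by simp
  qed
  have i: "integrable M (\<lambda>\<omega>. W \<omega> * X k \<omega>)" for k
    by (rule test_mult_integrable[OF W bounded_integrable[OF X_meas X_bound]])
  have "(\<integral>\<omega>. W \<omega> * U 1 \<omega> \<partial>M) = (\<Sum>k\<in>{1..q}. \<integral>\<omega>. W \<omega> * X (1 * q + k) \<omega> \<partial>M)"
    unfolding U_def sum_distrib_left using i by (subst Bochner_Integration.integral_sum) auto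
  also have "\<bar>\<dots>\<bar> \<le> (\<Sum>k\<in>{1..q}. \<bar>\<integral>\<omega>. W \<omega> * X (1 * q + k) \<omega> \<partial>M\<bar>)" by (rule sum_abs)
  also have "\<dots> \<le> (\<Sum>k\<in>{1..q}. 4 * K * v)" by (intro sum_mono X) simp
  finally show ?thesis by simp
qed

lemma cov_sum:
  assumes "test W" "finite A" "\<And>i. i \<in> A \<Longrightarrow> integrable M (f i)"
  shows "cov W (\<lambda>\<omega>. \<Sum>i\<in>A. f i \<omega>) = (\<Sum>i\<in>A. cov W (f i))"
  using assms test_mult_integrable[OF assms(1)]
  by (simp add: cov_def sum_distrib_left Bochner_Integration.integral_sum sum_subtractf)

lemma cov_cmult: "cov W (\<lambda>\<omega>. a * f \<omega>) = a * cov W f"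
proof -
  have "(\<lambda>\<omega>. W \<omega> * (a * f \<omega>)) = (\<lambda>\<omega>. a * (W \<omega> * f \<omega>))" by (auto simp: mult_ac)
  then show ?thesis by (simp add: cov_def algebra_simps)
qed

lemma U2_test:
  assumes W: "test W"
  shows "\<bar>cov W (\<lambda>\<omega>. (U 1 \<omega>)\<^sup>2)\<bar> \<le> 16 * (real q * K)\<^sup>2 * v"
proof -
  let ?S = "{1..q} \<times> I"
  let ?c = "\<lambda>s. c (snd s)" and ?Z = "\<lambda>s. Z (1 * q + fst s) (snd s)"
  have fin: "finite ?S" using finite_I by simp
  have U: "U 1 \<omega> = (\<Sum>s\<in>?S. ?c s * ?Z s \<omega>)" for \<omega>
    unfolding U_def X_def by (simp add: sum.cartesian_product split_beta)
  have "(U 1 \<omega>)\<^sup>2 = (\<Sum>s\<in>?S. \<Sum>r\<in>?S. (?c s * ?c r) * (?Z s \<omega> * ?Z r \<omega>))" for \<omega>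
    unfolding U power2_eq_square sum_product by (simp add: mult_ac)
  moreover have i: "integrable M (\<lambda>\<omega>. (?c s * ?c r) * (?Z s \<omega> * ?Z r \<omega>))" if "s \<in> ?S" "r \<in> ?S" for s r
    using that by (intro integrable_mult_right ZZ_integrable) auto
  ultimately have "cov W (\<lambda>\<omega>. (U 1 \<omega>)\<^sup>2)
      = cov W (\<lambda>\<omega>. \<Sum>s\<in>?S. \<Sum>r\<in>?S. (?c s * ?c r) * (?Z s \<omega> * ?Z r \<omega>))"
    by (simp only:)
  also have "\<dots> = (\<Sum>s\<in>?S. cov W (\<lambda>\<omega>. \<Sum>r\<in>?S. (?c s * ?c r) * (?Z s \<omega> * ?Z r \<omega>)))"
    by (rule cov_sum[OF W fin]) (intro Bochner_Integration.integrable_sum i)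
  also have "\<dots> = (\<Sum>s\<in>?S. \<Sum>r\<in>?S. cov W (\<lambda>\<omega>. (?c s * ?c r) * (?Z s \<omega> * ?Z r \<omega>)))"
    by (rule sum.cong[OF refl], rule cov_sum[OF W fin], rule i)
  also have "\<dots> = (\<Sum>s\<in>?S. \<Sum>r\<in>?S. (?c s * ?c r) * cov W (\<lambda>\<omega>. ?Z s \<omega> * ?Z r \<omega>))"
    by (simp only: cov_cmult)
  finally have expand: "cov W (\<lambda>\<omega>. (U 1 \<omega>)\<^sup>2) = (\<Sum>s\<in>?S. \<Sum>r\<in>?S. (?c s * ?c r) * cov W (\<lambda>\<omega>. ?Z s \<omega> * ?Z r \<omega>))" .
  have "\<bar>cov W (\<lambda>\<omega>. (U 1 \<omega>)\<^sup>2)\<bar> \<le> (\<Sum>s\<in>?S. \<Sum>r\<in>?S. \<bar>(?c s * ?c r) * cov W (\<lambda>\<omega>. ?Z s \<omega> * ?Z r \<omega>)\<bar>)"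
    unfolding expand by (rule order_trans[OF sum_abs sum_mono[OF sum_abs]])
  also have "\<dots> \<le> (\<Sum>s\<in>?S. \<Sum>r\<in>?S. \<bar>?c s\<bar> * \<bar>?c r\<bar> * (4 * v))"
  proof (intro sum_mono)
    fix s r assume s: "s \<in> ?S" and r: "r \<in> ?S"
    have "\<bar>cov W (\<lambda>\<omega>. ?Z s \<omega> * ?Z r \<omega>)\<bar> \<le> 4 * v" unfolding Z_def
      by (rule cov_interval_pair[OF W q _ _ v]) (use s r J_interval in \<open>simp_all add: mem_Times_iff\<close>)
    then show "\<bar>(?c s * ?c r) * cov W (\<lambda>\<omega>. ?Z s \<omega> * ?Z r \<omega>)\<bar> \<le> \<bar>?c s\<bar> * \<bar>?c r\<bar> * (4 * v)"
      unfolding abs_mult by (intro mult_left_mono) auto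
  qed
  also have "\<dots> = (\<Sum>s\<in>?S. \<bar>?c s\<bar>)\<^sup>2 * (4 * v)"
    unfolding power2_eq_square sum_product by (simp add: sum_distrib_right)
  also have "(\<Sum>s\<in>?S. \<bar>?c s\<bar>) = real q * (\<Sum>\<iota>\<in>I. \<bar>c \<iota>\<bar>)"
    using sum.cartesian_product[of "\<lambda>k \<iota>. \<bar>c \<iota>\<bar>" I "{1..q}"] by (simp add: split_beta)
  also have "(real q * (\<Sum>\<iota>\<in>I. \<bar>c \<iota>\<bar>))\<^sup>2 * (4 * v) \<le> (real q * (2 * K))\<^sup>2 * (4 * v)"
    using mass v(1) by (intro mult_right_mono power_mono mult_left_mono) (auto intro!: mult_nonneg_nonneg sum_nonneg)
  finally show ?thesis by (simp add: power_mult_distrib)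
qed

text \<open>Each covariance inside a block is, up to a factor, at most the integral of \<open>Q\<^sup>2\<close> over
  \<open>[0, \<beta> m / 4]\<close>, with \<open>m\<close> the lag, and the number of lags \<open>m < q\<close> with
  \<open>u \<le> \<beta> m / 4\<close> is at most \<open>\<alpha>\<inverse> u\<close>. The quarter leaves room for the convention
  \<open>\<alpha> 0 = 1 / 2\<close>.\<close>

definition \<beta> :: "nat \<Rightarrow> real" where
  "\<beta> m = (if m = 0 then 1 else enn2real (min 1 (2 * \<alpha> 1 m)))"

lemma \<beta>_range: "0 \<le> \<beta> m" "\<beta> m \<le> 1"
proof -
  have "min 1 (2 * \<alpha> 1 m) \<le> ennreal 1" by simp
  then have "enn2real (min 1 (2 * \<alpha> 1 m)) \<le> 1" by (intro enn2real_leI) auto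
  then show "0 \<le> \<beta> m" "\<beta> m \<le> 1" by (auto simp: \<beta>_def)
qed

lemma lag_lt_alpha_inv:
  assumes u: "0 < u" "u \<le> \<beta> m / 4"
  shows "enat m < alpha_inv (\<alpha> 1) u"
proof (rule ccontr)
  assume "\<not> enat m < alpha_inv (\<alpha> 1) u"
  then have "alpha_inv (\<alpha> 1) u \<le> enat m" by simp
  then obtain r where r: "r \<le> m" "\<alpha> 1 r \<le> ennreal u" by (rule alpha_inv_attained)
  have u4: "u \<le> 1 / 4" using u \<beta>_range(2)[of m] by simp
  show False
  proof (cases "r = 0")
    case True
    then have "ennreal (1 / 2) \<le> ennreal u" using r by (simp add: alpha_seq_def)
    then show False using u u4 by (subst (asm) ennreal_le_iff) auto
  next
    case False
    then have "\<alpha> 1 m \<le> \<alpha> 1 r" using r by (intro alpha_decreasing) auto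
    then have "\<alpha> 1 m \<le> ennreal u" using r by simp
    then have "2 * \<alpha> 1 m \<le> ennreal (2 * u)" using u
      by (simp add: ennreal_mult') (metis mult_left_mono zero_le)
    then have "min 1 (2 * \<alpha> 1 m) \<le> ennreal (2 * u)" by (simp add: min.coboundedI2)
    then have "enn2real (min 1 (2 * \<alpha> 1 m)) \<le> 2 * u" using u by (intro enn2real_leI) simp_all
    then have "\<beta> m \<le> 2 * u" using False r by (simp add: \<beta>_def)
    then show False using u by simp
  qed
qed

lemma XX_covariance:
  shows "ennreal \<bar>\<integral>\<omega>. X j \<omega> * X (m + j) \<omega> \<partial>M\<bar> \<le> 16 * (\<integral>\<^sup>+u\<in>{0..\<beta> m / 4}. (quantile_of H u)\<^sup>2 \<partial>lborel)"
proof -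
  have "(\<integral>\<omega>. X j \<omega> * X (m + j) \<omega> \<partial>M) = (\<integral>\<omega>. (\<Sum>\<iota>\<in>I. \<Sum>\<kappa>\<in>I. (c \<iota> * c \<kappa>) * (Z j \<iota> \<omega> * Z (m + j) \<kappa> \<omega>)) \<partial>M)"
    unfolding X_def sum_product by (simp add: mult_ac)
  also have "\<dots> = (\<Sum>\<iota>\<in>I. \<Sum>\<kappa>\<in>I. (c \<iota> * c \<kappa>) * (\<integral>\<omega>. Z j \<iota> \<omega> * Z (m + j) \<kappa> \<omega> \<partial>M))"
    by (simp add: Bochner_Integration.integral_sum Bochner_Integration.integrable_sum ZZ_integrable cong: sum.cong)
  also have "\<bar>\<dots>\<bar> \<le> (\<Sum>\<iota>\<in>I. \<Sum>\<kappa>\<in>I. \<bar>(c \<iota> * c \<kappa>) * (\<integral>\<omega>. Z j \<iota> \<omega> * Z (m + j) \<kappa> \<omega> \<partial>M)\<bar>)"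
    by (rule order_trans[OF sum_abs sum_mono[OF sum_abs]])
  also have "\<dots> \<le> (\<Sum>\<iota>\<in>I. \<Sum>\<kappa>\<in>I. \<bar>c \<iota>\<bar> * \<bar>c \<kappa>\<bar> * min (\<beta> m) (min (H (t \<iota>)) (H (t \<kappa>))))"
  proof (intro sum_mono)
    fix \<iota> \<kappa> assume i: "\<iota> \<in> I" "\<kappa> \<in> I"
    have "\<bar>\<integral>\<omega>. Z j \<iota> \<omega> * Z (m + j) \<kappa> \<omega> \<partial>M\<bar> \<le> min (\<beta> m) (min (measure \<mu> (J \<iota>)) (measure \<mu> (J \<kappa>)))"
      unfolding Z_def \<beta>_def using i by (intro cov_indicators J_interval)
    also have "\<dots> \<le> min (\<beta> m) (min (H (t \<iota>)) (H (t \<kappa>)))"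
      using form i by (intro min.mono) (auto simp: step_form_def)
    finally show "\<bar>(c \<iota> * c \<kappa>) * (\<integral>\<omega>. Z j \<iota> \<omega> * Z (m + j) \<kappa> \<omega> \<partial>M)\<bar>
        \<le> \<bar>c \<iota>\<bar> * \<bar>c \<kappa>\<bar> * min (\<beta> m) (min (H (t \<iota>)) (H (t \<kappa>)))"
      unfolding abs_mult by (intro mult_left_mono) auto
  qed
  finally have "ennreal \<bar>\<integral>\<omega>. X j \<omega> * X (m + j) \<omega> \<partial>M\<bar>
      \<le> ennreal (\<Sum>\<iota>\<in>I. \<Sum>\<kappa>\<in>I. \<bar>c \<iota>\<bar> * \<bar>c \<kappa>\<bar> * min (\<beta> m) (min (H (t \<iota>)) (H (t \<kappa>))))"
    by (rule ennreal_leI)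
  also have "\<dots> \<le> 4 * (\<integral>\<^sup>+u\<in>{0..\<beta> m}. (quantile_of H u)\<^sup>2 \<partial>lborel)"
    by (rule step_form_double_sum[OF tail form \<beta>_range])
  also have "\<dots> \<le> 4 * (4 * (\<integral>\<^sup>+u\<in>{0..\<beta> m / 4}. (quantile_of H u)\<^sup>2 \<partial>lborel))"
    by (intro mult_left_mono nn_integral_antimono_quarter power_mono quantile_antimono) auto
  finally show ?thesis by (simp add: mult.assoc[symmetric])
qed

lemma block_variance:
  assumes "q \<le> n"
  shows "ennreal (\<integral>\<omega>. (U 0 \<omega>)\<^sup>2 \<partial>M) \<le> 32 * of_nat q *
    (\<integral>\<^sup>+u\<in>{0..1}. ennreal_of_enat (min (alpha_inv (\<alpha> 1) u) (enat n)) * (quantile_of H u)\<^sup>2 \<partial>lborel)"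
proof -
  define h where "h m = (\<integral>\<^sup>+u\<in>{0..\<beta> m / 4}. (quantile_of H u)\<^sup>2 \<partial>lborel)" for m
  have i: "integrable M (\<lambda>\<omega>. X j \<omega> * X k \<omega>)" for j k
  proof (rule bounded_integrable[where K = "(2 * K) * (2 * K)"])
    show "\<bar>X j \<omega> * X k \<omega>\<bar> \<le> (2 * K) * (2 * K)" for \<omega>
      unfolding abs_mult using K_nonneg by (intro mult_mono X_bound) auto
  qed measurable
  have pair: "ennreal \<bar>\<integral>\<omega>. X j \<omega> * X k \<omega> \<partial>M\<bar> \<le> 16 * h (if j \<le> k then k - j else j - k)" for j k
  proof (cases "j \<le> k")
    case True
    then show ?thesis using XX_covariance[of j "k - j"] by (simp add: h_def)
  next
    case False
    then show ?thesis using XX_covariance[of k "j - k"] by (simp add: h_def mult.commute)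
  qed
  have "(\<integral>\<omega>. (U 0 \<omega>)\<^sup>2 \<partial>M) = (\<integral>\<omega>. (\<Sum>j\<in>{1..q}. \<Sum>k\<in>{1..q}. X j \<omega> * X k \<omega>) \<partial>M)"
    by (simp add: U_def power2_eq_square sum_product)
  also have "\<dots> = (\<Sum>j\<in>{1..q}. \<Sum>k\<in>{1..q}. \<integral>\<omega>. X j \<omega> * X k \<omega> \<partial>M)"
    by (simp add: Bochner_Integration.integral_sum Bochner_Integration.integrable_sum i)
  also have "\<dots> \<le> (\<Sum>j\<in>{1..q}. \<Sum>k\<in>{1..q}. \<bar>\<integral>\<omega>. X j \<omega> * X k \<omega> \<partial>M\<bar>)" by (intro sum_mono abs_ge_self)
  finally have "ennreal (\<integral>\<omega>. (U 0 \<omega>)\<^sup>2 \<partial>M) \<le> ennreal (\<Sum>j\<in>{1..q}. \<Sum>k\<in>{1..q}. \<bar>\<integral>\<omega>. X j \<omega> * X k \<omega> \<partial>M\<bar>)"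
    by (rule ennreal_leI)
  also have "\<dots> = (\<Sum>j\<in>{1..q}. \<Sum>k\<in>{1..q}. ennreal \<bar>\<integral>\<omega>. X j \<omega> * X k \<omega> \<partial>M\<bar>)"
    by (rule ennreal_double_sum[symmetric]) simp
  also have "\<dots> \<le> (\<Sum>j\<in>{1..q}. \<Sum>k\<in>{1..q}. 16 * h (if j \<le> k then k - j else j - k))"
    by (intro sum_mono pair)
  also have "\<dots> \<le> (\<Sum>j\<in>{1..q}. 2 * (\<Sum>m<q. 16 * h m))"
    by (intro sum_mono sum_distance_le[where f = "\<lambda>m. 16 * h m"])
  also have "\<dots> = 32 * of_nat q * (\<Sum>m<q. h m)"
  proof -
    have "(\<Sum>m<q. 16 * h m) = 16 * (\<Sum>m<q. h m)" by (simp only: sum_distrib_left)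
    then have "2 * (\<Sum>m<q. 16 * h m) = 32 * (\<Sum>m<q. h m)" by (simp only: mult_numeral_left) simp
    then show ?thesis by (simp add: mult_ac)
  qed
  also have "(\<Sum>m<q. h m) = (\<integral>\<^sup>+u. (\<Sum>m<q. (quantile_of H u)\<^sup>2 * indicator {0..\<beta> m / 4} u) \<partial>lborel)"
    unfolding h_def by (subst nn_integral_sum) auto
  also have "\<dots> \<le> (\<integral>\<^sup>+u\<in>{0..1}. ennreal_of_enat (min (alpha_inv (\<alpha> 1) u) (enat n)) * (quantile_of H u)\<^sup>2 \<partial>lborel)"
  proof (rule nn_integral_mono_AE)
    have "AE u in lborel. u \<noteq> (0::real)" by (rule AE_lborel_singleton)
    then show "AE u in lborel. (\<Sum>m<q. (quantile_of H u)\<^sup>2 * indicator {0..\<beta> m / 4} u)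
        \<le> ennreal_of_enat (min (alpha_inv (\<alpha> 1) u) (enat n)) * (quantile_of H u)\<^sup>2 * indicator {0..1} u"
    proof (rule AE_mp, intro AE_I2 impI)
      fix u :: real assume u: "u \<noteq> 0"
      let ?A = "{m. m < q \<and> u \<in> {0..\<beta> m / 4}}"
      have "(\<Sum>m<q. (quantile_of H u)\<^sup>2 * indicator {0..\<beta> m / 4} u) = (\<Sum>m\<in>?A. (quantile_of H u)\<^sup>2)"
        by (rule sum.mono_neutral_cong_right) (auto simp: indicator_def)
      also have "\<dots> = of_nat (card ?A) * (quantile_of H u)\<^sup>2" by simp
      also have "\<dots> \<le> ennreal_of_enat (min (alpha_inv (\<alpha> 1) u) (enat n)) * (quantile_of H u)\<^sup>2 * indicator {0..1} u"
      proof (cases "u \<in> {0..1}")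
        case True
        have "enat (card ?A) \<le> alpha_inv (\<alpha> 1) u"
        proof (cases "alpha_inv (\<alpha> 1) u")
          case (enat r)
          have "?A \<subseteq> {..<r}" using lag_lt_alpha_inv[of u] u True enat by auto
          then have "card ?A \<le> card {..<r}" by (intro card_mono) auto
          then show ?thesis using enat by simp
        qed simp
        moreover have "card ?A \<le> card {..<q}" by (intro card_mono) auto
        ultimately have "enat (card ?A) \<le> min (alpha_inv (\<alpha> 1) u) (enat n)" using assms by simp
        then have "ennreal_of_enat (enat (card ?A)) \<le> ennreal_of_enat (min (alpha_inv (\<alpha> 1) u) (enat n))"
          by (simp only: ennreal_of_enat_le_iff)
        then have "of_nat (card ?A) \<le> ennreal_of_enat (min (alpha_inv (\<alpha> 1) u) (enat n))" by simp
        then show ?thesis using True by (simp add: mult_right_mono)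
      next
        case False
        have "u \<notin> {0..\<beta> m / 4}" for m using \<beta>_range(2)[of m] False by auto
        then have none: "?A = {}" by blast
        show ?thesis unfolding none by simp
      qed
      finally show "(\<Sum>m<q. (quantile_of H u)\<^sup>2 * indicator {0..\<beta> m / 4} u)
        \<le> ennreal_of_enat (min (alpha_inv (\<alpha> 1) u) (enat n)) * (quantile_of H u)\<^sup>2 * indicator {0..1} u" .
    qed
  qed
  finally show ?thesis by (simp add: mult_left_mono)
qed

text \<open>The part of a block that is predicted by the past one block earlier, clipped to the range of the
  block sum so that the martingale differences are bounded everywhere.\<close>

definition R :: "nat \<Rightarrow> 'a \<Rightarrow> real" where
  "R i \<omega> = max (- (2 * (real q * K))) (min (2 * (real q * K)) (real_cond_exp M (past (i * q)) (U (Suc i)) \<omega>))"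

definition d :: "nat \<Rightarrow> 'a \<Rightarrow> real" where
  "d i \<omega> = U (Suc i) \<omega> - R i \<omega>"

definition \<sigma>2 :: real where
  "\<sigma>2 = (\<integral>\<omega>. (U 0 \<omega>)\<^sup>2 \<partial>M)"

definition D :: "nat \<Rightarrow> 'a \<Rightarrow> real" where
  "D i \<omega> = max 0 (real_cond_exp M (past (i * q)) (\<lambda>\<omega>. (U (Suc i) \<omega>)\<^sup>2) \<omega> - \<sigma>2)"

lemma \<sigma>2_nonneg: "0 \<le> \<sigma>2"
  unfolding \<sigma>2_def by (intro integral_nonneg_AE) auto

lemma \<sigma>2_eq: "(\<integral>\<omega>. (U 1 \<omega>)\<^sup>2 \<partial>M) = \<sigma>2"
proof -
  have "U 1 \<omega> = U 0 ((T ^^ q) \<omega>)" for \<omega> by (simp add: U_def X_shift algebra_simps)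
  then have "(\<integral>\<omega>. (U 1 \<omega>)\<^sup>2 \<partial>M) = (\<integral>\<omega>. (\<lambda>\<omega>. (U 0 \<omega>)\<^sup>2) ((T ^^ q) \<omega>) \<partial>M)" by simp
  also have "\<dots> = \<sigma>2" unfolding \<sigma>2_def by (rule integral_shift) measurable
  finally show ?thesis .
qed

lemma R_meas: "R i \<in> borel_measurable (past (i * q))"
  unfolding R_def[abs_def] by measurable

lemma D_meas: "D i \<in> borel_measurable (past (i * q))"
  unfolding D_def[abs_def] by measurable

lemma past_meas_M: "f \<in> borel_measurable (past k) \<Longrightarrow> f \<in> borel_measurable M"
  by (rule measurable_from_subalg[OF past_subalgebra])

lemma R_bound: "\<bar>R i \<omega>\<bar> \<le> 2 * (real q * K)"
proof -
  have "0 \<le> 2 * (real q * K)" using K_nonneg by simp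
  then show ?thesis unfolding R_def by (simp add: abs_le_iff min_def max_def)
qed

lemma d_bound: "\<bar>d i \<omega>\<bar> \<le> 4 * (real q * K)"
  using U_bound[of "Suc i" \<omega>] R_bound[of i \<omega>] unfolding d_def by linarith

lemma R_AE: "AE \<omega> in M. R i \<omega> = real_cond_exp M (past (i * q)) (U (Suc i)) \<omega>"
proof -
  interpret P: sigma_finite_subalgebra M "past (i * q)" by (rule cond_subalgebra[OF past_subalgebra])
  have "AE \<omega> in M. real_cond_exp M (past (i * q)) (U (Suc i)) \<omega> \<ge> - (2 * (real q * K))"
  proof (rule P.real_cond_exp_ge_c[OF U_integrable], rule AE_I2)
    show "- (2 * (real q * K)) \<le> U (Suc i) \<omega>" for \<omega> using U_bound[of "Suc i" \<omega>] by linarith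
  qed
  moreover have "AE \<omega> in M. real_cond_exp M (past (i * q)) (U (Suc i)) \<omega> \<le> 2 * (real q * K)"
  proof (rule P.real_cond_exp_le_c[OF U_integrable], rule AE_I2)
    show "U (Suc i) \<omega> \<le> 2 * (real q * K)" for \<omega> using U_bound[of "Suc i" \<omega>] by linarith
  qed
  ultimately show ?thesis by eventually_elim (simp add: R_def)
qed

lemma U_Suc_eq: "U (Suc i) = (\<lambda>\<omega>. U 1 ((T ^^ (i * q)) \<omega>))"
  by (rule ext) (rule U_shift)

lemma R_abs_integral: "(\<integral>\<omega>. \<bar>R i \<omega>\<bar> \<partial>M) \<le> real q * (4 * K * v)"
proof -
  interpret F: sigma_finite_subalgebra M F0 by (rule cond_subalgebra[OF sub0])
  let ?E = "real_cond_exp M F0 (U 1)"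
  have E: "integrable M ?E" by (rule F.real_cond_exp_int(1)[OF U_integrable])
  have "AE \<omega> in M. \<bar>R i \<omega>\<bar> = \<bar>?E ((T ^^ (i * q)) \<omega>)\<bar>"
    using R_AE[of i] cond_exp_shift[OF U_integrable, of "i * q" 1] unfolding U_Suc_eq
    by eventually_elim simp
  then have "(\<integral>\<omega>. \<bar>R i \<omega>\<bar> \<partial>M) = (\<integral>\<omega>. (\<lambda>\<omega>. \<bar>?E \<omega>\<bar>) ((T ^^ (i * q)) \<omega>) \<partial>M)"
    using past_meas_M[OF R_meas, of i] by (intro integral_cong_AE) auto
  also have "\<dots> = (\<integral>\<omega>. \<bar>?E \<omega>\<bar> \<partial>M)" by (rule integral_shift) measurable
  also have "\<dots> = (\<integral>\<omega>. sgn (?E \<omega>) * ?E \<omega> \<partial>M)" by (simp add: abs_sgn mult.commute)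
  also have "\<dots> = (\<integral>\<omega>. sgn (?E \<omega>) * U 1 \<omega> \<partial>M)"
  proof (rule F.real_cond_exp_intg(2))
    show s: "(\<lambda>\<omega>. sgn (?E \<omega>)) \<in> borel_measurable F0" by measurable
    then have "test (\<lambda>\<omega>. sgn (?E \<omega>))" by (auto simp: test_def sgn_if)
    then show "integrable M (\<lambda>\<omega>. sgn (?E \<omega>) * U 1 \<omega>)" by (rule test_mult_integrable[OF _ U_integrable])
  qed measurable
  also have "\<dots> \<le> \<bar>\<integral>\<omega>. sgn (?E \<omega>) * U 1 \<omega> \<partial>M\<bar>" by (rule abs_ge_self)
  also have "\<dots> \<le> real q * (4 * K * v)" by (rule U_test) (auto simp: test_def sgn_if)
  finally show ?thesis .
qed

lemma D_integral: "integrable M (D i)" "(\<integral>\<omega>. D i \<omega> \<partial>M) \<le> 16 * (real q * K)\<^sup>2 * v"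
proof -
  interpret F: sigma_finite_subalgebra M F0 by (rule cond_subalgebra[OF sub0])
  interpret P: sigma_finite_subalgebra M "past (i * q)" by (rule cond_subalgebra[OF past_subalgebra])
  show "integrable M (D i)" unfolding D_def[abs_def]
    by (intro integrable_max Bochner_Integration.integrable_diff P.real_cond_exp_int U2_integrable) simp_all
  let ?E = "real_cond_exp M F0 (\<lambda>\<omega>. (U 1 \<omega>)\<^sup>2)"
  let ?W = "\<lambda>\<omega>. indicat_real {0<..} (?E \<omega> - \<sigma>2)"
  have E: "integrable M ?E" by (rule F.real_cond_exp_int(1)[OF U2_integrable])
  have W: "test ?W" by (auto simp: test_def indicator_def)
  have WM: "?W \<in> borel_measurable M" by (rule test_meas[OF W])
  have iW: "integrable M ?W" using WM by (rule bounded_integrable[where K = 1]) (simp add: indicator_def)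
  have "AE \<omega> in M. D i \<omega> = max 0 (?E ((T ^^ (i * q)) \<omega>) - \<sigma>2)"
    using cond_exp_shift[OF U2_integrable, of "i * q" 1] unfolding U_Suc_eq D_def
    by eventually_elim simp
  then have "(\<integral>\<omega>. D i \<omega> \<partial>M) = (\<integral>\<omega>. (\<lambda>\<omega>. max 0 (?E \<omega> - \<sigma>2)) ((T ^^ (i * q)) \<omega>) \<partial>M)"
    using past_meas_M[OF D_meas, of i] by (intro integral_cong_AE) auto
  also have "\<dots> = (\<integral>\<omega>. max 0 (?E \<omega> - \<sigma>2) \<partial>M)" by (rule integral_shift) measurable
  also have "\<dots> = (\<integral>\<omega>. ?W \<omega> * ?E \<omega> - \<sigma>2 * ?W \<omega> \<partial>M)"
    by (intro Bochner_Integration.integral_cong) (auto simp: indicator_def)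
  also have "\<dots> = (\<integral>\<omega>. ?W \<omega> * ?E \<omega> \<partial>M) - \<sigma>2 * (\<integral>\<omega>. ?W \<omega> \<partial>M)"
    using test_mult_integrable[OF W E] iW by simp
  also have "(\<integral>\<omega>. ?W \<omega> * ?E \<omega> \<partial>M) = (\<integral>\<omega>. ?W \<omega> * (U 1 \<omega>)\<^sup>2 \<partial>M)"
    using W by (intro F.real_cond_exp_intg(2) test_mult_integrable[OF W] U2_integrable) (auto simp: test_def)
  also have "\<dots> - \<sigma>2 * (\<integral>\<omega>. ?W \<omega> \<partial>M) = cov ?W (\<lambda>\<omega>. (U 1 \<omega>)\<^sup>2)"
    by (simp only: cov_def \<sigma>2_eq mult.commute)
  also have "\<dots> \<le> 16 * (real q * K)\<^sup>2 * v" using U2_test[OF W] by linarith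
  finally show "(\<integral>\<omega>. D i \<omega> \<partial>M) \<le> 16 * (real q * K)\<^sup>2 * v" .
qed

text \<open>Two blocks apart, the centred blocks form a martingale difference sequence; hence one
  martingale for each parity \<open>e\<close>.\<close>

lemma parity_martingale:
  assumes b: "4 * (real q * K) \<le> b"
  shows "bounded_martingale M (\<lambda>j. past ((2 * j + e) * q)) (\<lambda>j. d (2 * j + e)) (\<lambda>j. D (2 * j + e)) b \<sigma>2"
proof
  have b0: "0 \<le> 4 * (real q * K)" using K_nonneg by simp
  then show "0 \<le> b" using b by linarith
  show "0 \<le> \<sigma>2" by (rule \<sigma>2_nonneg)
  show "subalgebra M (past ((2 * j + e) * q))" for j by (rule past_subalgebra)
  show "sets (past ((2 * i + e) * q)) \<subseteq> sets (past ((2 * j + e) * q))" if "i \<le> j" for i j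
    by (rule past_mono) (use that in simp)
  have dM: "d i \<in> borel_measurable M" for i
    unfolding d_def[abs_def] by (intro borel_measurable_diff U_meas past_meas_M[OF R_meas])
  show "d (2 * j + e) \<in> borel_measurable (past ((2 * Suc j + e) * q))" for j
    unfolding d_def[abs_def]
    by (intro borel_measurable_diff meas_past_mono[OF U_past] meas_past_mono[OF R_meas]) auto
  show "\<bar>d (2 * j + e) \<omega>\<bar> \<le> b" for j \<omega> using d_bound[of "2 * j + e" \<omega>] b by linarith
  show "D (2 * j + e) \<in> borel_measurable (past ((2 * j + e) * q))" for j by (rule D_meas)
  show "0 \<le> D (2 * j + e) \<omega>" for j \<omega> by (simp add: D_def)
  show "integrable M (D (2 * j + e))" for j by (rule D_integral)
  fix j and W :: "'a \<Rightarrow> real" and L :: real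
  assume W: "W \<in> borel_measurable (past ((2 * j + e) * q))"
  let ?i = "2 * j + e"
  interpret P: sigma_finite_subalgebra M "past (?i * q)" by (rule cond_subalgebra[OF past_subalgebra])
  have WM [measurable]: "W \<in> borel_measurable M" by (rule past_meas_M[OF W])
  have RM [measurable]: "R ?i \<in> borel_measurable M" by (rule past_meas_M[OF R_meas])
  note int = bounded_mult_integrable
  have R_int: "integrable M (R ?i)" by (rule bounded_integrable[OF RM R_bound])
  have predicted: "(\<integral>\<omega>. V \<omega> * R ?i \<omega> \<partial>M) = (\<integral>\<omega>. V \<omega> * U (Suc ?i) \<omega> \<partial>M)"
    if V: "V \<in> borel_measurable (past (?i * q))" "\<And>\<omega>. \<omega> \<in> space M \<Longrightarrow> \<bar>V \<omega>\<bar> \<le> A" for V A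
  proof -
    have VM [measurable]: "V \<in> borel_measurable M" by (rule past_meas_M[OF V(1)])
    have "(\<integral>\<omega>. V \<omega> * R ?i \<omega> \<partial>M) = (\<integral>\<omega>. V \<omega> * real_cond_exp M (past (?i * q)) (U (Suc ?i)) \<omega> \<partial>M)"
      using R_AE[of ?i] by (intro integral_cong_AE) auto
    also have "\<dots> = (\<integral>\<omega>. V \<omega> * U (Suc ?i) \<omega> \<partial>M)"
      using V by (intro P.real_cond_exp_intg(2) int[OF VM V(2) U_integrable]) auto
    finally show ?thesis .
  qed
  show "(\<integral>\<omega>. W \<omega> * d ?i \<omega> \<partial>M) = 0" if bd: "\<And>\<omega>. \<omega> \<in> space M \<Longrightarrow> \<bar>W \<omega>\<bar> \<le> L"
  proof -
    have "(\<integral>\<omega>. W \<omega> * d ?i \<omega> \<partial>M) = (\<integral>\<omega>. W \<omega> * U (Suc ?i) \<omega> \<partial>M) - (\<integral>\<omega>. W \<omega> * R ?i \<omega> \<partial>M)"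
      unfolding d_def right_diff_distrib
      by (intro Bochner_Integration.integral_diff int[OF WM bd] U_integrable R_int)
    then show ?thesis using predicted[OF W bd] by simp
  qed
  show "(\<integral>\<omega>. W \<omega> * (d ?i \<omega>)\<^sup>2 \<partial>M) \<le> (\<integral>\<omega>. W \<omega> * (\<sigma>2 + D ?i \<omega>) \<partial>M)"
    if W01: "\<And>\<omega>. \<omega> \<in> space M \<Longrightarrow> 0 \<le> W \<omega> \<and> W \<omega> \<le> L"
  proof -
    have bd: "\<bar>W \<omega>\<bar> \<le> L" if "\<omega> \<in> space M" for \<omega> using W01[OF that] by simp
    have WR: "(\<lambda>\<omega>. W \<omega> * R ?i \<omega>) \<in> borel_measurable (past (?i * q))" using W R_meas[of ?i] by measurable
    have WRbd: "\<bar>W \<omega> * R ?i \<omega>\<bar> \<le> L * (2 * (real q * K))" if "\<omega> \<in> space M" for \<omega>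
      unfolding abs_mult using bd[OF that] by (intro mult_mono R_bound) auto
    have WRM: "(\<lambda>\<omega>. W \<omega> * R ?i \<omega>) \<in> borel_measurable M" by measurable
    note i1 = int[OF WM bd U2_integrable[of "Suc ?i"]] and i2 = int[OF WRM WRbd U_integrable[of "Suc ?i"]]
      and i3 = int[OF WRM WRbd R_int]
    let ?E = "real_cond_exp M (past (?i * q)) (\<lambda>\<omega>. (U (Suc ?i) \<omega>)\<^sup>2)"
    have Eint: "integrable M ?E" by (rule P.real_cond_exp_int(1)[OF U2_integrable])
    have "(\<integral>\<omega>. W \<omega> * (d ?i \<omega>)\<^sup>2 \<partial>M) = (\<integral>\<omega>. W \<omega> * (U (Suc ?i) \<omega>)\<^sup>2 - 2 * (W \<omega> * R ?i \<omega> * U (Suc ?i) \<omega>) + W \<omega> * R ?i \<omega> * R ?i \<omega> \<partial>M)"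
      by (intro Bochner_Integration.integral_cong refl) (simp add: d_def power2_eq_square algebra_simps)
    also have "\<dots> = (\<integral>\<omega>. W \<omega> * (U (Suc ?i) \<omega>)\<^sup>2 \<partial>M) - 2 * (\<integral>\<omega>. W \<omega> * R ?i \<omega> * U (Suc ?i) \<omega> \<partial>M) + (\<integral>\<omega>. W \<omega> * R ?i \<omega> * R ?i \<omega> \<partial>M)"
      using i1 i2 i3 by simp
    also have "\<dots> = (\<integral>\<omega>. W \<omega> * (U (Suc ?i) \<omega>)\<^sup>2 \<partial>M) - (\<integral>\<omega>. W \<omega> * R ?i \<omega> * R ?i \<omega> \<partial>M)"
      using predicted[OF WR WRbd] by simp
    also have "\<dots> \<le> (\<integral>\<omega>. W \<omega> * (U (Suc ?i) \<omega>)\<^sup>2 \<partial>M)"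
    proof -
      have "0 \<le> (\<integral>\<omega>. W \<omega> * R ?i \<omega> * R ?i \<omega> \<partial>M)"
        using W01 by (intro integral_nonneg_AE AE_I2) (simp add: mult.assoc)
      then show ?thesis by simp
    qed
    also have "\<dots> = (\<integral>\<omega>. W \<omega> * ?E \<omega> \<partial>M)"
      using W i1 by (intro P.real_cond_exp_intg(2)[symmetric]) auto
    also have "\<dots> \<le> (\<integral>\<omega>. W \<omega> * (\<sigma>2 + D ?i \<omega>) \<partial>M)"
    proof (rule integral_mono)
      show "integrable M (\<lambda>\<omega>. W \<omega> * ?E \<omega>)" by (rule int[OF WM bd Eint])
      show "integrable M (\<lambda>\<omega>. W \<omega> * (\<sigma>2 + D ?i \<omega>))" using D_integral(1) by (intro int[OF WM bd]) auto
      fix \<omega> assume w: "\<omega> \<in> space M"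
      have "?E \<omega> \<le> \<sigma>2 + D ?i \<omega>" by (simp add: D_def)
      then show "W \<omega> * ?E \<omega> \<le> W \<omega> * (\<sigma>2 + D ?i \<omega>)" using W01[OF w] by (intro mult_left_mono) auto
    qed
    finally show ?thesis .
  qed
qed

text \<open>From blocks back to the partial sums: the first block and the incomplete last one are bounded,
  the blocks in between split into the two martingales and the predicted parts.\<close>

lemma partial_sum_blocks: "(\<Sum>k\<in>{1..m * q}. X k \<omega>) = (\<Sum>i<m. U i \<omega>)"
proof (induction m)
  case (Suc m)
  have "{1..Suc m * q} = {1..m * q} \<union> {m * q + 1..m * q + q}" by auto
  then have "(\<Sum>k\<in>{1..Suc m * q}. X k \<omega>) = (\<Sum>k\<in>{1..m * q}. X k \<omega>) + (\<Sum>k\<in>{m * q + 1..m * q + q}. X k \<omega>)"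
    by (simp add: sum.union_disjoint)
  also have "(\<Sum>k\<in>{m * q + 1..m * q + q}. X k \<omega>) = U m \<omega>"
    unfolding U_def using sum.shift_bounds_cl_nat_ivl[of "\<lambda>k. X k \<omega>" 1 "m * q" q] by (simp add: add.commute)
  finally show ?case using Suc by simp
qed simp

lemma sum_parity: "(\<Sum>i<m. f i) = (\<Sum>j<(m + 1) div 2. f (2 * j + 0)) + (\<Sum>j<m div 2. f (2 * j + 1))"
  for f :: "nat \<Rightarrow> real"
proof (induction m)
  case (Suc m)
  show ?case
  proof (cases "even m")
    case True
    then obtain r where "m = 2 * r" by blast
    then show ?thesis using Suc by simp
  next
    case False
    then obtain r where "m = 2 * r + 1" by (elim oddE)
    then show ?thesis using Suc by simp
  qed
qed simp

lemma partial_sum_bound: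
  assumes k: "k \<le> n"
    and even: "\<And>k. k \<le> n div q \<Longrightarrow> \<bar>\<Sum>j<k. d (2 * j + 0) \<omega>\<bar> < a"
    and odd: "\<And>k. k \<le> n div q \<Longrightarrow> \<bar>\<Sum>j<k. d (2 * j + 1) \<omega>\<bar> < a"
    and pred: "(\<Sum>i<n div q. \<bar>R i \<omega>\<bar>) < x" and x: "real q * K \<le> x"
  shows "\<bar>\<Sum>k\<in>{1..k}. X k \<omega>\<bar> < 2 * a + 5 * x"
proof -
  define m where "m = k div q"
  define r where "r = k mod q"
  have kq: "k = m * q + r" "r < q" using q by (auto simp: m_def r_def)
  have mn: "m \<le> n div q" unfolding m_def using k by (rule div_le_mono)
  have "{1..k} = {1..m * q} \<union> {m * q + 1..m * q + r}" using kq by auto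
  then have "(\<Sum>k\<in>{1..k}. X k \<omega>) = (\<Sum>i<m. U i \<omega>) + (\<Sum>k\<in>{m * q + 1..m * q + r}. X k \<omega>)"
    by (simp add: sum.union_disjoint partial_sum_blocks[symmetric])
  moreover have "\<bar>\<Sum>k\<in>{m * q + 1..m * q + r}. X k \<omega>\<bar> \<le> 2 * x"
  proof -
    have "\<bar>\<Sum>k\<in>{m * q + 1..m * q + r}. X k \<omega>\<bar> \<le> (\<Sum>k\<in>{m * q + 1..m * q + r}. 2 * K)"
      by (intro order_trans[OF sum_abs] sum_mono X_bound)
    also have "\<dots> = 2 * (real r * K)" by simp
    also have "real r * K \<le> real q * K" using kq K_nonneg by (intro mult_right_mono) auto
    finally show ?thesis using x by simp
  qed
  moreover have "\<bar>\<Sum>i<m. U i \<omega>\<bar> < 2 * x + (2 * a + x)"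
  proof (cases m)
    case 0
    have "0 < a" using even[of 0] by simp
    moreover have "0 < x" using pred sum_nonneg[of "{..<n div q}" "\<lambda>i. \<bar>R i \<omega>\<bar>"] by (smt (verit) abs_ge_zero)
    ultimately show ?thesis using 0 by simp
  next
    case (Suc m')
    have "(\<Sum>i<m. U i \<omega>) = U 0 \<omega> + (\<Sum>i<m'. U (Suc i) \<omega>)"
      unfolding Suc by (rule sum.lessThan_Suc_shift)
    also have "(\<Sum>i<m'. U (Suc i) \<omega>) = (\<Sum>i<m'. d i \<omega>) + (\<Sum>i<m'. R i \<omega>)"
      by (simp add: d_def sum.distrib[symmetric])
    also have "(\<Sum>i<m'. d i \<omega>) = (\<Sum>j<(m' + 1) div 2. d (2 * j + 0) \<omega>) + (\<Sum>j<m' div 2. d (2 * j + 1) \<omega>)"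
      by (rule sum_parity)
    finally have eq: "(\<Sum>i<m. U i \<omega>) = U 0 \<omega> + ((\<Sum>j<(m' + 1) div 2. d (2 * j + 0) \<omega>)
      + (\<Sum>j<m' div 2. d (2 * j + 1) \<omega>) + (\<Sum>i<m'. R i \<omega>))" .
    have "\<bar>\<Sum>i<m'. R i \<omega>\<bar> \<le> (\<Sum>i<m'. \<bar>R i \<omega>\<bar>)" by (rule sum_abs)
    also have "\<dots> \<le> (\<Sum>i<n div q. \<bar>R i \<omega>\<bar>)" using mn Suc by (intro sum_mono2) auto
    finally have "\<bar>\<Sum>i<m'. R i \<omega>\<bar> < x" using pred by simp
    moreover have "\<bar>\<Sum>j<(m' + 1) div 2. d (2 * j + 0) \<omega>\<bar> < a" by (rule even) (use mn Suc in linarith)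
    moreover have "\<bar>\<Sum>j<m' div 2. d (2 * j + 1) \<omega>\<bar> < a" by (rule odd) (use mn Suc in linarith)
    moreover have "\<bar>U 0 \<omega>\<bar> \<le> 2 * x" using U_bound[of 0 \<omega>] x by linarith
    ultimately show ?thesis unfolding eq by linarith
  qed
  ultimately show ?thesis by linarith
qed

text \<open>Each martingale is allowed \<open>(2 p + 1) 4 x\<close>, where \<open>4 x\<close> bounds its increments; the predicted
  parts are allowed \<open>x\<close>, and the first and the last block contribute \<open>4 x\<close>.\<close>

lemma truncated_deviation:
  assumes p: "2 \<le> p" and x: "0 < x" "real q * K \<le> x" and y: "2 * (real (n div q) * \<sigma>2) \<le> y"
  shows "prob {\<omega>\<in>space M. \<exists>k\<le>n. (16 * p + 13) * x \<le> \<bar>\<Sum>k\<in>{1..k}. X k \<omega>\<bar>}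
    \<le> 4 * (y / x\<^sup>2) powr p + 8 * real n * K * v / x"
proof -
  let ?N = "n div q"
  have Ny: "real ?N * \<sigma>2 \<le> y / 2" using y by simp
  have "0 \<le> real ?N * \<sigma>2" using \<sigma>2_nonneg by simp
  then have y0: "0 \<le> y" using Ny by linarith
  have b: "4 * (real q * K) \<le> 4 * x" using x by simp
  have Nq: "real ?N * real q \<le> real n"
    by (metis of_nat_le_iff of_nat_mult div_times_less_eq_dividend)
  let ?a = "(2 * p + 1) * (4 * x)"
  let ?E = "\<lambda>e. {\<omega>\<in>space M. \<exists>k\<le>?N. ?a \<le> \<bar>\<Sum>j<k. d (2 * j + e) \<omega>\<bar>}"
  have par: "prob (?E e) \<le> 2 * (y / x\<^sup>2) powr p + 2 * real n * K * v / x" for e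
  proof -
    interpret bm: bounded_martingale M "\<lambda>j. past ((2 * j + e) * q)" "\<lambda>j. d (2 * j + e)" "\<lambda>j. D (2 * j + e)" "4 * x" \<sigma>2
      by (rule parity_martingale[OF b])
    have "prob (?E e) \<le> 2 * (y / (4 * x)\<^sup>2) powr p + 2 / (4 * x)\<^sup>2 * (\<Sum>j<?N. \<integral>\<omega>. D (2 * j + e) \<omega> \<partial>M)"
      by (rule bm.deviation[OF p _ Ny]) (use x in simp)
    also have "(y / (4 * x)\<^sup>2) powr p \<le> (y / x\<^sup>2) powr p"
      using y0 x p by (intro powr_mono2 divide_left_mono) (auto simp: power_mult_distrib)
    also have "(\<Sum>j<?N. \<integral>\<omega>. D (2 * j + e) \<omega> \<partial>M) \<le> (\<Sum>j<?N. 16 * (real q * K)\<^sup>2 * v)"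
      by (intro sum_mono D_integral(2))
    also have "(\<Sum>j<?N. 16 * (real q * K)\<^sup>2 * v) \<le> 16 * (real n * K * x) * v"
    proof -
      have "(\<Sum>j<?N. 16 * (real q * K)\<^sup>2 * v) = 16 * ((real ?N * real q) * K * (real q * K)) * v"
        by (simp add: power2_eq_square algebra_simps)
      also have "\<dots> \<le> 16 * (real n * K * x) * v"
        using Nq x K_nonneg v(1) by (intro mult_right_mono mult_left_mono mult_mono) auto
      finally show ?thesis .
    qed
    finally show ?thesis using x by (simp add: power2_eq_square divide_right_mono mult_left_mono field_simps)
  qed
  let ?F = "{\<omega>\<in>space M. x \<le> (\<Sum>i<?N. \<bar>R i \<omega>\<bar>)}"
  have RM [measurable]: "R i \<in> borel_measurable M" for i by (rule past_meas_M[OF R_meas])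
  have R_int: "integrable M (\<lambda>\<omega>. \<bar>R i \<omega>\<bar>)" for i
    by (intro integrable_abs bounded_integrable[OF RM R_bound])
  have predF: "prob ?F \<le> 4 * real n * K * v / x"
  proof -
    have "prob ?F \<le> (\<integral>\<omega>. (\<Sum>i<?N. \<bar>R i \<omega>\<bar>) \<partial>M) / x"
      by (rule integral_Markov_inequality_measure[where A = "{}"]) (use x R_int in \<open>auto intro!: sum_nonneg\<close>)
    also have "(\<integral>\<omega>. (\<Sum>i<?N. \<bar>R i \<omega>\<bar>) \<partial>M) = (\<Sum>i<?N. \<integral>\<omega>. \<bar>R i \<omega>\<bar> \<partial>M)"
      using R_int by (rule Bochner_Integration.integral_sum)
    also have "\<dots> \<le> (\<Sum>i<?N. real q * (4 * K * v))" by (intro sum_mono R_abs_integral)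
    also have "\<dots> = (real ?N * real q) * (4 * K * v)" by simp
    also have "\<dots> \<le> real n * (4 * K * v)" using Nq K_nonneg v(1) by (intro mult_right_mono) auto
    finally show ?thesis using x by (simp add: divide_right_mono mult_ac)
  qed
  have dM: "d i \<in> borel_measurable M" for i
    unfolding d_def[abs_def] by (intro borel_measurable_diff U_meas RM)
  have E: "?E e \<in> sets M" for e by (intro prefix_max_event_measurable borel_measurable_sum dM)
  have F: "?F \<in> sets M" by measurable
  let ?S = "{\<omega>\<in>space M. \<exists>k\<le>n. (16 * p + 13) * x \<le> \<bar>\<Sum>k\<in>{1..k}. X k \<omega>\<bar>}"
  have "?S \<subseteq> ?E 0 \<union> ?E 1 \<union> ?F"
  proof (rule subsetI, rule ccontr)
    fix \<omega> assume "\<omega> \<in> ?S"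
    then obtain k where w: "\<omega> \<in> space M" and k: "k \<le> n" "(16 * p + 13) * x \<le> \<bar>\<Sum>k\<in>{1..k}. X k \<omega>\<bar>" by auto
    assume n: "\<omega> \<notin> ?E 0 \<union> ?E 1 \<union> ?F"
    have "\<bar>\<Sum>k\<in>{1..k}. X k \<omega>\<bar> < 2 * ?a + 5 * x"
    proof (rule partial_sum_bound[OF k(1)])
      show "\<bar>\<Sum>j<k. d (2 * j + 0) \<omega>\<bar> < ?a" if "k \<le> ?N" for k using n w that not_le by blast
      show "\<bar>\<Sum>j<k. d (2 * j + 1) \<omega>\<bar> < ?a" if "k \<le> ?N" for k using n w that not_le by blast
      show "(\<Sum>i<?N. \<bar>R i \<omega>\<bar>) < x" using n w not_le by blast
    qed (rule x)
    also have "2 * ?a + 5 * x = (16 * p + 13) * x" by (simp add: algebra_simps)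
    finally show False using k(2) by linarith
  qed
  then have "prob ?S \<le> prob (?E 0 \<union> ?E 1 \<union> ?F)" by (rule finite_measure_mono) (intro sets.Un E F)
  also have "\<dots> \<le> prob (?E 0 \<union> ?E 1) + prob ?F" by (intro measure_Un_le sets.Un E F)
  also have "prob (?E 0 \<union> ?E 1) \<le> prob (?E 0) + prob (?E 1)" by (intro measure_Un_le E)
  also have "prob (?E 0) + prob (?E 1) + prob ?F \<le> (2 * (y / x\<^sup>2) powr p + 2 * real n * K * v / x)
      + (2 * (y / x\<^sup>2) powr p + 2 * real n * K * v / x) + 4 * real n * K * v / x"
    by (intro add_mono par predF)
  also have "\<dots> = 4 * (y / x\<^sup>2) powr p + 8 * real n * K * v / x"
    by (simp add: add_divide_distrib[symmetric])
  finally show ?thesis by simp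
qed

end

section \<open>The deviation inequality for step forms\<close>

lemma step_form_subset:
  assumes F: "step_form H \<mu> I c t J" and sub: "I' \<subseteq> I"
  shows "step_form H \<mu> I' c t J"
proof -
  have fin: "finite I" using F by (simp add: step_form_def)
  have "(\<Sum>\<iota>\<in>{\<iota>\<in>I'. t \<iota> \<le> x}. \<bar>c \<iota>\<bar>) \<le> 2 * x" if "0 \<le> x" for x
  proof -
    have "(\<Sum>\<iota>\<in>{\<iota>\<in>I'. t \<iota> \<le> x}. \<bar>c \<iota>\<bar>) \<le> (\<Sum>\<iota>\<in>{\<iota>\<in>I. t \<iota> \<le> x}. \<bar>c \<iota>\<bar>)"
      using fin sub by (intro sum_mono2) auto
    also have "\<dots> \<le> 2 * x" using F that by (simp add: step_form_def)
    finally show ?thesis .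
  qed
  then show ?thesis using F sub finite_subset[OF sub fin] unfolding step_form_def by blast
qed

context stationary_sequence
begin

text \<open>The lag \<open>\<alpha>\<inverse> u\<close>, cut off at \<open>n\<close> and raised to at least \<open>1\<close> so that it can serve
  as a block length.\<close>

definition lag :: "nat \<Rightarrow> real \<Rightarrow> enat" where
  "lag n u = max 1 (min (alpha_inv (\<alpha> 2) u) (enat n))"

lemma lag_antimono: "u \<le> u' \<Longrightarrow> lag n u' \<le> lag n u"
  unfolding lag_def by (intro max.mono min.mono alpha_inv_antimono order_refl)

definition tail_integral :: "(real \<Rightarrow> ennreal) \<Rightarrow> nat \<Rightarrow> real \<Rightarrow> ennreal" where
  "tail_integral Q n x = (\<integral>\<^sup>+u\<in>{0..1}. Q u * indicator {u. ennreal x \<le> ennreal_of_enat (lag n u) * Q u} u \<partial>lborel)"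

text \<open>Taking the block length \<open>q\<close> as a minimiser of \<open>max (\<alpha> q) (H (x / q))\<close>, with the mixing term
  dropped at \<open>q = n\<close>, and \<open>v\<close> as the minimum makes every \<open>u < v\<close> satisfy
  \<open>x \<le> lag n u * Q u\<close>: otherwise \<open>lag n u\<close> would give a smaller maximum. The restriction to
  \<open>u \<le> 1/4\<close> ensures \<open>\<alpha>\<inverse> u \<ge> 1\<close>. The truncation level \<open>K = Q v\<close> is used rather than
  \<open>x / q\<close> because then \<open>K v\<close> is at most the integral of \<open>Q\<close> over \<open>[0, v]\<close>.\<close>

lemma choice_of_levels:
  assumes H: "tail_function H" and n: "1 \<le> n" and x: "0 < x"
  obtains q v K where "1 \<le> q" "q \<le> n" "0 \<le> v" "v \<le> 1" "0 \<le> K" "real q * K \<le> x" "H K \<le> v"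
    "q < n \<Longrightarrow> \<alpha> 2 q \<le> ennreal v" "quantile_of H v = ennreal K"
    "\<And>u. 0 \<le> u \<Longrightarrow> u < v \<Longrightarrow> u \<le> 1 / 4 \<Longrightarrow> ennreal x \<le> ennreal_of_enat (lag n u) * quantile_of H u"
proof -
  define \<phi> where "\<phi> q = max (if q < n then \<alpha> 2 q else 0) (ennreal (H (x / real q)))" for q
  have "Min (\<phi> ` {1..n}) \<in> \<phi> ` {1..n}" using n by (intro Min_in) auto
  then obtain q where q: "q \<in> {1..n}" "Min (\<phi> ` {1..n}) = \<phi> q" by auto
  have min: "\<phi> q \<le> \<phi> q'" if "q' \<in> {1..n}" for q'
    unfolding q(2)[symmetric] using that by (intro Min_le) auto
  have q0: "0 < real q" using q by simp
  have H01: "0 \<le> H s" "H s \<le> 1" if "0 \<le> s" for s using H that by (auto simp: tail_function_def)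
  have "\<phi> q \<le> \<phi> n" using n by (intro min) simp
  also have "\<dots> = ennreal (H (x / real n))" by (simp add: \<phi>_def)
  also have "\<dots> \<le> ennreal 1" using H01[of "x / real n"] x by (intro ennreal_leI) simp
  finally have \<phi>1: "\<phi> q \<le> ennreal 1" .
  define v where "v = enn2real (\<phi> q)"
  have v: "\<phi> q = ennreal v" unfolding v_def using \<phi>1 by (intro ennreal_enn2real[symmetric]) (auto simp: less_top[symmetric] top_unique)
  have v0: "0 \<le> v" by (simp add: v_def)
  have v1: "v \<le> 1" using \<phi>1 v0 unfolding v by simp
  have \<alpha>v: "\<alpha> 2 q \<le> ennreal v" if "q < n" unfolding v[symmetric] \<phi>_def using that by simp
  have "ennreal (H (x / real q)) \<le> ennreal v" unfolding v[symmetric] \<phi>_def by simp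
  then have Hv: "H (x / real q) \<le> v" using v0 by simp
  have "quantile_of H v \<le> ennreal (x / real q)"
    unfolding quantile_of_def using Hv x by (intro Inf_lower) auto
  then obtain K where K: "0 \<le> K" "K \<le> x / real q" "quantile_of H v = ennreal K" "H K \<le> v"
    using quantile_attained[OF H] x by (metis divide_nonneg_nonneg less_imp_le of_nat_0_le_iff)
  have qK: "real q * K \<le> x" using K(2) q0 by (simp add: field_simps)
  have u: "ennreal x \<le> ennreal_of_enat (lag n u) * quantile_of H u" if u: "0 \<le> u" "u < v" "u \<le> 1 / 4" for u
  proof -
    have "lag n u \<le> enat n" unfolding lag_def using n by (auto simp: one_enat_def)
    then obtain r where r: "lag n u = enat r" using enat_ile by blast
    have "1 \<le> lag n u" unfolding lag_def by (rule max.cobounded1)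
    then have r1: "1 \<le> r" and rn: "r \<le> n"
      using \<open>lag n u \<le> enat n\<close> unfolding r by (auto simp: one_enat_def)
    have "ennreal u < \<phi> r" using min[of r] r1 rn v u by (auto intro!: less_le_trans[OF _ min[of r]] ennreal_lessI)
    moreover have "(if r < n then \<alpha> 2 r else 0) \<le> ennreal u"
    proof (cases "r < n")
      case True
      have "min (alpha_inv (\<alpha> 2) u) (enat n) \<le> enat r" using r unfolding lag_def by (metis max.cobounded2)
      then have "alpha_inv (\<alpha> 2) u \<le> enat r" using True by (auto simp: min_le_iff_disj)
      then obtain s where s: "alpha_inv (\<alpha> 2) u = enat s" "s \<le> r" "\<alpha> 2 s \<le> ennreal u" by (rule alpha_inv_attained)
      have "s \<noteq> 0"
      proof
        assume "s = 0"
        then have "ennreal (1 / 2) \<le> ennreal u" using s by (simp add: alpha_seq_def)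
        then show False using u by (subst (asm) ennreal_le_iff) auto
      qed
      then have "\<alpha> 2 r \<le> \<alpha> 2 s" using s by (intro alpha_decreasing) auto
      then show ?thesis using s True by simp
    qed simp
    ultimately have "ennreal u < ennreal (H (x / real r))" unfolding \<phi>_def by (auto simp: max_def not_le split: if_splits)
    then have "u < H (x / real r)" using u by (simp add: ennreal_less_iff)
    then have "ennreal (x / real r) \<le> quantile_of H u" using x by (intro quantile_ge[OF H]) auto
    then have "of_nat r * ennreal (x / real r) \<le> of_nat r * quantile_of H u" by (intro mult_left_mono) auto
    moreover have "of_nat r * ennreal (x / real r) = ennreal x"
      using r1 x by (simp add: ennreal_of_nat_eq_real_of_nat ennreal_mult[symmetric])
    ultimately show ?thesis unfolding r by simp
  qed
  show thesis by (rule that[of q v K]) (use q v0 v1 K qK \<alpha>v u in auto)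
qed

lemma level_integrals:
  assumes v: "0 \<le> v" "v \<le> 1"
    and u: "\<And>u. 0 \<le> u \<Longrightarrow> u < v \<Longrightarrow> u \<le> 1 / 4 \<Longrightarrow> ennreal x \<le> ennreal_of_enat (lag n u) * quantile_of H u"
    and K: "quantile_of H v = ennreal K"
  shows "(\<integral>\<^sup>+u\<in>{0..1}. quantile_of H u * indicator {..<v} u \<partial>lborel) \<le> 4 * tail_integral (quantile_of H) n x"
    and "ennreal K * ennreal v \<le> (\<integral>\<^sup>+u\<in>{0..1}. quantile_of H u * indicator {..<v} u \<partial>lborel)"
proof -
  have quarter: "(\<integral>\<^sup>+u\<in>{0..v/4}. quantile_of H u \<partial>lborel) \<le> tail_integral (quantile_of H) n x"
    unfolding tail_integral_def
  proof (rule nn_integral_mono_AE)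
    have "AE u in lborel. u \<noteq> (0::real)" by (rule AE_lborel_singleton)
    then show "AE y in lborel. quantile_of H y * indicator {0..v / 4} y \<le> quantile_of H y *
       indicator {u. ennreal x \<le> ennreal_of_enat (lag n u) * quantile_of H u} y * indicator {0..1} y"
    proof (rule AE_mp, intro AE_I2 impI)
      fix y :: real assume "y \<noteq> 0"
      then show "quantile_of H y * indicator {0..v / 4} y \<le> quantile_of H y *
         indicator {u. ennreal x \<le> ennreal_of_enat (lag n u) * quantile_of H u} y * indicator {0..1} y"
        using u[of y] v by (cases "y \<in> {0..v / 4}") auto
    qed
  qed
  have "(\<integral>\<^sup>+u\<in>{0..1}. quantile_of H u * indicator {..<v} u \<partial>lborel) \<le> (\<integral>\<^sup>+u\<in>{0..v}. quantile_of H u \<partial>lborel)"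
    by (intro nn_integral_mono) (auto simp: indicator_def)
  also have "\<dots> \<le> 4 * (\<integral>\<^sup>+u\<in>{0..v/4}. quantile_of H u \<partial>lborel)"
    by (rule nn_integral_antimono_quarter) (rule quantile_antimono)
  also have "4 * (\<integral>\<^sup>+u\<in>{0..v/4}. quantile_of H u \<partial>lborel) \<le> 4 * tail_integral (quantile_of H) n x"
    using quarter by (rule mult_left_mono) simp
  finally show "(\<integral>\<^sup>+u\<in>{0..1}. quantile_of H u * indicator {..<v} u \<partial>lborel) \<le> 4 * tail_integral (quantile_of H) n x" .
  have "ennreal K * ennreal v = ennreal K * (\<integral>\<^sup>+u\<in>{0..1}. indicator {..<v} u \<partial>lborel)"
    by (simp only: ennreal_min_eq_nn_integral[OF v])
  also have "\<dots> = (\<integral>\<^sup>+u. ennreal K * (indicator {..<v} u * indicator {0..1} u) \<partial>lborel)"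
    by (rule nn_integral_cmult[symmetric]) measurable
  also have "\<dots> = (\<integral>\<^sup>+u\<in>{0..1}. ennreal K * indicator {..<v} u \<partial>lborel)"
    by (simp only: mult.assoc)
  also have "\<dots> \<le> (\<integral>\<^sup>+u\<in>{0..1}. quantile_of H u * indicator {..<v} u \<partial>lborel)"
  proof (rule nn_integral_mono)
    fix u :: real
    show "ennreal K * indicator {..<v} u * indicator {0..1} u \<le> quantile_of H u * indicator {..<v} u * indicator {0..1} u"
      unfolding K[symmetric] by (cases "u < v") (auto intro!: mult_right_mono quantile_antimono)
  qed
  finally show "ennreal K * ennreal v \<le> (\<integral>\<^sup>+u\<in>{0..1}. quantile_of H u * indicator {..<v} u \<partial>lborel)" .
qed

text \<open>The first term has the power \<open>p\<close> of \<open>n A / x\<^sup>2\<close>, twice the decay that a moment of order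
  \<open>p\<close> needs; the second one integrates to \<open>n\<close> times the integral of
  \<open>(\<alpha>\<inverse>)\<^sup>p\<^sup>-\<^sup>1 Q\<^sup>p\<close>. One more \<open>x\<close> in the threshold pays for the layers above \<open>K\<close>.\<close>

lemma step_form_deviation:
  assumes H: "tail_function H" and F: "step_form H \<mu> I c t J"
    and p: "2 \<le> p" and n: "1 \<le> n" and x: "0 < x" and A: "0 \<le> A"
    "(\<integral>\<^sup>+u\<in>{0..1}. ennreal_of_enat (min (alpha_inv (\<alpha> 1) u) (enat n)) * (quantile_of H u)\<^sup>2 \<partial>lborel) = ennreal A"
  shows "emeasure M {\<omega>\<in>space M. \<exists>k\<le>n. (16 * p + 14) * x \<le> \<bar>\<Sum>k\<in>{1..k}. \<Sum>\<iota>\<in>I. c \<iota> * cen k (indicat_real (J \<iota>)) \<omega>\<bar>}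
    \<le> ennreal (4 * (64 * real n * A / x\<^sup>2) powr p) + ennreal (48 * real n / x) * tail_integral (quantile_of H) n x"
proof -
  obtain q v K where q: "1 \<le> q" "q \<le> n" and v: "0 \<le> v" "v \<le> 1" and K: "0 \<le> K" "real q * K \<le> x" "H K \<le> v"
    "quantile_of H v = ennreal K" and \<alpha>v: "q < n \<Longrightarrow> \<alpha> 2 q \<le> ennreal v"
    and u: "\<And>u. 0 \<le> u \<Longrightarrow> u < v \<Longrightarrow> u \<le> 1 / 4 \<Longrightarrow> ennreal x \<le> ennreal_of_enat (lag n u) * quantile_of H u"
    using choice_of_levels[OF H n x] by metis
  let ?IQ = "tail_integral (quantile_of H) n x"
  note lev = level_integrals[OF v u K(4)]
  have fin: "finite I" using F by (simp add: step_form_def)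
  define I1 where "I1 = {\<iota>\<in>I. t \<iota> \<le> K}"
  define I2 where "I2 = {\<iota>\<in>I. K < t \<iota>}"
  have I12: "I = I1 \<union> I2" "I1 \<inter> I2 = {}" "finite I1" "finite I2" using fin by (auto simp: I1_def I2_def)
  define X where "X k \<omega> = (\<Sum>\<iota>\<in>I. c \<iota> * cen k (indicat_real (J \<iota>)) \<omega>)" for k \<omega>
  define X1 where "X1 k \<omega> = (\<Sum>\<iota>\<in>I1. c \<iota> * cen k (indicat_real (J \<iota>)) \<omega>)" for k \<omega>
  define X2 where "X2 k \<omega> = (\<Sum>\<iota>\<in>I2. c \<iota> * cen k (indicat_real (J \<iota>)) \<omega>)" for k \<omega>
  have X12: "X k \<omega> = X1 k \<omega> + X2 k \<omega>" for k \<omega>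
    unfolding X_def X1_def X2_def I12(1) using I12 by (intro sum.union_disjoint) auto
  have JM: "J \<iota> \<in> sets borel" if "\<iota> \<in> I" for \<iota>
    using F that by (auto simp: step_form_def intro: real_interval_borel_measurable)
  have cM: "cen k (indicat_real (J \<iota>)) \<in> borel_measurable M" if "\<iota> \<in> I" for k \<iota>
    by (rule cen_meas[OF borel_measurable_indicator[OF JM[OF that]]])
  have cI: "integrable M (cen k (indicat_real (J \<iota>)))" if "\<iota> \<in> I" for k \<iota>
    by (rule cen_integral(1)[OF borel_measurable_indicator[OF JM[OF that]] indicat_bound])
  have X1M [measurable]: "X1 k \<in> borel_measurable M" for k
    unfolding X1_def[abs_def] by (intro borel_measurable_sum borel_measurable_times borel_measurable_const cM) (simp add: I1_def)
  have X2I: "integrable M (X2 k)" for k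
    unfolding X2_def[abs_def] by (intro Bochner_Integration.integrable_sum integrable_mult_right cI) (simp add: I2_def)
  have X2M [measurable]: "X2 k \<in> borel_measurable M" for k using X2I by (rule borel_measurable_integrable)
  \<comment> \<open>The levels above \<open>K\<close> are controlled in mean.\<close>
  define h where "h = (\<Sum>\<iota>\<in>I2. \<bar>c \<iota>\<bar> * H (t \<iota>))"
  have h: "ennreal h \<le> 8 * ?IQ"
  proof -
    have "ennreal h \<le> 2 * (\<integral>\<^sup>+u\<in>{0..1}. quantile_of H u * indicator {..<v} u \<partial>lborel)"
      unfolding h_def I2_def by (rule step_form_tail_mass[OF H F K(1,3)])
    also have "\<dots> \<le> 2 * (4 * ?IQ)" by (intro mult_left_mono lev(1)) auto
    finally show ?thesis by (simp add: mult.assoc[symmetric])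
  qed
  have X2abs: "(\<integral>\<omega>. \<bar>X2 k \<omega>\<bar> \<partial>M) \<le> 2 * h" for k
  proof -
    have "(\<integral>\<omega>. \<bar>X2 k \<omega>\<bar> \<partial>M) \<le> (\<integral>\<omega>. (\<Sum>\<iota>\<in>I2. \<bar>c \<iota>\<bar> * \<bar>cen k (indicat_real (J \<iota>)) \<omega>\<bar>) \<partial>M)"
    proof (rule integral_mono)
      show "integrable M (\<lambda>\<omega>. \<bar>X2 k \<omega>\<bar>)" using X2I by simp
      show "integrable M (\<lambda>\<omega>. \<Sum>\<iota>\<in>I2. \<bar>c \<iota>\<bar> * \<bar>cen k (indicat_real (J \<iota>)) \<omega>\<bar>)"
        by (intro Bochner_Integration.integrable_sum integrable_mult_right integrable_abs cI) (simp add: I2_def)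
      show "\<bar>X2 k \<omega>\<bar> \<le> (\<Sum>\<iota>\<in>I2. \<bar>c \<iota>\<bar> * \<bar>cen k (indicat_real (J \<iota>)) \<omega>\<bar>)" for \<omega>
        unfolding X2_def abs_mult[symmetric] by (rule sum_abs)
    qed
    also have "\<dots> = (\<Sum>\<iota>\<in>I2. \<bar>c \<iota>\<bar> * (\<integral>\<omega>. \<bar>cen k (indicat_real (J \<iota>)) \<omega>\<bar> \<partial>M))"
      by (subst Bochner_Integration.integral_sum) (auto intro!: integrable_abs cI simp: I2_def)
    also have "\<dots> \<le> (\<Sum>\<iota>\<in>I2. \<bar>c \<iota>\<bar> * (2 * H (t \<iota>)))"
    proof (intro sum_mono mult_left_mono)
      fix \<iota> assume "\<iota> \<in> I2"
      then have i: "\<iota> \<in> I" by (simp add: I2_def)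
      have "(\<integral>\<omega>. \<bar>cen k (indicat_real (J \<iota>)) \<omega>\<bar> \<partial>M) \<le> 2 * measure \<mu> (J \<iota>)"
        by (rule cen_indicat_abs_integral[OF JM[OF i]])
      also have "measure \<mu> (J \<iota>) \<le> H (t \<iota>)" using F i by (simp add: step_form_def)
      finally show "(\<integral>\<omega>. \<bar>cen k (indicat_real (J \<iota>)) \<omega>\<bar> \<partial>M) \<le> 2 * H (t \<iota>)" by simp
    qed simp
    also have "\<dots> = 2 * h" by (simp add: h_def sum_distrib_left mult_ac)
    finally show ?thesis .
  qed
  have h0: "0 \<le> h" 
  proof -
    have "0 \<le> (\<integral>\<omega>. \<bar>X2 0 \<omega>\<bar> \<partial>M)" by (rule integral_nonneg_AE) simp
    then show ?thesis using X2abs[of 0] by linarith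
  qed
  let ?F = "{\<omega>\<in>space M. x \<le> (\<Sum>k\<in>{1..n}. \<bar>X2 k \<omega>\<bar>)}"
  have FM: "?F \<in> sets M" by measurable
  have probF: "prob ?F \<le> 2 * real n / x * h"
  proof -
    have "prob ?F \<le> (\<integral>\<omega>. (\<Sum>k\<in>{1..n}. \<bar>X2 k \<omega>\<bar>) \<partial>M) / x"
      by (rule integral_Markov_inequality_measure[where A = "{}"]) (use x X2I in \<open>auto intro!: sum_nonneg\<close>)
    also have "(\<integral>\<omega>. (\<Sum>k\<in>{1..n}. \<bar>X2 k \<omega>\<bar>) \<partial>M) = (\<Sum>k\<in>{1..n}. \<integral>\<omega>. \<bar>X2 k \<omega>\<bar> \<partial>M)"
      by (rule Bochner_Integration.integral_sum) (rule integrable_abs[OF X2I])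
    also have "\<dots> \<le> (\<Sum>k\<in>{1..n}. 2 * h)" by (intro sum_mono X2abs)
    finally show ?thesis using x by (simp add: divide_right_mono mult_ac)
  qed
  \<comment> \<open>The levels up to \<open>K\<close> are bounded; they are trivial if there is a single block.\<close>
  let ?E = "{\<omega>\<in>space M. \<exists>k\<le>n. (16 * p + 13) * x \<le> \<bar>\<Sum>k\<in>{1..k}. X1 k \<omega>\<bar>}"
  have EM: "?E \<in> sets M" by (intro prefix_max_event_measurable borel_measurable_sum) measurable
  have mass: "(\<Sum>\<iota>\<in>I1. \<bar>c \<iota>\<bar>) \<le> 2 * K" using F K(1) by (simp add: step_form_def I1_def)
  have probE: "prob ?E \<le> 4 * (64 * real n * A / x\<^sup>2) powr p + 8 * real n * K * v / x"
  proof (cases "q < n")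
    case True
    interpret B: blocks M F0 T Y0 H I1 c t J K v q
      by unfold_locales (use H step_form_subset[OF F, of I1] mass q v \<alpha>v[OF True] in \<open>auto simp: I1_def\<close>)
    have X1B: "X1 = B.X" by (intro ext) (simp add: X1_def B.X_def B.Z_def)
    have "ennreal B.\<sigma>2 \<le> 32 * of_nat q * ennreal A"
      unfolding B.\<sigma>2_def A(2)[symmetric] by (rule B.block_variance[OF q(2)])
    also have "\<dots> = ennreal (32 * real q * A)"
      using A(1) by (simp add: ennreal_mult' ennreal_of_nat_eq_real_of_nat)
    finally have s: "B.\<sigma>2 \<le> 32 * real q * A" using A(1) by (subst (asm) ennreal_le_iff) auto
    have Nq: "real (n div q) * real q \<le> real n"
      by (metis of_nat_le_iff of_nat_mult div_times_less_eq_dividend)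
    have "2 * (real (n div q) * B.\<sigma>2) \<le> 2 * (real (n div q) * (32 * real q * A))"
      using s by (intro mult_left_mono) auto
    also have "\<dots> = 64 * (real (n div q) * real q) * A" by simp
    also have "\<dots> \<le> 64 * real n * A" using Nq A(1) by (intro mult_right_mono) auto
    finally show ?thesis unfolding X1B by (rule B.truncated_deviation[OF p x K(2)])
  next
    case False
    then have "q = n" using q by simp
    have none: "?E = {}"
    proof (rule ccontr)
      assume "?E \<noteq> {}"
      then obtain \<omega> k where k: "k \<le> n" "(16 * p + 13) * x \<le> \<bar>\<Sum>k\<in>{1..k}. X1 k \<omega>\<bar>" by auto
      have "\<bar>X1 k \<omega>\<bar> \<le> 2 * K" for k
      proof -
        have "\<bar>X1 k \<omega>\<bar> \<le> (\<Sum>\<iota>\<in>I1. \<bar>c \<iota> * cen k (indicat_real (J \<iota>)) \<omega>\<bar>)" unfolding X1_def by (rule sum_abs)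
        also have "\<dots> \<le> (\<Sum>\<iota>\<in>I1. \<bar>c \<iota>\<bar>)" using cen_indicat_bound[OF JM]
          by (intro sum_mono) (auto simp: abs_mult I1_def intro: mult_left_le)
        finally show ?thesis using mass by simp
      qed
      then have "\<bar>\<Sum>k\<in>{1..k}. X1 k \<omega>\<bar> \<le> (\<Sum>k\<in>{1..k}. 2 * K)" by (intro order_trans[OF sum_abs] sum_mono)
      also have "\<dots> = 2 * (real k * K)" by simp
      also have "real k * K \<le> real q * K" using k \<open>q = n\<close> K(1) by (intro mult_right_mono) auto
      finally have "\<bar>\<Sum>k\<in>{1..k}. X1 k \<omega>\<bar> \<le> 2 * x" using K(2) by simp
      moreover have "2 * x < (16 * p + 13) * x" using x p by (intro mult_strict_right_mono) auto
      ultimately show False using k(2) by simp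
    qed
    show ?thesis unfolding none using K v x by simp
  qed
  let ?S = "{\<omega>\<in>space M. \<exists>k\<le>n. (16 * p + 14) * x \<le> \<bar>\<Sum>k\<in>{1..k}. X k \<omega>\<bar>}"
  have "?S \<subseteq> ?E \<union> ?F"
  proof (rule subsetI, rule ccontr)
    fix \<omega> assume "\<omega> \<in> ?S"
    then obtain k where w: "\<omega> \<in> space M" and k: "k \<le> n" "(16 * p + 14) * x \<le> \<bar>\<Sum>k\<in>{1..k}. X k \<omega>\<bar>" by auto
    assume no: "\<omega> \<notin> ?E \<union> ?F"
    have "\<bar>\<Sum>k\<in>{1..k}. X2 k \<omega>\<bar> \<le> (\<Sum>k\<in>{1..n}. \<bar>X2 k \<omega>\<bar>)"
      using k(1) by (intro order_trans[OF sum_abs] sum_mono2) auto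
    moreover have "\<bar>\<Sum>k\<in>{1..k}. X1 k \<omega>\<bar> < (16 * p + 13) * x" using no w k(1) not_le by blast
    moreover have "(\<Sum>k\<in>{1..n}. \<bar>X2 k \<omega>\<bar>) < x" using no w not_le by blast
    moreover have "(\<Sum>k\<in>{1..k}. X k \<omega>) = (\<Sum>k\<in>{1..k}. X1 k \<omega>) + (\<Sum>k\<in>{1..k}. X2 k \<omega>)"
      by (simp add: X12 sum.distrib)
    ultimately have "\<bar>\<Sum>k\<in>{1..k}. X k \<omega>\<bar> < (16 * p + 13) * x + x" by linarith
    also have "\<dots> = (16 * p + 14) * x" by (simp add: algebra_simps)
    finally show False using k(2) by simp
  qed
  then have "emeasure M ?S \<le> emeasure M (?E \<union> ?F)" using EM FM by (intro emeasure_mono) auto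
  also have "\<dots> \<le> emeasure M ?E + emeasure M ?F" by (rule emeasure_subadditive[OF EM FM])
  also have "\<dots> = ennreal (prob ?E) + ennreal (prob ?F)" by (simp add: emeasure_eq_measure)
  also have "\<dots> \<le> ennreal (4 * (64 * real n * A / x\<^sup>2) powr p + 8 * real n * K * v / x) + ennreal (2 * real n / x * h)"
    by (intro add_mono ennreal_leI probE probF)
  also have "\<dots> = ennreal (4 * (64 * real n * A / x\<^sup>2) powr p) + (ennreal (8 * real n / x) * (ennreal K * ennreal v) + ennreal (2 * real n / x) * ennreal h)"
    using K v x h0 by (simp add: ennreal_plus[symmetric] ennreal_mult[symmetric] add.assoc del: ennreal_plus)
  also have "\<dots> \<le> ennreal (4 * (64 * real n * A / x\<^sup>2) powr p) + (ennreal (8 * real n / x) * (4 * ?IQ) + ennreal (2 * real n / x) * (8 * ?IQ))"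
    by (intro add_left_mono add_mono mult_left_mono h order_trans[OF lev(2,1)]) auto
  also have "ennreal (8 * real n / x) * (4 * ?IQ) + ennreal (2 * real n / x) * (8 * ?IQ) = ennreal (48 * real n / x) * ?IQ"
  proof -
    have "ennreal (8 * real n / x) * 4 + ennreal (2 * real n / x) * 8 = ennreal (8 * real n / x) * ennreal 4 + ennreal (2 * real n / x) * ennreal 8"
      by simp
    also have "\<dots> = ennreal (48 * real n / x)" using x by (simp add: ennreal_plus[symmetric] ennreal_mult[symmetric] del: ennreal_plus ennreal_numeral)
    finally show ?thesis by (metis distrib_right mult.assoc)
  qed
  finally show ?thesis unfolding X_def .
qed

end

section \<open>Approximation by step forms\<close>

lemma ennreal_add_less_le:
  fixes a b c d :: ennreal
  assumes "a < c" "b \<le> d" "d \<noteq> top"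
  shows "a + b < c + d"
proof -
  have le: "a + b \<le> a + d" using assms(2) by (rule add_left_mono)
  have "d + a < d + c" unfolding ennreal_add_left_cancel_less using assms(1,3) by simp
  then have "a + d < c + d" by (simp only: add.commute)
  with le show ?thesis by (rule le_less_trans)
qed

lemma count_below:
  fixes z :: real
  assumes z: "0 \<le> z"
  shows "(\<Sum>i\<in>{1..m}. indicat_real {i. real i < z} i) \<le> z"
    and "z \<le> real m \<Longrightarrow> z - 1 \<le> (\<Sum>i\<in>{1..m}. indicat_real {i. real i < z} i)"
proof -
  have sum: "(\<Sum>i\<in>{1..m}. indicat_real {i. real i < z} i) = real (card {i\<in>{1..m}. real i < z})"
    by (simp add: indicator_def sum.If_cases Int_def conj_commute)
  have "card {i\<in>{1..m}. real i < z} \<le> card {1..nat \<lfloor>z\<rfloor>}"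
    by (intro card_mono) (auto simp: le_nat_floor)
  then have "real (card {i\<in>{1..m}. real i < z}) \<le> real (nat \<lfloor>z\<rfloor>)" by simp
  also have "\<dots> \<le> z" using z by simp
  finally show "(\<Sum>i\<in>{1..m}. indicat_real {i. real i < z} i) \<le> z" unfolding sum .
  assume zm: "z \<le> real m"
  define r where "r = nat \<lceil>z\<rceil> - 1"
  have "{1..r} \<subseteq> {i\<in>{1..m}. real i < z}"
  proof
    fix i assume i: "i \<in> {1..r}"
    then have "int i < \<lceil>z\<rceil>" by (auto simp: r_def)
    then have "real i < z" by (simp add: less_ceiling_iff)
    then show "i \<in> {i\<in>{1..m}. real i < z}" using i zm by auto
  qed
  then have "card {1..r} \<le> card {i\<in>{1..m}. real i < z}" by (intro card_mono) auto
  then have "real r \<le> real (card {i\<in>{1..m}. real i < z})" by simp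
  moreover have "z - 1 \<le> real r" unfolding r_def by linarith
  ultimately show "z - 1 \<le> (\<Sum>i\<in>{1..m}. indicat_real {i. real i < z} i)" unfolding sum by linarith
qed

text \<open>The level sets of a function that is monotone on an interval and null elsewhere are intervals,
  as long as the level keeps away from the value \<open>0\<close> taken outside.\<close>

lemma monotone_level_sets:
  assumes g: "g \<in> Mon_class H \<mu>" and s: "0 \<le> s"
  shows "is_interval {y. s < g y}" "is_interval {y. g y < - s}"
proof -
  obtain I where I: "is_interval I" "mono_on I g \<or> antimono_on I g" "\<And>x. x \<notin> I \<Longrightarrow> g x = 0"
    using g by (auto simp: Mon_class_def)
  have above: "a \<in> I" if "s < g a" for a using that s I(3)[of a] by (cases "a \<in> I") auto
  have below: "a \<in> I" if "g a < - s" for a using that s I(3)[of a] by (cases "a \<in> I") auto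
  have mid: "y \<in> I \<and> ((g a \<le> g y \<and> g y \<le> g b) \<or> (g b \<le> g y \<and> g y \<le> g a))"
    if "a \<in> I" "b \<in> I" "a \<le> y" "y \<le> b" for a b y
  proof -
    have "y \<in> I" using I(1) that unfolding is_interval_1 by blast
    then show ?thesis using I(2) that unfolding monotone_on_def by blast
  qed
  show "is_interval {y. s < g y}" unfolding is_interval_1
  proof (intro ballI allI impI)
    fix a b y assume "a \<in> {y. s < g y}" "b \<in> {y. s < g y}" "a \<le> y \<and> y \<le> b"
    then show "y \<in> {y. s < g y}" using mid[of a b y] above[of a] above[of b] by auto
  qed
  show "is_interval {y. g y < - s}" unfolding is_interval_1
  proof (intro ballI allI impI)
    fix a b y assume "a \<in> {y. g y < - s}" "b \<in> {y. g y < - s}" "a \<le> y \<and> y \<le> b"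
    then show "y \<in> {y. g y < - s}" using mid[of a b y] below[of a] below[of b] by auto
  qed
qed

text \<open>The layer-cake approximation of \<open>g\<close> with mesh \<open>1 / k\<close>, capped at height \<open>k\<close>. It takes
  values between \<open>0\<close> and \<open>g\<close>, so that convergence to \<open>g\<close> is dominated.\<close>

definition layers :: "(real \<Rightarrow> real) \<Rightarrow> nat \<Rightarrow> real \<Rightarrow> real" where
  "layers g k y = (\<Sum>i\<in>{1..k * k}. 1 / real k *
     (indicat_real {y. real i / real k < g y} y - indicat_real {y. g y < - (real i / real k)} y))"

lemma layers_approx:
  assumes k: "1 \<le> k"
  shows "\<bar>layers g k y\<bar> \<le> \<bar>g y\<bar>" "\<bar>g y\<bar> \<le> real k \<Longrightarrow> \<bar>g y - layers g k y\<bar> \<le> 1 / real k"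
proof -
  have k0: "0 < real k" using k by simp
  let ?N = "\<lambda>z. \<Sum>i\<in>{1..k * k}. indicat_real {i. real i < z} i"
  have pos: "layers g k y = 1 / real k * ?N (real k * g y)" if "0 \<le> g y"
  proof -
    have "indicat_real {y. real i / real k < g y} y - indicat_real {y. g y < - (real i / real k)} y
        = indicat_real {i. real i < real k * g y} i" for i
    proof -
      have "0 \<le> real i / real k" by simp
      then have "\<not> g y < - (real i / real k)" using that by linarith
      then show ?thesis using k0 by (simp add: indicator_def field_simps)
    qed
    then show ?thesis unfolding layers_def by (simp only: sum_distrib_left)
  qed
  have neg: "layers g k y = - (1 / real k * ?N (real k * (- g y)))" if "g y < 0"
  proof -
    have "indicat_real {y. real i / real k < g y} y - indicat_real {y. g y < - (real i / real k)} y
        = - indicat_real {i. real i < real k * (- g y)} i" for i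
    proof -
      have "0 \<le> real i / real k" by simp
      then have "\<not> real i / real k < g y" using that by linarith
      moreover have "g y < - (real i / real k) \<longleftrightarrow> real i < real k * (- g y)"
        using k0 by (simp add: field_simps) linarith
      ultimately show ?thesis by (simp add: indicator_def)
    qed
    then show ?thesis unfolding layers_def by (simp only: sum_distrib_left sum_negf mult_minus_right)
  qed
  have abs: "\<bar>layers g k y\<bar> = 1 / real k * ?N (real k * \<bar>g y\<bar>) \<and>
      \<bar>g y - layers g k y\<bar> = \<bar>\<bar>g y\<bar> - 1 / real k * ?N (real k * \<bar>g y\<bar>)\<bar>"
  proof -
    have N0: "0 \<le> 1 / real k * ?N z" for z using k0 by (intro mult_nonneg_nonneg sum_nonneg) auto
    show ?thesis
    proof (cases "0 \<le> g y")
      case True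
      then have "\<bar>g y\<bar> = g y" by simp
      then show ?thesis unfolding pos[OF True] using N0[of "real k * g y"] by (simp only: abs_of_nonneg)
    next
      case False
      then have n: "g y < 0" and a: "\<bar>g y\<bar> = - g y" by auto
      show ?thesis unfolding neg[OF n] a abs_minus_cancel using N0[of "real k * (- g y)"]
        by (simp only: abs_of_nonneg) (simp add: abs_if)
    qed
  qed
  have z: "0 \<le> real k * \<bar>g y\<bar>" by simp
  have up: "1 / real k * ?N (real k * \<bar>g y\<bar>) \<le> \<bar>g y\<bar>"
    using mult_left_mono[OF count_below(1)[OF z, of "k * k"], of "1 / real k"] k0 by simp
  then show "\<bar>layers g k y\<bar> \<le> \<bar>g y\<bar>" using abs by simp
  assume "\<bar>g y\<bar> \<le> real k"
  then have "real k * \<bar>g y\<bar> \<le> real (k * k)" using k0 by simp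
  from mult_left_mono[OF count_below(2)[OF z this], of "1 / real k"]
  have "\<bar>g y\<bar> - 1 / real k \<le> 1 / real k * ?N (real k * \<bar>g y\<bar>)" using k0 by (simp add: right_diff_distrib)
  then show "\<bar>g y - layers g k y\<bar> \<le> 1 / real k" using abs up by linarith
qed

lemma level_set_borel:
  assumes g: "g \<in> Mon_class H \<mu>" and s: "0 \<le> s"
  shows "{y. s < g y} \<in> sets borel" "{y. g y < - s} \<in> sets borel"
  using monotone_level_sets[OF g s] by (auto intro: real_interval_borel_measurable)

lemma layers_measurable:
  assumes g: "g \<in> Mon_class H \<mu>"
  shows "layers g k \<in> borel_measurable borel"
  unfolding layers_def[abs_def]
  by (intro borel_measurable_sum borel_measurable_times borel_measurable_const borel_measurable_diff
      borel_measurable_indicator level_set_borel[OF g]) auto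

lemma layers_tendsto: "(\<lambda>k. layers g (Suc k) y) \<longlonglongrightarrow> g y"
proof (rule LIMSEQ_I)
  fix r :: real assume r: "0 < r"
  obtain n :: nat where n: "max \<bar>g y\<bar> (1 / r) < real n" using reals_Archimedean2 by blast
  have "norm (layers g (Suc k) y - g y) < r" if "n \<le> k" for k
  proof -
    have nk: "real n \<le> real (Suc k)" using that by simp
    then have "\<bar>g y\<bar> \<le> real (Suc k)" using n by linarith
    then have "\<bar>g y - layers g (Suc k) y\<bar> \<le> 1 / real (Suc k)" by (rule layers_approx(2)[rotated]) simp
    also have "\<dots> < r"
    proof -
      have "1 / r < real (Suc k)" using n nk by linarith
      then show ?thesis using r by (simp add: field_simps)
    qed
    finally show ?thesis by (simp add: abs_minus_commute)
  qed
  then show "\<exists>no. \<forall>n\<ge>no. norm (layers g (Suc n) y - g y) < r" by blast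
qed

lemma Mon_measurable: "g \<in> Mon_class H \<mu> \<Longrightarrow> g \<in> borel_measurable borel"
  by (rule borel_measurable_LIMSEQ_metric[OF layers_measurable layers_tendsto])

lemma Mon_tail: "g \<in> Mon_class H \<mu> \<Longrightarrow> 0 \<le> t \<Longrightarrow> space \<mu> = UNIV \<Longrightarrow> measure \<mu> {x. \<bar>g x\<bar> > t} \<le> H t"
  by (auto simp: Mon_class_def)

text \<open>\<open>\<bar>g\<bar>\<close> is at most \<open>1\<close> plus the number of positive integers below it, so its mean is controlled
  by the sum of \<open>H\<close> over the positive integers. That sum is the tail mass above level \<open>0\<close> of
  the step form with coefficient \<open>1\<close> and an empty interval at each integer level.\<close>

lemma Mon_integrable:
  assumes g: "g \<in> Mon_class H \<mu>" and H: "tail_function H" and \<mu>: "prob_space \<mu>" "sets \<mu> = sets borel"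
    and Q: "(\<integral>\<^sup>+u\<in>{0..1}. quantile_of H u \<partial>lborel) < \<infinity>"
  shows "(\<integral>\<^sup>+y. ennreal \<bar>g y\<bar> \<partial>\<mu>) < \<infinity>"
proof -
  interpret prob_space \<mu> by (rule \<mu>)
  have sp: "space \<mu> = UNIV" using \<mu>(2) by (metis sets_eq_imp_space_eq space_borel)
  have gM [measurable]: "g \<in> borel_measurable \<mu>" using Mon_measurable[OF g] \<mu>(2) by (simp cong: measurable_cong_sets)
  let ?e = "\<lambda>i y. indicator {y. real (Suc i) < \<bar>g y\<bar>} y :: ennreal"
  have eM [measurable]: "{y. real (Suc i) < \<bar>g y\<bar>} \<in> sets \<mu>" for i
  proof -
    have "{y\<in>space \<mu>. real (Suc i) < \<bar>g y\<bar>} \<in> sets \<mu>" by measurable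
    then show ?thesis by (simp add: sp)
  qed
  have "ennreal \<bar>g y\<bar> \<le> 1 + (\<Sum>i. ?e i y)" for y
  proof -
    define m where "m = nat \<lceil>\<bar>g y\<bar>\<rceil>"
    have "\<bar>g y\<bar> \<le> real m" unfolding m_def by linarith
    then have "\<bar>g y\<bar> \<le> 1 + (\<Sum>i\<in>{1..m}. indicat_real {i. real i < \<bar>g y\<bar>} i)"
      using count_below(2)[of "\<bar>g y\<bar>" m] by simp
    then have "ennreal \<bar>g y\<bar> \<le> ennreal (1 + (\<Sum>i\<in>{1..m}. indicat_real {i. real i < \<bar>g y\<bar>} i))" by (rule ennreal_leI)
    also have "\<dots> = 1 + (\<Sum>i\<in>{1..m}. ennreal (indicat_real {i. real i < \<bar>g y\<bar>} i))"
      by (subst ennreal_plus) (auto intro!: sum_nonneg)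
    also have "(\<Sum>i\<in>{1..m}. ennreal (indicat_real {i. real i < \<bar>g y\<bar>} i)) = (\<Sum>i<m. ?e i y)"
      by (rule sum.reindex_bij_witness[of _ Suc "\<lambda>i. i - 1"]) (auto simp: indicator_def)
    also have "\<dots> \<le> (\<Sum>i. ?e i y)" by (rule sum_le_suminf) auto
    finally show ?thesis by (simp add: add_left_mono)
  qed
  then have "(\<integral>\<^sup>+y. ennreal \<bar>g y\<bar> \<partial>\<mu>) \<le> (\<integral>\<^sup>+y. 1 + (\<Sum>i. ?e i y) \<partial>\<mu>)" by (intro nn_integral_mono)
  also have "\<dots> = (\<integral>\<^sup>+y. 1 \<partial>\<mu>) + (\<integral>\<^sup>+y. (\<Sum>i. ?e i y) \<partial>\<mu>)"
    by (rule nn_integral_add) measurable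
  also have "(\<integral>\<^sup>+y. (\<Sum>i. ?e i y) \<partial>\<mu>) = (\<Sum>i. \<integral>\<^sup>+y. ?e i y \<partial>\<mu>)"
    by (rule nn_integral_suminf) measurable
  also have "\<dots> = (\<Sum>i. emeasure \<mu> {y. real (Suc i) < \<bar>g y\<bar>})"
    by (simp only: nn_integral_indicator[OF eM])
  also have "(\<Sum>i. emeasure \<mu> {y. real (Suc i) < \<bar>g y\<bar>}) \<le> 2 * (\<integral>\<^sup>+u\<in>{0..1}. quantile_of H u \<partial>lborel)"
  proof (rule suminf_le_const)
    fix m
    have F: "step_form H \<mu> {1..m} (\<lambda>_. 1) real (\<lambda>_. {})"
    proof -
      have "real (card {i\<in>{1..m}. real i \<le> x}) \<le> 2 * x" if "0 \<le> x" for x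
      proof -
        have "card {i\<in>{1..m}. real i \<le> x} \<le> card {1..nat \<lfloor>x\<rfloor>}" by (intro card_mono) (auto simp: le_nat_floor)
        then have "real (card {i\<in>{1..m}. real i \<le> x}) \<le> real (nat \<lfloor>x\<rfloor>)" by simp
        also have "\<dots> \<le> x" using that by simp
        finally show ?thesis using that by simp
      qed
      then show ?thesis using H by (auto simp: step_form_def tail_function_def is_interval_1)
    qed
    have "(\<Sum>i<m. emeasure \<mu> {y. real (Suc i) < \<bar>g y\<bar>}) = (\<Sum>i\<in>{1..m}. emeasure \<mu> {y. real i < \<bar>g y\<bar>})"
      by (rule sum.reindex_bij_witness[of _ "\<lambda>i. i - 1" Suc]) auto
    also have "\<dots> \<le> (\<Sum>i\<in>{1..m}. ennreal (H (real i)))"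
      using Mon_tail[OF g _ sp] by (intro sum_mono) (auto simp: emeasure_eq_measure intro!: ennreal_leI)
    also have "\<dots> = ennreal (\<Sum>i\<in>{1..m}. H (real i))" using H by (subst sum_ennreal) (auto simp: tail_function_def)
    also have "\<dots> = ennreal (\<Sum>i\<in>{i\<in>{1..m}. 0 < real i}. \<bar>1\<bar> * H (real i))"
      by (intro arg_cong[where f = ennreal] sum.cong) auto
    also have "\<dots> \<le> 2 * (\<integral>\<^sup>+u\<in>{0..1}. quantile_of H u * indicator {..<1} u \<partial>lborel)"
      using H by (intro step_form_tail_mass[OF H F]) (auto simp: tail_function_def)
    also have "\<dots> \<le> 2 * (\<integral>\<^sup>+u\<in>{0..1}. quantile_of H u \<partial>lborel)"
      by (intro mult_left_mono nn_integral_mono) (auto simp: indicator_def)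
    finally show "(\<Sum>i<m. emeasure \<mu> {y. real (Suc i) < \<bar>g y\<bar>}) \<le> 2 * (\<integral>\<^sup>+u\<in>{0..1}. quantile_of H u \<partial>lborel)" .
  qed auto
  also have "(\<integral>\<^sup>+y. 1 \<partial>\<mu>) + 2 * (\<integral>\<^sup>+u\<in>{0..1}. quantile_of H u \<partial>lborel) < \<infinity>"
    using Q by (simp add: ennreal_mult_less_top emeasure_space_1)
  finally show ?thesis by (simp add: add_left_mono)
qed

lemma layers_L1:
  assumes g: "g \<in> Mon_class H \<mu>" and H: "tail_function H" and \<mu>: "prob_space \<mu>" "sets \<mu> = sets borel"
    and Q: "(\<integral>\<^sup>+u\<in>{0..1}. quantile_of H u \<partial>lborel) < \<infinity>"
  shows "(\<lambda>k. \<integral>\<^sup>+y. ennreal \<bar>g y - layers g (Suc k) y\<bar> \<partial>\<mu>) \<longlonglongrightarrow> 0"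
proof -
  have [measurable]: "g \<in> borel_measurable \<mu>" using Mon_measurable[OF g] \<mu>(2) by (simp cong: measurable_cong_sets)
  have [measurable]: "layers g k \<in> borel_measurable \<mu>" for k
    using layers_measurable[OF g] \<mu>(2) by (simp cong: measurable_cong_sets)
  have "(\<lambda>k. \<integral>\<^sup>+y. norm (g y - layers g (Suc k) y) \<partial>\<mu>) \<longlonglongrightarrow> 0"
    by (rule nn_integral_dominated_convergence_norm[where w = "\<lambda>y. \<bar>g y\<bar>"])
      (use layers_approx(1)[of "Suc _" g] layers_tendsto Mon_integrable[OF assms] in auto)
  then show ?thesis by simp
qed

text \<open>The signed layers of a combination of functions of the class form a step form: at each level
  there are two indicators for each function, whence the factor \<open>2\<close> in the budget.\<close>

lemma layers_step_form:
  assumes a: "(\<Sum>l\<in>{1..L}. \<bar>a l\<bar>) \<le> 1" and Mon: "\<forall>l\<in>{1..L}. g l \<in> Mon_class H \<mu>"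
    and \<mu>: "prob_space \<mu>" "sets \<mu> = sets borel" and k: "1 \<le> k"
  defines "I \<equiv> {1..L} \<times> {1..k * k} \<times> (UNIV :: bool set)"
    and "c \<equiv> (\<lambda>\<iota> :: nat \<times> nat \<times> bool. (if snd (snd \<iota>) then 1 else -1) * a (fst \<iota>) / real k)"
    and "t \<equiv> (\<lambda>\<iota> :: nat \<times> nat \<times> bool. real (fst (snd \<iota>)) / real k)"
    and "J \<equiv> (\<lambda>\<iota> :: nat \<times> nat \<times> bool. if snd (snd \<iota>) then {y. real (fst (snd \<iota>)) / real k < g (fst \<iota>) y}
      else {y. g (fst \<iota>) y < - (real (fst (snd \<iota>)) / real k)})"
  shows "step_form H \<mu> I c t J" "(\<Sum>\<iota>\<in>I. c \<iota> * indicat_real (J \<iota>) y) = (\<Sum>l\<in>{1..L}. a l * layers (g l) k y)"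
proof -
  note g = bspec[OF Mon]
  have k0: "0 < real k" using k by simp
  interpret prob_space \<mu> by (rule \<mu>)
  have sp: "space \<mu> = UNIV" using \<mu>(2) by (metis sets_eq_imp_space_eq space_borel)
  show "step_form H \<mu> I c t J"
    unfolding step_form_def
  proof (intro conjI ballI allI impI)
    show "finite I" by (simp add: I_def)
    fix \<iota> assume "\<iota> \<in> I"
    then obtain l i b where \<iota>: "\<iota> = (l, i, b)" "l \<in> {1..L}" "i \<in> {1..k * k}" by (auto simp: I_def)
    have t0: "0 \<le> real i / real k" by simp
    show "is_interval (J \<iota>)" using monotone_level_sets[OF g[OF \<iota>(2)] t0] by (simp add: \<iota> J_def)
    show "0 < t \<iota>" using \<iota> k0 by (simp add: t_def)
    have gM: "g l \<in> borel_measurable \<mu>" using Mon_measurable[OF g[OF \<iota>(2)]] \<mu>(2) by (simp cong: measurable_cong_sets)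
    have "{y\<in>space \<mu>. real i / real k < \<bar>g l y\<bar>} \<in> sets \<mu>" using gM by measurable
    then have "measure \<mu> (J \<iota>) \<le> measure \<mu> {y. real i / real k < \<bar>g l y\<bar>}"
      using t0 by (intro finite_measure_mono) (auto simp: \<iota> J_def sp)
    also have "\<dots> \<le> H (real i / real k)" by (rule Mon_tail[OF g[OF \<iota>(2)] t0 sp])
    finally show "measure \<mu> (J \<iota>) \<le> H (t \<iota>)" by (simp add: \<iota> t_def)
  next
    fix x :: real assume x: "0 \<le> x"
    let ?N = "{i\<in>{1..k * k}. real i / real k \<le> x}"
    have levels: "{\<iota>\<in>I. t \<iota> \<le> x} = {1..L} \<times> (?N \<times> UNIV)" by (auto simp: I_def t_def)
    have c_abs: "\<bar>c \<iota>\<bar> = \<bar>a (fst \<iota>)\<bar> / real k" for \<iota> by (simp add: c_def abs_mult)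
    have inner: "(\<Sum>\<iota>\<in>?N \<times> (UNIV :: bool set). \<bar>a l\<bar> / real k) = \<bar>a l\<bar> * (2 * real (card ?N) / real k)" for l
      by (simp add: card_cartesian_product)
    have "(\<Sum>\<iota>\<in>{\<iota>\<in>I. t \<iota> \<le> x}. \<bar>c \<iota>\<bar>) = (\<Sum>(l, \<iota>)\<in>{1..L} \<times> (?N \<times> (UNIV :: bool set)). \<bar>a l\<bar> / real k)"
      unfolding levels c_abs split_beta ..
    also have "\<dots> = (\<Sum>l\<in>{1..L}. \<Sum>\<iota>\<in>?N \<times> (UNIV :: bool set). \<bar>a l\<bar> / real k)"
      by (rule sum.cartesian_product[symmetric])
    also have "\<dots> = (\<Sum>l\<in>{1..L}. \<bar>a l\<bar>) * (2 * real (card ?N) / real k)"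
      unfolding inner by (rule sum_distrib_right[symmetric])
    also have "\<dots> \<le> 1 * (2 * x)"
    proof (intro mult_mono a)
      have "card ?N \<le> card {1..nat \<lfloor>real k * x\<rfloor>}"
        using k0 by (intro card_mono) (auto intro!: le_nat_floor simp: field_simps)
      then have "real (card ?N) \<le> real (nat \<lfloor>real k * x\<rfloor>)" by simp
      also have "\<dots> \<le> real k * x" using x by simp
      finally show "2 * real (card ?N) / real k \<le> 2 * x" using k0 by (simp add: field_simps)
    qed (use k0 in auto)
    finally show "(\<Sum>\<iota>\<in>{\<iota>\<in>I. t \<iota> \<le> x}. \<bar>c \<iota>\<bar>) \<le> 2 * x" by simp
  qed
  have "(\<Sum>\<iota>\<in>I. c \<iota> * indicat_real (J \<iota>) y) = (\<Sum>l\<in>{1..L}. \<Sum>i\<in>{1..k * k}. \<Sum>b\<in>UNIV. c (l, i, b) * indicat_real (J (l, i, b)) y)"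
    unfolding I_def by (subst sum.cartesian_product, subst sum.cartesian_product, rule sum.cong, rule refl, simp only: split_beta prod.collapse)
  also have "\<dots> = (\<Sum>l\<in>{1..L}. a l * layers (g l) k y)"
    unfolding layers_def sum_distrib_left
    by (intro sum.cong refl) (simp add: UNIV_bool c_def J_def algebra_simps)
  finally show "(\<Sum>\<iota>\<in>I. c \<iota> * indicat_real (J \<iota>) y) = (\<Sum>l\<in>{1..L}. a l * layers (g l) k y)" .
qed

lemma F_class_step_form:
  assumes f: "f \<in> F_class H \<mu>" and H: "tail_function H" and \<mu>: "prob_space \<mu>" "sets \<mu> = sets borel"
    and Q: "(\<integral>\<^sup>+u\<in>{0..1}. quantile_of H u \<partial>lborel) < \<infinity>" and \<epsilon>: "0 < \<epsilon>"
  shows "\<exists>(I :: (nat \<times> nat \<times> bool) set) c t J. step_form H \<mu> I c t J \<and>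
    (\<integral>\<^sup>+y. ennreal \<bar>f y - (\<Sum>\<iota>\<in>I. c \<iota> * indicat_real (J \<iota>) y)\<bar> \<partial>\<mu>) < ennreal \<epsilon>"
proof -
  obtain h where h: "h \<in> Mon_combinations H \<mu>" "(\<integral>\<^sup>+y. ennreal \<bar>f y - h y\<bar> \<partial>\<mu>) < ennreal (\<epsilon> / 2)"
    using f \<epsilon> unfolding F_class_def by (auto dest!: spec[of _ "\<epsilon> / 2"])
  have "\<exists>(L :: nat) (a :: nat \<Rightarrow> real) (g :: nat \<Rightarrow> real \<Rightarrow> real). h = (\<lambda>x. \<Sum>l\<in>{1..L}. a l * g l x) \<and> (\<Sum>l\<in>{1..L}. \<bar>a l\<bar>) \<le> 1 \<and>
      (\<forall>l\<in>{1..L}. g l \<in> Mon_class H \<mu>)"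
    using h(1) unfolding Mon_combinations_def mem_Collect_eq .
  then obtain L :: nat and a :: "nat \<Rightarrow> real" and g :: "nat \<Rightarrow> real \<Rightarrow> real"
    where Lag: "h = (\<lambda>x. \<Sum>l\<in>{1..L}. a l * g l x)" "(\<Sum>l\<in>{1..L}. \<bar>a l\<bar>) \<le> 1"
      and Mon: "\<forall>l\<in>{1..L}. g l \<in> Mon_class H \<mu>"
    by (elim exE conjE) (rule that)
  note Lag = Lag bspec[OF Mon]
  have fM [measurable]: "f \<in> borel_measurable \<mu>" using f by (auto simp: F_class_def)
  have gM: "g l \<in> borel_measurable \<mu>" if "l \<in> {1..L}" for l
    using Mon_measurable[OF Lag(3)[OF that]] \<mu>(2) by (simp cong: measurable_cong_sets)
  have lM: "layers (g l) k \<in> borel_measurable \<mu>" if "l \<in> {1..L}" for l k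
    using layers_measurable[OF Lag(3)[OF that]] \<mu>(2) by (simp cong: measurable_cong_sets)
  have hM [measurable]: "h \<in> borel_measurable \<mu>" unfolding Lag(1)
    by (intro borel_measurable_sum borel_measurable_times borel_measurable_const gM)
  have "eventually (\<lambda>k. \<forall>l\<in>{1..L}. (\<integral>\<^sup>+y. ennreal \<bar>g l y - layers (g l) (Suc k) y\<bar> \<partial>\<mu>) < ennreal (\<epsilon> / 2)) sequentially"
    using \<epsilon> by (intro eventually_ball_finite ballI order_tendstoD(2)[OF layers_L1[OF Lag(3) H \<mu> Q]]) auto
  then obtain k where "\<forall>l\<in>{1..L}. (\<integral>\<^sup>+y. ennreal \<bar>g l y - layers (g l) (Suc k) y\<bar> \<partial>\<mu>) < ennreal (\<epsilon> / 2)"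
    unfolding eventually_sequentially by blast
  note k = bspec[OF this]
  let ?h = "\<lambda>y. \<Sum>l\<in>{1..L}. a l * layers (g l) (Suc k) y"
  have h'M [measurable]: "?h \<in> borel_measurable \<mu>"
    by (intro borel_measurable_sum borel_measurable_times borel_measurable_const lM)
  have "(\<integral>\<^sup>+y. ennreal \<bar>h y - ?h y\<bar> \<partial>\<mu>) \<le> (\<integral>\<^sup>+y. (\<Sum>l\<in>{1..L}. ennreal \<bar>a l\<bar> * ennreal \<bar>g l y - layers (g l) (Suc k) y\<bar>) \<partial>\<mu>)"
  proof (rule nn_integral_mono)
    fix y
    have "\<bar>h y - ?h y\<bar> = \<bar>\<Sum>l\<in>{1..L}. a l * (g l y - layers (g l) (Suc k) y)\<bar>"
      by (simp add: Lag(1) sum_subtractf right_diff_distrib)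
    also have "\<dots> \<le> (\<Sum>l\<in>{1..L}. \<bar>a l\<bar> * \<bar>g l y - layers (g l) (Suc k) y\<bar>)"
      unfolding abs_mult[symmetric] by (rule sum_abs)
    finally have "ennreal \<bar>h y - ?h y\<bar> \<le> ennreal (\<Sum>l\<in>{1..L}. \<bar>a l\<bar> * \<bar>g l y - layers (g l) (Suc k) y\<bar>)" by (rule ennreal_leI)
    also have "\<dots> = (\<Sum>l\<in>{1..L}. ennreal \<bar>a l\<bar> * ennreal \<bar>g l y - layers (g l) (Suc k) y\<bar>)"
      by (subst sum_ennreal[symmetric]) (auto intro!: sum.cong simp: ennreal_mult)
    finally show "ennreal \<bar>h y - ?h y\<bar> \<le> (\<Sum>l\<in>{1..L}. ennreal \<bar>a l\<bar> * ennreal \<bar>g l y - layers (g l) (Suc k) y\<bar>)" .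
  qed
  also have "\<dots> = (\<Sum>l\<in>{1..L}. ennreal \<bar>a l\<bar> * (\<integral>\<^sup>+y. ennreal \<bar>g l y - layers (g l) (Suc k) y\<bar> \<partial>\<mu>))"
  proof (subst nn_integral_sum)
    show "(\<lambda>y. ennreal \<bar>a l\<bar> * ennreal \<bar>g l y - layers (g l) (Suc k) y\<bar>) \<in> borel_measurable \<mu>" if "l \<in> {1..L}" for l
      using gM[OF that] lM[OF that] by measurable
    show "(\<Sum>l\<in>{1..L}. \<integral>\<^sup>+y. ennreal \<bar>a l\<bar> * ennreal \<bar>g l y - layers (g l) (Suc k) y\<bar> \<partial>\<mu>)
        = (\<Sum>l\<in>{1..L}. ennreal \<bar>a l\<bar> * (\<integral>\<^sup>+y. ennreal \<bar>g l y - layers (g l) (Suc k) y\<bar> \<partial>\<mu>))"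
      using gM lM by (intro sum.cong refl nn_integral_cmult) measurable
  qed
  also have "\<dots> \<le> (\<Sum>l\<in>{1..L}. ennreal \<bar>a l\<bar> * ennreal (\<epsilon> / 2))"
    using k by (intro sum_mono mult_left_mono) (auto intro: less_imp_le)
  also have "\<dots> = ennreal ((\<Sum>l\<in>{1..L}. \<bar>a l\<bar>) * (\<epsilon> / 2))"
    using \<epsilon> by (subst ennreal_mult) (auto simp: sum_distrib_right[symmetric] sum_nonneg)
  also have "\<dots> \<le> ennreal (\<epsilon> / 2)"
    using Lag(2) \<epsilon> by (intro ennreal_leI) (simp add: mult_left_le_one_le sum_nonneg)
  finally have 2: "(\<integral>\<^sup>+y. ennreal \<bar>h y - ?h y\<bar> \<partial>\<mu>) \<le> ennreal (\<epsilon> / 2)" .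
  have "(\<integral>\<^sup>+y. ennreal \<bar>f y - ?h y\<bar> \<partial>\<mu>) \<le> (\<integral>\<^sup>+y. ennreal \<bar>f y - h y\<bar> + ennreal \<bar>h y - ?h y\<bar> \<partial>\<mu>)"
    by (intro nn_integral_mono) (auto simp: ennreal_plus[symmetric] simp del: ennreal_plus intro!: ennreal_leI)
  also have "\<dots> = (\<integral>\<^sup>+y. ennreal \<bar>f y - h y\<bar> \<partial>\<mu>) + (\<integral>\<^sup>+y. ennreal \<bar>h y - ?h y\<bar> \<partial>\<mu>)"
    by (rule nn_integral_add) measurable
  also have "\<dots> < ennreal (\<epsilon> / 2) + ennreal (\<epsilon> / 2)"
    using h(2) 2 by (intro ennreal_add_less_le) simp_all
  also have "\<dots> = ennreal \<epsilon>" using \<epsilon> by (simp add: ennreal_plus[symmetric] del: ennreal_plus)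
  finally have "(\<integral>\<^sup>+y. ennreal \<bar>f y - ?h y\<bar> \<partial>\<mu>) < ennreal \<epsilon>" .
  moreover have "1 \<le> Suc k" by simp
  note step = layers_step_form[where a = a and g = g and k = "Suc k", OF Lag(2) Mon \<mu> this]
  ultimately show ?thesis unfolding step(2)[symmetric] by (intro exI conjI step(1))
qed

section \<open>The deviation inequality for the function class\<close>

context stationary_sequence
begin

text \<open>The bound for step forms does not depend on the step form, so it passes to the closure: an
  approximation in \<open>L\<^sup>1\<close> changes the partial sums up to time \<open>n\<close> by more than \<open>x\<close> only with
  arbitrarily small probability. This is paid for by one more \<open>x\<close> in the threshold.\<close>

lemma F_class_deviation:
  assumes H: "tail_function H" and f: "f \<in> F_class H \<mu>" and Q: "(\<integral>\<^sup>+u\<in>{0..1}. quantile_of H u \<partial>lborel) < \<infinity>"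
    and p: "2 \<le> p" and n: "1 \<le> n" and x: "0 < x" and A: "0 \<le> A"
    "(\<integral>\<^sup>+u\<in>{0..1}. ennreal_of_enat (min (alpha_inv (\<alpha> 1) u) (enat n)) * (quantile_of H u)\<^sup>2 \<partial>lborel) = ennreal A"
  shows "emeasure M {\<omega>\<in>space M. \<exists>k\<le>n. (16 * p + 15) * x \<le> \<bar>\<Sum>k\<in>{1..k}. cen k f \<omega>\<bar>}
    \<le> ennreal (4 * (64 * real n * A / x\<^sup>2) powr p) + ennreal (48 * real n / x) * tail_integral (quantile_of H) n x"
proof (rule ennreal_le_epsilon)
  fix e :: real assume e: "0 < e"
  have \<mu>: "prob_space \<mu>" "sets \<mu> = sets borel" by (auto intro: prob_space_distr)
  define \<epsilon> where "\<epsilon> = e * x / (2 * real n)"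
  have \<epsilon>: "0 < \<epsilon>" using e x n by (simp add: \<epsilon>_def)
  obtain I :: "(nat \<times> nat \<times> bool) set" and c t J where F: "step_form H \<mu> I c t J"
    and approx: "(\<integral>\<^sup>+y. ennreal \<bar>f y - (\<Sum>\<iota>\<in>I. c \<iota> * indicat_real (J \<iota>) y)\<bar> \<partial>\<mu>) < ennreal \<epsilon>"
    using F_class_step_form[OF f H \<mu> Q \<epsilon>] by blast
  define h where "h y = (\<Sum>\<iota>\<in>I. c \<iota> * indicat_real (J \<iota>) y)" for y
  have JM: "J \<iota> \<in> sets borel" if "\<iota> \<in> I" for \<iota>
    using F that by (auto simp: step_form_def intro: real_interval_borel_measurable)
  have hM [measurable]: "h \<in> borel_measurable borel" unfolding h_def[abs_def]
    by (intro borel_measurable_sum borel_measurable_times borel_measurable_const borel_measurable_indicator JM)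
  have fM [measurable]: "f \<in> borel_measurable borel" and f_int: "integrable \<mu> f" using f by (auto simp: F_class_def)
  have fh_int: "integrable \<mu> (\<lambda>y. f y - h y)"
    using approx by (intro integrableI_bounded) (auto simp: h_def[symmetric] intro: less_trans)
  have fh: "(\<integral>y. \<bar>f y - h y\<bar> \<partial>\<mu>) \<le> \<epsilon>"
  proof -
    have "ennreal (\<integral>y. \<bar>f y - h y\<bar> \<partial>\<mu>) = (\<integral>\<^sup>+y. ennreal \<bar>f y - h y\<bar> \<partial>\<mu>)"
      using fh_int by (intro nn_integral_eq_integral[symmetric]) auto
    also have "\<dots> \<le> ennreal \<epsilon>" using approx unfolding h_def by (rule less_imp_le)
    finally show ?thesis using \<epsilon> by (subst (asm) ennreal_le_iff) auto
  qed
  have Y_int: "integrable M (\<lambda>\<omega>. \<phi> (Y k \<omega>))" "(\<integral>\<omega>. \<phi> (Y k \<omega>) \<partial>M) = (\<integral>y. \<phi> y \<partial>\<mu>)"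
    if \<phi>: "integrable \<mu> \<phi>" "\<phi> \<in> borel_measurable borel" for \<phi> :: "real \<Rightarrow> real" and k
  proof -
    have "integrable M (\<lambda>\<omega>. \<phi> (Y0 \<omega>))" using \<phi>(1) by (rule integrable_distr[OF Y0_M])
    then have "integrable M (\<lambda>\<omega>. (\<lambda>\<omega>. \<phi> (Y0 \<omega>)) ((T ^^ k) \<omega>))" by (rule integrable_shift)
    then show "integrable M (\<lambda>\<omega>. \<phi> (Y k \<omega>))" by (simp add: Y_def)
    note \<phi>(2)[measurable]
    have "(\<integral>\<omega>. \<phi> (Y k \<omega>) \<partial>M) = (\<integral>\<omega>. (\<lambda>\<omega>. \<phi> (Y0 \<omega>)) ((T ^^ k) \<omega>) \<partial>M)" by (simp add: Y_def)
    also have "\<dots> = (\<integral>\<omega>. \<phi> (Y0 \<omega>) \<partial>M)" by (rule integral_shift) measurable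
    also have "\<dots> = (\<integral>y. \<phi> y \<partial>\<mu>)" by (rule integral_distr[symmetric]) measurable
    finally show "(\<integral>\<omega>. \<phi> (Y k \<omega>) \<partial>M) = (\<integral>y. \<phi> y \<partial>\<mu>)" .
  qed
  have h_int: "integrable \<mu> h"
  proof -
    have "integrable \<mu> (\<lambda>y. f y - (f y - h y))" by (rule Bochner_Integration.integrable_diff[OF f_int fh_int])
    then show ?thesis by simp
  qed
  have cenM [measurable]: "cen k f \<in> borel_measurable M" "cen k h \<in> borel_measurable M" for k by (auto intro: cen_meas)
  have cen_h: "cen k h \<omega> = (\<Sum>\<iota>\<in>I. c \<iota> * cen k (indicat_real (J \<iota>)) \<omega>)" for k \<omega>
  proof -
    have "integrable M (\<lambda>\<omega>. c \<iota> * indicat_real (J \<iota>) (Y k \<omega>))" if "\<iota> \<in> I" for \<iota>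
      by (intro integrable_mult_right comp_integrable indicat_bound borel_measurable_indicator JM that)
    then have "(\<integral>\<omega>. h (Y k \<omega>) \<partial>M) = (\<Sum>\<iota>\<in>I. c \<iota> * (\<integral>\<omega>. indicat_real (J \<iota>) (Y k \<omega>) \<partial>M))"
      unfolding h_def by (subst Bochner_Integration.integral_sum) (auto intro!: sum.cong)
    then show ?thesis by (simp add: cen_def h_def right_diff_distrib sum_subtractf)
  qed
  let ?D = "\<lambda>k \<omega>. cen k f \<omega> - cen k h \<omega>"
  have D_eq: "?D k \<omega> = (f (Y k \<omega>) - h (Y k \<omega>)) - (\<integral>y. f y - h y \<partial>\<mu>)" for k \<omega>
    using f_int h_int by (simp add: cen_def Y_int)
  have D_abs: "integrable M (\<lambda>\<omega>. \<bar>?D k \<omega>\<bar>)" "(\<integral>\<omega>. \<bar>?D k \<omega>\<bar> \<partial>M) \<le> 2 * \<epsilon>" for k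
  proof -
    let ?m = "\<integral>y. f y - h y \<partial>\<mu>"
    have i: "integrable M (\<lambda>\<omega>. f (Y k \<omega>) - h (Y k \<omega>))" using Y_int(1)[OF f_int] Y_int(1)[OF h_int] by simp
    show int: "integrable M (\<lambda>\<omega>. \<bar>?D k \<omega>\<bar>)" unfolding D_eq using i by simp
    have m: "\<bar>?m\<bar> \<le> \<epsilon>" using integral_abs_bound[of \<mu> "\<lambda>y. f y - h y"] fh by linarith
    have "(\<integral>\<omega>. \<bar>?D k \<omega>\<bar> \<partial>M) \<le> (\<integral>\<omega>. \<bar>f (Y k \<omega>) - h (Y k \<omega>)\<bar> + \<epsilon> \<partial>M)"
    proof (rule integral_mono[OF int])
      show "integrable M (\<lambda>\<omega>. \<bar>f (Y k \<omega>) - h (Y k \<omega>)\<bar> + \<epsilon>)" using i by simp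
      show "\<bar>?D k \<omega>\<bar> \<le> \<bar>f (Y k \<omega>) - h (Y k \<omega>)\<bar> + \<epsilon>" for \<omega> unfolding D_eq using m by linarith
    qed
    also have "\<dots> = (\<integral>\<omega>. \<bar>f (Y k \<omega>) - h (Y k \<omega>)\<bar> \<partial>M) + \<epsilon>" using i by (simp add: prob_space)
    also have "(\<integral>\<omega>. \<bar>f (Y k \<omega>) - h (Y k \<omega>)\<bar> \<partial>M) = (\<integral>y. \<bar>f y - h y\<bar> \<partial>\<mu>)"
      by (rule Y_int(2)[OF integrable_abs[OF fh_int]]) measurable
    finally show "(\<integral>\<omega>. \<bar>?D k \<omega>\<bar> \<partial>M) \<le> 2 * \<epsilon>" using fh by simp
  qed
  let ?F = "{\<omega>\<in>space M. x \<le> (\<Sum>k\<in>{1..n}. \<bar>?D k \<omega>\<bar>)}"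
  let ?E = "{\<omega>\<in>space M. \<exists>k\<le>n. (16 * p + 14) * x \<le> \<bar>\<Sum>k\<in>{1..k}. cen k h \<omega>\<bar>}"
  let ?S = "{\<omega>\<in>space M. \<exists>k\<le>n. (16 * p + 15) * x \<le> \<bar>\<Sum>k\<in>{1..k}. cen k f \<omega>\<bar>}"
  have FM: "?F \<in> sets M" by measurable
  have EM: "?E \<in> sets M" by (intro prefix_max_event_measurable borel_measurable_sum) measurable
  have "prob ?F \<le> e"
  proof -
    have "prob ?F \<le> (\<integral>\<omega>. (\<Sum>k\<in>{1..n}. \<bar>?D k \<omega>\<bar>) \<partial>M) / x"
      by (rule integral_Markov_inequality_measure[where A = "{}"]) (use x D_abs in \<open>auto intro!: sum_nonneg\<close>)
    also have "(\<integral>\<omega>. (\<Sum>k\<in>{1..n}. \<bar>?D k \<omega>\<bar>) \<partial>M) = (\<Sum>k\<in>{1..n}. \<integral>\<omega>. \<bar>?D k \<omega>\<bar> \<partial>M)"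
      by (rule Bochner_Integration.integral_sum) (rule D_abs)
    also have "\<dots> \<le> (\<Sum>k\<in>{1..n}. 2 * \<epsilon>)" by (intro sum_mono D_abs)
    also have "\<dots> = e * x" using n by (simp add: \<epsilon>_def)
    finally show ?thesis using x by (simp add: divide_right_mono)
  qed
  then have F_le: "emeasure M ?F \<le> ennreal e" by (simp add: emeasure_eq_measure ennreal_leI)
  have "?S \<subseteq> ?E \<union> ?F"
  proof (rule subsetI, rule ccontr)
    fix \<omega> assume "\<omega> \<in> ?S"
    then obtain k where w: "\<omega> \<in> space M" and k: "k \<le> n" "(16 * p + 15) * x \<le> \<bar>\<Sum>k\<in>{1..k}. cen k f \<omega>\<bar>" by auto
    assume no: "\<omega> \<notin> ?E \<union> ?F"
    have "\<bar>\<Sum>k\<in>{1..k}. ?D k \<omega>\<bar> \<le> (\<Sum>k\<in>{1..n}. \<bar>?D k \<omega>\<bar>)"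
      using k(1) by (intro order_trans[OF sum_abs] sum_mono2) auto
    moreover have "\<bar>\<Sum>k\<in>{1..k}. cen k h \<omega>\<bar> < (16 * p + 14) * x" using no w k(1) not_le by blast
    moreover have "(\<Sum>k\<in>{1..n}. \<bar>?D k \<omega>\<bar>) < x" using no w not_le by blast
    moreover have "(\<Sum>k\<in>{1..k}. cen k f \<omega>) = (\<Sum>k\<in>{1..k}. cen k h \<omega>) + (\<Sum>k\<in>{1..k}. ?D k \<omega>)"
      by (simp add: sum_subtractf)
    ultimately have "\<bar>\<Sum>k\<in>{1..k}. cen k f \<omega>\<bar> < (16 * p + 14) * x + x" by linarith
    also have "\<dots> = (16 * p + 15) * x" by (simp add: algebra_simps)
    finally show False using k(2) by simp
  qed
  then have "emeasure M ?S \<le> emeasure M (?E \<union> ?F)" using EM FM by (intro emeasure_mono) auto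
  also have "\<dots> \<le> emeasure M ?E + emeasure M ?F" by (rule emeasure_subadditive[OF EM FM])
  also have "\<dots> \<le> (ennreal (4 * (64 * real n * A / x\<^sup>2) powr p) + ennreal (48 * real n / x) * tail_integral (quantile_of H) n x) + ennreal e"
    using step_form_deviation[OF H F p n x A] F_le unfolding cen_h by (intro add_mono)
  finally show "emeasure M ?S \<le> (ennreal (4 * (64 * real n * A / x\<^sup>2) powr p) + ennreal (48 * real n / x) * tail_integral (quantile_of H) n x) + ennreal e" .
qed

end

section \<open>From tails to moments\<close>

lemma epowr_ennreal: "0 \<le> x \<Longrightarrow> epowr (ennreal x) r = ennreal (x powr r)"
  by (simp add: epowr_def)

lemma epowr_mono:
  assumes "x \<le> y" "0 \<le> r"
  shows "epowr x r \<le> epowr y r"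
proof (cases "y = top")
  case False
  then have "x \<noteq> top" using assms(1) by (auto simp: top_unique)
  moreover have "enn2real x \<le> enn2real y" using assms(1) False by (simp add: enn2real_mono less_top)
  ultimately show ?thesis using False assms(2) by (auto simp: epowr_def intro!: ennreal_leI powr_mono2)
qed (simp add: epowr_def)

lemma epowr_root:
  assumes "0 < p"
  shows "epowr (epowr x (1 / p)) p = x"
proof (cases x)
  case (real a)
  then show ?thesis using assms by (simp add: epowr_ennreal powr_powr)
qed (simp add: epowr_def)

lemma nn_integral_powr_Icc:
  assumes a: "- 1 < a" and z: "0 \<le> z"
  shows "(\<integral>\<^sup>+x\<in>{0..z}. ennreal (x powr a) \<partial>lborel) = ennreal (z powr (a + 1) / (a + 1))"
proof -
  have "((\<lambda>x. x powr a) has_integral (z powr (a + 1) / (a + 1))) {0..z}"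
    using a z by (rule has_integral_powr_from_0)
  then have "((\<lambda>x. if x \<in> {0..z} then x powr a else 0) has_integral (z powr (a + 1) / (a + 1))) UNIV"
    by (simp only: has_integral_restrict_UNIV)
  then have "(\<integral>\<^sup>+x. ennreal (if x \<in> {0..z} then x powr a else 0) \<partial>lborel) = ennreal (z powr (a + 1) / (a + 1))"
    by (intro nn_integral_has_integral_lborel) auto
  moreover have "(\<integral>\<^sup>+x. ennreal (if x \<in> {0..z} then x powr a else 0) \<partial>lborel) = (\<integral>\<^sup>+x\<in>{0..z}. ennreal (x powr a) \<partial>lborel)"
    by (intro nn_integral_cong) (simp add: indicator_def)
  ultimately show ?thesis by simp
qed

text \<open>The layer-cake formula for \<open>(Z / L)\<^sup>p\<close>, with the tail probabilities replaced by their
  bounds.\<close>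

lemma (in prob_space) moment_le_tail_integral:
  assumes Z [measurable]: "Z \<in> borel_measurable M" and Z0: "\<And>\<omega>. 0 \<le> Z \<omega>" and p: "1 \<le> p" and L: "0 < L"
    and tail: "\<And>x. 0 < x \<Longrightarrow> emeasure M {\<omega>\<in>space M. L * x \<le> Z \<omega>} \<le> \<Psi> x"
  shows "(\<integral>\<^sup>+\<omega>. ennreal (Z \<omega> powr p) \<partial>M)
    \<le> ennreal (L powr p) * (\<integral>\<^sup>+x\<in>{0<..}. ennreal (p * x powr (p - 1)) * \<Psi> x \<partial>lborel)"
proof -
  interpret pair_sigma_finite lborel M
    by (intro pair_sigma_finite.intro sigma_finite_lborel sigma_finite_measure_axioms)
  let ?S = "{s :: real \<times> 'a. 0 < fst s \<and> L * fst s \<le> Z (snd s)}"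
  let ?g = "\<lambda>s :: real \<times> 'a. ennreal (p * fst s powr (p - 1)) * indicator ?S s"
  have gM: "?g \<in> borel_measurable (lborel \<Otimes>\<^sub>M M)"
  proof -
    have "{s \<in> space (lborel \<Otimes>\<^sub>M M). 0 < fst s \<and> L * fst s \<le> Z (snd s)} \<in> sets (lborel \<Otimes>\<^sub>M M)" by measurable
    then have "(\<lambda>s. ennreal (p * fst s powr (p - 1)) * indicator {s \<in> space (lborel \<Otimes>\<^sub>M M). 0 < fst s \<and> L * fst s \<le> Z (snd s)} s)
        \<in> borel_measurable (lborel \<Otimes>\<^sub>M M)" by measurable
    then show ?thesis by (rule measurable_cong[THEN iffD1, rotated]) (simp add: indicator_def)
  qed
  have "ennreal (Z \<omega> powr p) = ennreal (L powr p) * (\<integral>\<^sup>+x. ?g (x, \<omega>) \<partial>lborel)" for \<omega>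
  proof -
    let ?z = "Z \<omega> / L"
    have z: "0 \<le> ?z" using Z0 L by simp
    have "(\<integral>\<^sup>+x. ?g (x, \<omega>) \<partial>lborel) = (\<integral>\<^sup>+x. ennreal p * (ennreal (x powr (p - 1)) * indicator {0..?z} x) \<partial>lborel)"
    proof (intro nn_integral_cong)
      fix x :: real
      show "?g (x, \<omega>) = ennreal p * (ennreal (x powr (p - 1)) * indicator {0..?z} x)"
        using p L by (cases "x = 0") (auto simp: indicator_def field_simps ennreal_mult)
    qed
    also have "\<dots> = ennreal p * (\<integral>\<^sup>+x\<in>{0..?z}. ennreal (x powr (p - 1)) \<partial>lborel)"
      by (rule nn_integral_cmult) measurable
    also have "\<dots> = ennreal p * ennreal (?z powr p / p)" using nn_integral_powr_Icc[of "p - 1" ?z] p z by simp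
    also have "\<dots> = ennreal (?z powr p)" using p by (simp add: ennreal_mult[symmetric])
    finally show ?thesis using L Z0 by (simp add: ennreal_mult[symmetric] powr_divide)
  qed
  then have "(\<integral>\<^sup>+\<omega>. ennreal (Z \<omega> powr p) \<partial>M) = (\<integral>\<^sup>+\<omega>. ennreal (L powr p) * (\<integral>\<^sup>+x. ?g (x, \<omega>) \<partial>lborel) \<partial>M)"
    by simp
  also have "\<dots> = ennreal (L powr p) * (\<integral>\<^sup>+\<omega>. (\<integral>\<^sup>+x. ?g (x, \<omega>) \<partial>lborel) \<partial>M)"
  proof (rule nn_integral_cmult)
    have "(\<lambda>(\<omega>, x). ?g (x, \<omega>)) \<in> borel_measurable (M \<Otimes>\<^sub>M lborel)" by (rule measurable_pair_swap[OF gM])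
    from lborel.borel_measurable_nn_integral_fst[OF this]
    show "(\<lambda>\<omega>. \<integral>\<^sup>+x. ?g (x, \<omega>) \<partial>lborel) \<in> borel_measurable M" by (simp only: split_conv)
  qed
  also have "(\<integral>\<^sup>+\<omega>. (\<integral>\<^sup>+x. ?g (x, \<omega>) \<partial>lborel) \<partial>M) = (\<integral>\<^sup>+x. (\<integral>\<^sup>+\<omega>. ?g (x, \<omega>) \<partial>M) \<partial>lborel)"
    by (rule Fubini[OF gM])
  finally have swapped: "(\<integral>\<^sup>+\<omega>. ennreal (Z \<omega> powr p) \<partial>M)
    = ennreal (L powr p) * (\<integral>\<^sup>+x. (\<integral>\<^sup>+\<omega>. ?g (x, \<omega>) \<partial>M) \<partial>lborel)" .
  have "(\<integral>\<^sup>+x. (\<integral>\<^sup>+\<omega>. ?g (x, \<omega>) \<partial>M) \<partial>lborel) \<le> (\<integral>\<^sup>+x\<in>{0<..}. ennreal (p * x powr (p - 1)) * \<Psi> x \<partial>lborel)"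
  proof (rule nn_integral_mono)
    fix x :: real
    show "(\<integral>\<^sup>+\<omega>. ?g (x, \<omega>) \<partial>M) \<le> ennreal (p * x powr (p - 1)) * \<Psi> x * indicator {0<..} x"
    proof (cases "0 < x")
      case True
      have "(\<integral>\<^sup>+\<omega>. ?g (x, \<omega>) \<partial>M) = (\<integral>\<^sup>+\<omega>. ennreal (p * x powr (p - 1)) * indicator {\<omega>\<in>space M. L * x \<le> Z \<omega>} \<omega> \<partial>M)"
        using True by (intro nn_integral_cong) (auto simp: indicator_def)
      also have "\<dots> = ennreal (p * x powr (p - 1)) * emeasure M {\<omega>\<in>space M. L * x \<le> Z \<omega>}"
        by (rule nn_integral_cmult_indicator) measurable
      also have "\<dots> \<le> ennreal (p * x powr (p - 1)) * \<Psi> x" by (intro mult_left_mono tail True) simp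
      finally show ?thesis using True by simp
    next
      case False
      then show ?thesis by (simp add: indicator_def)
    qed
  qed
  then show ?thesis unfolding swapped by (rule mult_left_mono) simp
qed

text \<open>Up to \<open>sqrt y\<close> the trivial bound \<open>1\<close> is used; beyond it the power \<open>p\<close> of \<open>y / x\<^sup>2\<close> makes
  the integral converge.\<close>

lemma variance_part:
  assumes p: "2 \<le> p" and y: "0 \<le> y"
  shows "(\<integral>\<^sup>+x\<in>{0<..}. ennreal (p * x powr (p - 1)) * min 1 (ennreal (4 * (y / x\<^sup>2) powr p)) \<partial>lborel)
    \<le> ennreal (5 * y powr (p / 2))"
proof (cases "y = 0")
  case True
  then show ?thesis by simp
next
  case False
  then have y0: "0 < y" using y by simp
  define s where "s = sqrt y"
  have s0: "0 < s" using y0 by (simp add: s_def)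
  have sp: "s powr p = y powr (p / 2)" unfolding s_def using y0 by (simp add: powr_half_sqrt[symmetric] powr_powr)
  let ?f = "\<lambda>x. 4 * p * y powr p * x powr (- p - 1)"
  have "(\<integral>\<^sup>+x\<in>{0<..}. ennreal (p * x powr (p - 1)) * min 1 (ennreal (4 * (y / x\<^sup>2) powr p)) \<partial>lborel)
      \<le> (\<integral>\<^sup>+x. ennreal p * (ennreal (x powr (p - 1)) * indicator {0..s} x) + ennreal (?f x) * indicator {s..} x \<partial>lborel)"
  proof (rule nn_integral_mono)
    fix x :: real
    show "ennreal (p * x powr (p - 1)) * min 1 (ennreal (4 * (y / x\<^sup>2) powr p)) * indicator {0<..} x
        \<le> ennreal p * (ennreal (x powr (p - 1)) * indicator {0..s} x) + ennreal (?f x) * indicator {s..} x"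
    proof (cases "x \<le> s")
      case True
      have "ennreal (p * x powr (p - 1)) * min 1 (ennreal (4 * (y / x\<^sup>2) powr p)) * indicator {0<..} x
          \<le> ennreal (p * x powr (p - 1)) * 1 * indicator {0..s} x"
        using True by (intro mult_mono mult_left_mono) (auto simp: indicator_def)
      also have "\<dots> = ennreal p * (ennreal (x powr (p - 1)) * indicator {0..s} x)"
        using p by (simp add: ennreal_mult mult.assoc)
      finally show ?thesis by (rule order_trans) simp
    next
      case False
      then have x: "0 < x" "s \<le> x" using s0 by auto
      have "p * x powr (p - 1) * (4 * (y / x\<^sup>2) powr p) = ?f x"
      proof -
        have "x\<^sup>2 = x powr 2" using x by simp
        then have "(x\<^sup>2) powr p = x powr (2 * p)" by (simp only: powr_powr)
        then have "(y / x\<^sup>2) powr p = y powr p / x powr (2 * p)" by (simp only: powr_divide)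
        moreover have "x powr (p - 1) / x powr (2 * p) = x powr (- p - 1)"
          using powr_diff[of x "p - 1" "2 * p"] by simp
        ultimately show ?thesis by (metis (no_types, opaque_lifting) mult.assoc mult.commute times_divide_eq_right)
      qed
      then have "ennreal (p * x powr (p - 1)) * ennreal (4 * (y / x\<^sup>2) powr p) = ennreal (?f x)"
        using p by (subst ennreal_mult[symmetric]) auto
      moreover have "ennreal (p * x powr (p - 1)) * min 1 (ennreal (4 * (y / x\<^sup>2) powr p))
          \<le> ennreal (p * x powr (p - 1)) * ennreal (4 * (y / x\<^sup>2) powr p)" by (intro mult_left_mono) auto
      ultimately have "ennreal (p * x powr (p - 1)) * min 1 (ennreal (4 * (y / x\<^sup>2) powr p)) \<le> ennreal (?f x)" by simp
      then show ?thesis using x by (simp add: add_increasing)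
    qed
  qed
  also have "\<dots> = ennreal p * (\<integral>\<^sup>+x\<in>{0..s}. ennreal (x powr (p - 1)) \<partial>lborel) + (\<integral>\<^sup>+x\<in>{s..}. ennreal (?f x) \<partial>lborel)"
    by (subst nn_integral_add) (auto simp: nn_integral_cmult)
  also have "ennreal p * (\<integral>\<^sup>+x\<in>{0..s}. ennreal (x powr (p - 1)) \<partial>lborel) = ennreal (s powr p)"
    using nn_integral_powr_Icc[of "p - 1" s] p s0 by (simp add: ennreal_mult[symmetric])
  also have "(\<integral>\<^sup>+x\<in>{s..}. ennreal (?f x) \<partial>lborel) = ennreal (0 - - (4 * y powr p * s powr (- p)))"
  proof (rule nn_integral_FTC_atLeast)
    show "?f \<in> borel_measurable borel" by measurable
    show "((\<lambda>x. - (4 * y powr p * x powr (- p))) has_real_derivative ?f x) (at x)" if "s \<le> x" for x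
      using that s0 by (auto intro!: derivative_eq_intros)
    show "0 \<le> ?f x" if "s \<le> x" for x using p by simp
    have "((\<lambda>x. x powr (- p)) \<longlongrightarrow> 0) at_top" using p by (intro tendsto_neg_powr filterlim_ident) auto
    then have "((\<lambda>x. - (4 * y powr p * x powr (- p))) \<longlongrightarrow> - (4 * y powr p * 0)) at_top"
      by (intro tendsto_intros)
    then show "((\<lambda>x. - (4 * y powr p * x powr (- p))) \<longlongrightarrow> 0) at_top" by simp
  qed
  also have "0 - - (4 * y powr p * s powr (- p)) = 4 * y powr (p / 2)"
  proof -
    have "s powr (- p) = inverse (y powr (p / 2))" by (simp only: powr_minus sp)
    moreover have "y powr p = y powr (p / 2) * y powr (p / 2)" by (subst powr_add[symmetric]) simp
    moreover have "y powr (p / 2) \<noteq> 0" using y0 by simp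
    ultimately show ?thesis by simp
  qed
  finally show ?thesis unfolding sp by (simp add: ennreal_plus[symmetric] del: ennreal_plus)
qed

context stationary_sequence
begin

lemma lag_le: "1 \<le> n \<Longrightarrow> lag n u \<le> enat n"
  by (auto simp: lag_def one_enat_def)

lemma lag_quantile_measurable:
  "(\<lambda>u. ennreal_of_enat (lag n u) * quantile_of H u) \<in> borel_measurable borel"
  by (rule borel_measurable_antimono_linorder) (intro mult_mono quantile_antimono; simp add: lag_antimono)

text \<open>Exchanging the integrals over \<open>x\<close> and \<open>u\<close> leaves, for each \<open>u\<close>, the integral of
  \<open>x\<^sup>p\<^sup>-\<^sup>2\<close> up to \<open>lag n u * Q u\<close>; the factor \<open>p / (p - 1)\<close> that it produces is at most
  \<open>2\<close>.\<close>

lemma mixing_part: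
  assumes p: "2 \<le> p" and n: "1 \<le> n"
  shows "(\<integral>\<^sup>+x\<in>{0<..}. ennreal (p * x powr (p - 1)) * (ennreal (48 * real n / x) * tail_integral (quantile_of H) n x) \<partial>lborel)
    \<le> of_nat (96 * n) * (\<integral>\<^sup>+u\<in>{0..1}. epowr (ennreal_of_enat (lag n u)) (p - 1) * epowr (quantile_of H u) p \<partial>lborel)"
proof -
  let ?Q = "quantile_of H"
  define w where "w u = ennreal_of_enat (lag n u) * ?Q u" for u
  have wM [measurable]: "w \<in> borel_measurable borel" unfolding w_def[abs_def] by (rule lag_quantile_measurable)
  let ?k = "\<lambda>s :: real \<times> real. ennreal (48 * real n * p * fst s powr (p - 2)) *
    (?Q (snd s) * (if ennreal (fst s) \<le> w (snd s) \<and> 0 < fst s \<and> snd s \<in> {0..1} then 1 else 0))"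
  have kM: "?k \<in> borel_measurable (lborel \<Otimes>\<^sub>M lborel)" by measurable
  have "(\<integral>\<^sup>+x\<in>{0<..}. ennreal (p * x powr (p - 1)) * (ennreal (48 * real n / x) * tail_integral ?Q n x) \<partial>lborel)
      = (\<integral>\<^sup>+x. (\<integral>\<^sup>+u. ?k (x, u) \<partial>lborel) \<partial>lborel)"
  proof (rule nn_integral_cong)
    fix x :: real
    show "ennreal (p * x powr (p - 1)) * (ennreal (48 * real n / x) * tail_integral ?Q n x) * indicator {0<..} x
        = (\<integral>\<^sup>+u. ?k (x, u) \<partial>lborel)"
    proof (cases "0 < x")
      case True
      have "ennreal (p * x powr (p - 1)) * ennreal (48 * real n / x) = ennreal (48 * real n * p * x powr (p - 2))"
      proof -
        have "x powr (p - 1) / x = x powr (p - 2)"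
          using True powr_diff[of x "p - 1" 1] by simp
        moreover have "p * x powr (p - 1) * (48 * real n / x) = 48 * real n * p * (x powr (p - 1) / x)" by simp
        ultimately have "p * x powr (p - 1) * (48 * real n / x) = 48 * real n * p * x powr (p - 2)" by (simp only:)
        then show ?thesis using p True by (subst ennreal_mult[symmetric]) auto
      qed
      then have weighted: "ennreal (p * x powr (p - 1)) * (ennreal (48 * real n / x) * tail_integral ?Q n x)
          = ennreal (48 * real n * p * x powr (p - 2)) * tail_integral ?Q n x"
        by (simp only: mult.assoc[symmetric])
      have ti: "tail_integral ?Q n x = (\<integral>\<^sup>+u. ?Q u * (if ennreal x \<le> w u \<and> 0 < x \<and> u \<in> {0..1} then 1 else 0) \<partial>lborel)"
        unfolding tail_integral_def w_def[symmetric] using True by (intro nn_integral_cong) (auto simp: indicator_def)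
      have "ennreal (48 * real n * p * x powr (p - 2)) * tail_integral ?Q n x = (\<integral>\<^sup>+u. ?k (x, u) \<partial>lborel)"
        unfolding ti by (subst nn_integral_cmult[symmetric]) (auto simp: fst_conv snd_conv)
      then show ?thesis unfolding weighted using True by simp
    qed simp
  qed
  also have "\<dots> = (\<integral>\<^sup>+u. (\<integral>\<^sup>+x. ?k (x, u) \<partial>lborel) \<partial>lborel)" by (rule lborel_pair.Fubini[OF kM, symmetric])
  also have "\<dots> \<le> (\<integral>\<^sup>+u. of_nat (96 * n) * (epowr (ennreal_of_enat (lag n u)) (p - 1) * epowr (?Q u) p * indicator {0..1} u) \<partial>lborel)"
  proof (rule nn_integral_mono)
    fix u :: real
    show "(\<integral>\<^sup>+x. ?k (x, u) \<partial>lborel) \<le> of_nat (96 * n) * (epowr (ennreal_of_enat (lag n u)) (p - 1) * epowr (?Q u) p * indicator {0..1} u)"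
    proof (cases "u \<in> {0..1}")
      case True
      obtain r where r: "lag n u = enat r" using lag_le[OF n] enat_ile by blast
      have "1 \<le> lag n u" unfolding lag_def by (rule max.cobounded1)
      then have r1: "1 \<le> r" unfolding r by (simp add: one_enat_def)
      show ?thesis
      proof (cases "?Q u")
        case (real a)
        have wa: "w u = ennreal (real r * a)" unfolding w_def r real using real
          by (simp add: ennreal_of_nat_eq_real_of_nat ennreal_mult)
        have ra: "0 \<le> real r * a" using real by simp
        have "(\<integral>\<^sup>+x. ?k (x, u) \<partial>lborel) = (\<integral>\<^sup>+x. ennreal (48 * real n * p * a) * (ennreal (x powr (p - 2)) * indicator {0<..real r * a} x) \<partial>lborel)"
        proof (rule nn_integral_cong)
          fix x :: real
          show "?k (x, u) = ennreal (48 * real n * p * a) * (ennreal (x powr (p - 2)) * indicator {0<..real r * a} x)"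
          proof (cases "0 < x \<and> x \<le> real r * a")
            case in_range: True
            have "ennreal (48 * real n * p * x powr (p - 2)) * ennreal a = ennreal (48 * real n * p * a) * ennreal (x powr (p - 2))"
              using p real(1) by (simp add: ennreal_mult[symmetric] mult_ac)
            moreover have "ennreal x \<le> w u" unfolding wa using in_range by (intro ennreal_leI) simp
            ultimately show ?thesis using in_range True real(2) by simp
          next
            case False
            then have "\<not> (ennreal x \<le> w u \<and> 0 < x)" unfolding wa ennreal_le_iff[OF ra] by auto
            then show ?thesis using False by auto
          qed
        qed
        also have "\<dots> \<le> (\<integral>\<^sup>+x. ennreal (48 * real n * p * a) * (ennreal (x powr (p - 2)) * indicator {0..real r * a} x) \<partial>lborel)"
          by (intro nn_integral_mono mult_left_mono) (auto simp: indicator_def)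
        also have "\<dots> = ennreal (48 * real n * p * a) * (\<integral>\<^sup>+x\<in>{0..real r * a}. ennreal (x powr (p - 2)) \<partial>lborel)"
          by (rule nn_integral_cmult) measurable
        also have "\<dots> = ennreal (48 * real n * p * a) * ennreal ((real r * a) powr (p - 1) / (p - 1))"
          using nn_integral_powr_Icc[of "p - 2" "real r * a"] p ra by simp
        also have "\<dots> = ennreal (48 * real n * p * a * ((real r * a) powr (p - 1) / (p - 1)))"
          using p real by (intro ennreal_mult[symmetric]) auto
        also have "\<dots> \<le> ennreal (96 * real n * (real r powr (p - 1) * a powr p))"
        proof (rule ennreal_leI)
          have pp: "p / (p - 1) \<le> 2" using p by (simp add: field_simps)
          have "a * a powr (p - 1) = a powr p"
            using real(1) powr_add[of a 1 "p - 1"] by (cases "a = 0") auto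
          then have "48 * real n * p * a * ((real r * a) powr (p - 1) / (p - 1))
              = 48 * real n * (p / (p - 1)) * (real r powr (p - 1) * a powr p)"
            using real(1) by (simp add: powr_mult)
          also have "\<dots> \<le> 48 * real n * 2 * (real r powr (p - 1) * a powr p)"
            using pp by (intro mult_right_mono mult_left_mono) auto
          finally show "48 * real n * p * a * ((real r * a) powr (p - 1) / (p - 1)) \<le> 96 * real n * (real r powr (p - 1) * a powr p)" by simp
        qed
        also have "\<dots> = of_nat (96 * n) * (epowr (ennreal_of_enat (lag n u)) (p - 1) * epowr (?Q u) p * indicator {0..1} u)"
        proof -
          have "epowr (ennreal_of_enat (lag n u)) (p - 1) = ennreal (real r powr (p - 1))"
            unfolding r by (simp add: ennreal_of_nat_eq_real_of_nat epowr_ennreal)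
          moreover have "epowr (?Q u) p = ennreal (a powr p)" using real by (simp add: epowr_ennreal)
          ultimately show ?thesis using True by (simp add: ennreal_of_nat_eq_real_of_nat ennreal_mult[symmetric])
        qed
        finally show ?thesis .
      next
        case top
        have "of_nat (96 * n) * (epowr (ennreal_of_enat (lag n u)) (p - 1) * epowr (?Q u) p * indicator {0..1} u) = top"
          using True n r r1 by (simp add: top epowr_def ennreal_mult_top ennreal_top_mult ennreal_of_nat_eq_real_of_nat)
        then show ?thesis by simp
      qed
    next
      case False
      have zero: "?k (x, u) = 0" for x using False by auto
      show ?thesis unfolding zero by simp
    qed
  qed
  also have "\<dots> = of_nat (96 * n) * (\<integral>\<^sup>+u\<in>{0..1}. epowr (ennreal_of_enat (lag n u)) (p - 1) * epowr (?Q u) p \<partial>lborel)"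
  proof (rule nn_integral_cmult)
    have "(\<lambda>u. epowr (ennreal_of_enat (lag n u)) (p - 1) * epowr (?Q u) p) \<in> borel_measurable borel"
      using p by (intro borel_measurable_antimono_linorder mult_mono epowr_mono quantile_antimono) (auto simp: lag_antimono)
    then show "(\<lambda>u. epowr (ennreal_of_enat (lag n u)) (p - 1) * epowr (?Q u) p * indicator {0..1} u) \<in> borel_measurable lborel"
      by measurable
  qed
  finally show ?thesis .
qed

text \<open>Raising \<open>\<alpha>\<inverse> u\<close> to at least \<open>1\<close> changes it only for \<open>u \<ge> 1/2\<close>, which costs a
  constant because the integrand decreases.\<close>

lemma lag_integral:
  assumes p: "2 \<le> p" and n: "1 \<le> n"
  shows "(\<integral>\<^sup>+u\<in>{0..1}. epowr (ennreal_of_enat (lag n u)) (p - 1) * epowr (quantile_of H u) p \<partial>lborel)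
    \<le> 4 * (\<integral>\<^sup>+u\<in>{0..1}. epowr (ennreal_of_enat (min (alpha_inv (\<alpha> 2) u) (enat n))) (p - 1) * epowr (quantile_of H u) p \<partial>lborel)"
proof -
  let ?l = "\<lambda>u. epowr (ennreal_of_enat (lag n u)) (p - 1) * epowr (quantile_of H u) p"
  have "(\<integral>\<^sup>+u\<in>{0..1}. ?l u \<partial>lborel) \<le> 4 * (\<integral>\<^sup>+u\<in>{0..1 / 4}. ?l u \<partial>lborel)"
    using p by (intro nn_integral_antimono_quarter mult_mono epowr_mono quantile_antimono) (auto simp: lag_antimono)
  also have "\<dots> \<le> 4 * (\<integral>\<^sup>+u\<in>{0..1}. epowr (ennreal_of_enat (min (alpha_inv (\<alpha> 2) u) (enat n))) (p - 1) * epowr (quantile_of H u) p \<partial>lborel)"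
  proof (intro mult_left_mono nn_integral_mono)
    fix u :: real
    have "lag n u = min (alpha_inv (\<alpha> 2) u) (enat n)" if u: "u \<in> {0..1 / 4}"
    proof -
      have "\<not> alpha_inv (\<alpha> 2) u \<le> enat 0"
      proof
        assume "alpha_inv (\<alpha> 2) u \<le> enat 0"
        then obtain r where "r \<le> 0" "\<alpha> 2 r \<le> ennreal u" by (rule alpha_inv_attained)
        then have "ennreal (1 / 2) \<le> ennreal u" by (simp add: alpha_seq_def)
        then show False using u by (subst (asm) ennreal_le_iff) auto
      qed
      then have "1 \<le> alpha_inv (\<alpha> 2) u" by (simp add: one_eSuc ileI1 zero_enat_def[symmetric])
      then have "1 \<le> min (alpha_inv (\<alpha> 2) u) (enat n)" using n by (simp add: one_enat_def)
      then show ?thesis by (simp add: lag_def max_absorb2)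
    qed
    then show "?l u * indicator {0..1 / 4} u \<le> epowr (ennreal_of_enat (min (alpha_inv (\<alpha> 2) u) (enat n))) (p - 1) * epowr (quantile_of H u) p * indicator {0..1} u"
      by (cases "u \<in> {0..1 / 4}") auto
  qed simp
  finally show ?thesis .
qed

text \<open>If the integral of \<open>(\<alpha>\<inverse> \<and> n) Q\<^sup>2\<close> is infinite, so is the right-hand side; otherwise the
  tail bound is integrated. The factor \<open>384\<close> is \<open>96\<close> from \<open>mixing_part\<close> times \<open>4\<close> from
  \<open>lag_integral\<close>, and \<open>64\<close> is twice the constant \<open>32\<close> in the variance of a block.\<close>

lemma rosenthal_inequality:
  assumes H: "tail_function H" and f: "f \<in> F_class H \<mu>" and p: "2 \<le> p" and Qp: "quantile_in_Lp p (quantile_of H)" and n: "1 \<le> n"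
  shows "(\<integral>\<^sup>+\<omega>. ennreal ((MAX k\<in>{1..n}. \<bar>\<Sum>j\<in>{1..k}. cen j f \<omega>\<bar>) powr p) \<partial>M)
    \<le> ennreal ((16 * p + 15) powr p * (5 * 64 powr (p / 2) + 384)) *
      (ennreal (real n powr (p / 2)) *
          epowr (\<integral>\<^sup>+u\<in>{0..1}. ennreal_of_enat (min (alpha_inv (\<alpha> 1) u) (enat n)) * (quantile_of H u)\<^sup>2 \<partial>lborel) (p / 2)
        + of_nat n *
          (\<integral>\<^sup>+u\<in>{0..1}. epowr (ennreal_of_enat (min (alpha_inv (\<alpha> 2) u) (enat n))) (p - 1) * epowr (quantile_of H u) p \<partial>lborel))"
    (is "?lhs \<le> ennreal ?C * (ennreal ?np * epowr ?A (p / 2) + of_nat n * ?B)")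
proof (cases "?A = top")
  case True
  have "0 < ?C" using p by (intro mult_pos_pos add_pos_pos) auto
  then have C: "ennreal ?C \<noteq> 0" by (simp only: ennreal_eq_0_iff not_le)
  have "ennreal ?np * epowr top (p / 2) = top" using n by (simp add: epowr_def ennreal_mult_top)
  then have infinite: "ennreal ?np * epowr ?A (p / 2) + of_nat n * ?B = top" unfolding True by simp
  show ?thesis unfolding infinite ennreal_mult_top if_not_P[OF C] by (rule top_greatest)
next
  case False
  then obtain A where A: "0 \<le> A" "?A = ennreal A" by (cases ?A) auto
  have Q1: "(\<integral>\<^sup>+u\<in>{0..1}. quantile_of H u \<partial>lborel) < \<infinity>"
  proof -
    have "(\<integral>\<^sup>+u\<in>{0..1}. quantile_of H u \<partial>lborel) \<le> (\<integral>\<^sup>+u. indicator {0..1} u + epowr (quantile_of H u) p * indicator {0..1} u \<partial>lborel)"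
    proof (rule nn_integral_mono)
      fix u :: real
      have "quantile_of H u \<le> 1 + epowr (quantile_of H u) p"
      proof (cases "quantile_of H u")
        case (real a)
        have "a \<le> 1 + a powr p"
        proof (cases "a \<le> 1")
          case True
          then show ?thesis by (simp add: add_increasing2)
        next
          case False
          then have "a powr 1 \<le> a powr p" using p by (intro powr_mono) auto
          then show ?thesis using real False by simp
        qed
        then have "ennreal a \<le> ennreal (1 + a powr p)" by (rule ennreal_leI)
        then show ?thesis using real by (simp add: epowr_ennreal)
      qed (simp add: epowr_def)
      then show "quantile_of H u * indicator {0..1} u \<le> indicator {0..1} u + epowr (quantile_of H u) p * indicator {0..1} u"
        by (auto simp: indicator_def)
    qed
    also have "\<dots> = (\<integral>\<^sup>+u. indicator {0..1::real} u \<partial>lborel) + (\<integral>\<^sup>+u\<in>{0..1}. epowr (quantile_of H u) p \<partial>lborel)"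
    proof (rule nn_integral_add)
      have [measurable]: "(\<lambda>u. epowr (quantile_of H u) p) \<in> borel_measurable borel"
        using p by (intro borel_measurable_antimono_linorder epowr_mono quantile_antimono) auto
      show "(\<lambda>u. epowr (quantile_of H u) p * indicator {0..1} u) \<in> borel_measurable lborel" by measurable
    qed measurable
    also have "\<dots> < \<infinity>" using Qp by (simp add: quantile_in_Lp_def)
    finally show ?thesis .
  qed
  let ?L = "16 * p + 15" and ?y = "64 * real n * A"
  let ?Z = "\<lambda>\<omega>. MAX k\<in>{1..n}. \<bar>\<Sum>j\<in>{1..k}. cen j f \<omega>\<bar>"
  let ?g = "\<lambda>x. min 1 (ennreal (4 * (?y / x\<^sup>2) powr p))" and ?m = "\<lambda>x. ennreal (48 * real n / x) * tail_integral (quantile_of H) n x"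
  have y: "0 \<le> ?y" using A by simp
  have fM [measurable]: "f \<in> borel_measurable borel" using f by (auto simp: F_class_def)
  have ZM: "?Z \<in> borel_measurable M"
    using n by (intro borel_measurable_Max borel_measurable_abs borel_measurable_sum cen_meas fM) auto
  have Z0: "0 \<le> ?Z \<omega>" for \<omega>
  proof -
    have "\<bar>\<Sum>j\<in>{1..1}. cen j f \<omega>\<bar> \<le> ?Z \<omega>"
      by (rule Max_ge, simp, rule image_eqI[where x = 1]) (use n in simp_all)
    then show ?thesis using abs_ge_zero order_trans by blast
  qed
  have tail: "emeasure M {\<omega>\<in>space M. ?L * x \<le> ?Z \<omega>} \<le> ?g x + ?m x" if x: "0 < x" for x
  proof -
    have "emeasure M {\<omega>\<in>space M. ?L * x \<le> ?Z \<omega>} \<le> emeasure M {\<omega>\<in>space M. \<exists>k\<le>n. ?L * x \<le> \<bar>\<Sum>j\<in>{1..k}. cen j f \<omega>\<bar>}"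
    proof (rule emeasure_mono)
      have "\<exists>k\<le>n. ?Z \<omega> = \<bar>\<Sum>j\<in>{1..k}. cen j f \<omega>\<bar>" for \<omega>
      proof -
        have "?Z \<omega> \<in> (\<lambda>k. \<bar>\<Sum>j\<in>{1..k}. cen j f \<omega>\<bar>) ` {1..n}" using n by (intro Max_in) auto
        then obtain k where k: "k \<in> {1..n}" and eq: "?Z \<omega> = \<bar>\<Sum>j\<in>{1..k}. cen j f \<omega>\<bar>" by (elim imageE)
        have "k \<le> n" using k by simp
        with eq show ?thesis by (intro exI[of _ k] conjI)
      qed
      then show "{\<omega>\<in>space M. ?L * x \<le> ?Z \<omega>} \<subseteq> {\<omega>\<in>space M. \<exists>k\<le>n. ?L * x \<le> \<bar>\<Sum>j\<in>{1..k}. cen j f \<omega>\<bar>}"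
        by (intro Collect_mono impI) metis
      have [measurable]: "cen j f \<in> borel_measurable M" for j by (rule cen_meas[OF fM])
      show "{\<omega>\<in>space M. \<exists>k\<le>n. ?L * x \<le> \<bar>\<Sum>j\<in>{1..k}. cen j f \<omega>\<bar>} \<in> sets M"
        by (rule prefix_max_event_measurable) measurable
    qed
    also have "\<dots> \<le> ennreal (4 * (?y / x\<^sup>2) powr p) + ?m x"
      by (rule F_class_deviation[OF H f Q1 p n x A])
    finally have "emeasure M {\<omega>\<in>space M. ?L * x \<le> ?Z \<omega>} \<le> ennreal (4 * (?y / x\<^sup>2) powr p) + ?m x" .
    moreover have "emeasure M {\<omega>\<in>space M. ?L * x \<le> ?Z \<omega>} \<le> 1 + ?m x"
      using emeasure_le_1 by (rule order_trans) simp
    ultimately show ?thesis by (simp add: min_def)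
  qed
  have "?lhs \<le> ennreal (?L powr p) * (\<integral>\<^sup>+x\<in>{0<..}. ennreal (p * x powr (p - 1)) * (?g x + ?m x) \<partial>lborel)"
    using p tail by (intro moment_le_tail_integral ZM Z0) auto
  also have "(\<integral>\<^sup>+x\<in>{0<..}. ennreal (p * x powr (p - 1)) * (?g x + ?m x) \<partial>lborel)
      = (\<integral>\<^sup>+x. ennreal (p * x powr (p - 1)) * ?g x * indicator {0<..} x + ennreal (p * x powr (p - 1)) * ?m x * indicator {0<..} x \<partial>lborel)"
    by (simp only: distrib_left distrib_right)
  also have "\<dots> = (\<integral>\<^sup>+x\<in>{0<..}. ennreal (p * x powr (p - 1)) * ?g x \<partial>lborel) + (\<integral>\<^sup>+x\<in>{0<..}. ennreal (p * x powr (p - 1)) * ?m x \<partial>lborel)"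
  proof (rule nn_integral_add)
    have "(\<lambda>x. tail_integral (quantile_of H) n x) \<in> borel_measurable borel"
      unfolding tail_integral_def
    proof (rule borel_measurable_antimono_linorder, rule nn_integral_mono)
      fix x x' u :: real assume "x \<le> x'"
      then have "ennreal x \<le> ennreal x'" by (rule ennreal_leI)
      then show "quantile_of H u * indicator {u. ennreal x' \<le> ennreal_of_enat (lag n u) * quantile_of H u} u * indicator {0..1} u
          \<le> quantile_of H u * indicator {u. ennreal x \<le> ennreal_of_enat (lag n u) * quantile_of H u} u * indicator {0..1} u"
        by (intro mult_mono mult_left_mono) (auto simp: indicator_def intro: order_trans)
    qed
    then show "(\<lambda>x. ennreal (p * x powr (p - 1)) * ?m x * indicator {0<..} x) \<in> borel_measurable lborel" by measurable
  qed measurable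
  also have "\<dots> \<le> ennreal (5 * ?y powr (p / 2)) + of_nat (96 * n) * (4 * ?B)"
    by (intro add_mono variance_part[OF p y] order_trans[OF mixing_part[OF p n]] mult_left_mono lag_integral[OF p n]) simp
  also have "\<dots> \<le> ennreal (5 * 64 powr (p / 2) + 384) * (ennreal ?np * epowr ?A (p / 2) + of_nat n * ?B)"
  proof -
    let ?c = "5 * 64 powr (p / 2) :: real"
    have "ennreal (5 * ?y powr (p / 2)) = ennreal ?c * (ennreal ?np * epowr ?A (p / 2))"
      unfolding A(2) using A(1) by (simp add: epowr_ennreal ennreal_mult[symmetric] powr_mult mult_ac)
    also have "\<dots> \<le> ennreal (?c + 384) * (ennreal ?np * epowr ?A (p / 2))"
      by (intro mult_right_mono ennreal_leI) auto
    finally have 1: "ennreal (5 * ?y powr (p / 2)) \<le> ennreal (?c + 384) * (ennreal ?np * epowr ?A (p / 2))" .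
    have "of_nat (96 * n) * (4 * ?B) = ennreal 384 * (of_nat n * ?B)"
      by (simp add: mult_ac)
    also have "\<dots> \<le> ennreal (?c + 384) * (of_nat n * ?B)"
      by (intro mult_right_mono ennreal_leI) auto
    finally have 2: "of_nat (96 * n) * (4 * ?B) \<le> ennreal (?c + 384) * (of_nat n * ?B)" .
    show ?thesis using add_mono[OF 1 2] by (simp only: distrib_left)
  qed
  finally have "?lhs \<le> ennreal (?L powr p) * (ennreal (5 * 64 powr (p / 2) + 384) * (ennreal ?np * epowr ?A (p / 2) + of_nat n * ?B))"
    by (simp add: mult_left_mono)
  also have "\<dots> = ennreal ?C * (ennreal ?np * epowr ?A (p / 2) + of_nat n * ?B)"
    by (subst ennreal_mult) (auto simp: mult.assoc)
  finally show ?thesis .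
qed

end

section \<open>The Rosenthal inequality\<close>

theorem theorem3p1:
  fixes M F0 :: "'a measure" and T :: "'a \<Rightarrow> 'a" and Y0 :: "'a \<Rightarrow> real"
    and Y :: "int \<Rightarrow> 'a \<Rightarrow> real"
    and p :: real and H :: "real \<Rightarrow> real" and Q :: "real \<Rightarrow> ennreal"
    and f :: "real \<Rightarrow> real" and X :: "int \<Rightarrow> 'a \<Rightarrow> real" and S :: "nat \<Rightarrow> 'a \<Rightarrow> real"
  assumes "prob_space M"
    and "bimeasurable_preserving M T"
    and "subalgebra M F0"
    and "sets F0 \<subseteq> {T -` A \<inter> space M | A. A \<in> sets F0}"
    and "Y0 \<in> borel_measurable F0" and "integrable M Y0"
    and Y_def: "\<And>i. Y i = orbit_seq M T Y0 i"
    and "2 \<le> p"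
    and "tail_function H" and "Q = quantile_of H" and "quantile_in_Lp p Q"
    and "f \<in> F_class H (distr M borel Y0)"
    and X_def: "\<And>i. X i = (\<lambda>\<omega>. f (Y i \<omega>) - integral\<^sup>L M (\<lambda>\<omega>. f (Y i \<omega>)))"
    and S_def: "\<And>n. S n = (\<lambda>\<omega>. \<Sum>k\<in>{1..n}. X (int k) \<omega>)"
  shows "\<exists>C>0. \<forall>n\<ge>1.
    epowr (lp_norm M p (\<lambda>\<omega>. MAX k\<in>{1..n}. \<bar>S k \<omega>\<bar>)) p
    \<le> ennreal C *
       (ennreal (real n powr (p / 2)) *
          epowr (\<integral>\<^sup>+u\<in>{0..1}. ennreal_of_enat (min (alpha_inv (alpha_seq M F0 Y 1) u) (enat n))
                   * (Q u)\<^sup>2 \<partial>lborel) (p / 2)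
        + of_nat n *
          (\<integral>\<^sup>+u\<in>{0..1}. epowr (ennreal_of_enat (min (alpha_inv (alpha_seq M F0 Y 2) u) (enat n))) (p - 1)
                   * epowr (Q u) p \<partial>lborel))"
proof -
  have Y: "Y = orbit_seq M T Y0" using Y_def by (intro ext) simp
  interpret seq: stationary_sequence M F0 T Y0
  proof (intro stationary_sequence.intro stationary_sequence_axioms.intro)
    show "T \<in> measurable M M" "distr M M T = M"
      using \<open>bimeasurable_preserving M T\<close> by (auto simp: bimeasurable_preserving_def)
  qed fact+
  have X: "X (int j) = seq.cen j f" for j
    unfolding X_def Y seq.orbit_seq_Y seq.cen_def ..
  have S: "S k \<omega> = (\<Sum>j\<in>{1..k}. seq.cen j f \<omega>)" for k \<omega>
    unfolding S_def X ..
  let ?Z = "\<lambda>n \<omega>. MAX k\<in>{1..n}. \<bar>\<Sum>j\<in>{1..k}. seq.cen j f \<omega>\<bar>"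
  have lhs: "epowr (lp_norm M p (\<lambda>\<omega>. MAX k\<in>{1..n}. \<bar>S k \<omega>\<bar>)) p = (\<integral>\<^sup>+\<omega>. ennreal (?Z n \<omega> powr p) \<partial>M)"
    if n: "1 \<le> n" for n
  proof -
    have "\<bar>?Z n \<omega>\<bar> = ?Z n \<omega>" for \<omega>
    proof -
      have "\<bar>\<Sum>j\<in>{1..1}. seq.cen j f \<omega>\<bar> \<le> ?Z n \<omega>"
        by (rule Max_ge, simp, rule image_eqI[where x = 1]) (use n in simp_all)
      then have "0 \<le> ?Z n \<omega>" by (rule order_trans[OF abs_ge_zero])
      then show ?thesis by (rule abs_of_nonneg)
    qed
    moreover have "0 < p" using \<open>2 \<le> p\<close> by simp
    ultimately show ?thesis unfolding lp_norm_def S by (simp only: epowr_root)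
  qed
  let ?C = "(16 * p + 15) powr p * (5 * 64 powr (p / 2) + 384)"
  show ?thesis
  proof (intro exI[of _ ?C] conjI allI impI)
    show "0 < ?C" using \<open>2 \<le> p\<close> by (intro mult_pos_pos add_pos_pos) auto
    fix n :: nat assume n: "1 \<le> n"
    have Qp: "quantile_in_Lp p (quantile_of H)" using \<open>quantile_in_Lp p Q\<close> \<open>Q = quantile_of H\<close> by simp
    show "epowr (lp_norm M p (\<lambda>\<omega>. MAX k\<in>{1..n}. \<bar>S k \<omega>\<bar>)) p
      \<le> ennreal ?C *
       (ennreal (real n powr (p / 2)) *
          epowr (\<integral>\<^sup>+u\<in>{0..1}. ennreal_of_enat (min (alpha_inv (alpha_seq M F0 Y 1) u) (enat n))
                   * (Q u)\<^sup>2 \<partial>lborel) (p / 2)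
        + of_nat n *
          (\<integral>\<^sup>+u\<in>{0..1}. epowr (ennreal_of_enat (min (alpha_inv (alpha_seq M F0 Y 2) u) (enat n))) (p - 1)
                   * epowr (Q u) p \<partial>lborel))"
      unfolding lhs[OF n] Y \<open>Q = quantile_of H\<close>
      by (rule seq.rosenthal_inequality[OF \<open>tail_function H\<close> \<open>f \<in> F_class H (distr M borel Y0)\<close> \<open>2 \<le> p\<close> Qp n])
  qed
qed


end
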